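(* Let $p$ be a prime and $q$ a prime power such that $p\equiv 3 \pmod 4$ and $q-1=p(p-3)/4$. Then there exist two nonisomorphic directed strongly regular graphs with parameters $$\left((q+1)p,\; q+\frac{p-1}{2},\; q,\; \frac{q-1}{p},\; \frac{q-1}{p}+1\right)$$ and automorphism group isomorphic to $\mathrm{P\Gamma L}(2,q)$.
   Context: A directed strongly regular graph with parameters $(v,k,t,\lambda,\mu)$ is a (loopless) directed graph on $v$ vertices such that every vertex has indegree and outdegree $k$ and, for any two vertices $\alpha,\beta$ (possibly equal), the number of directed paths of the form $\alpha\to\gamma\to\beta$ equals $t$ if $\alpha=\beta$, equals $\lambda$ if $(\alpha,\beta)$ is an arc, and equals $\mu$ if $\alpha\neq\beta$ and $(\alpha,\beta)$ is not an arc. (Both $(\alpha,\beta)$ and $(\beta,\alpha)$ may be arcs.) The automorphism group of a digraph is the group of all permutations of its vertex set preserving the arc set. $\mathrm{P\Gamma L}(2,q)=\mathrm{PGL}(2,q)\rtimes \mathrm{Aut}(\mathbb{F}_q)$ is the projective semilinear group of dimension $2$ over the field of order $q$. A prime power is a number $r^d$ with $r$ prime and $d\ge 1$. *)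

theory Defs
  imports
    "Graph_Theory.Graph_Theory"
    "Jordan_Normal_Form.Matrix"
    "Jordan_Normal_Form.Ring_Hom_Matrix"
    "HOL-Algebra.Bij"
    "HOL-Algebra.Coset"
    "HOL-Library.Cardinality"
    "HOL-Number_Theory.Prime_Powers"
begin

section \<open>Directed strongly regular graphs\<close>

text \<open>The locale \<^locale>\<open>pair_digraph\<close> provides finite loopless digraphs whose arcs are ordered
  pairs of vertices; opposite arcs may both be present.  A directed path of the form
  \<open>\<alpha> \<rightarrow> \<gamma> \<rightarrow> \<beta>\<close> is determined by its middle vertex \<open>\<gamma>\<close>.\<close>

locale directed_strongly_regular_graph = pair_digraph G
  for G :: "'a pair_pre_digraph" +
  fixes v k t l m :: nat
  assumes card_verts: "card (pverts G) = v"
    and in_degree_eq: "\<alpha> \<in> pverts G \<Longrightarrow> in_degree (with_proj G) \<alpha> = k"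
    and out_degree_eq: "\<alpha> \<in> pverts G \<Longrightarrow> out_degree (with_proj G) \<alpha> = k"
    and paths_same: "\<alpha> \<in> pverts G \<Longrightarrow>
      card {\<gamma> \<in> pverts G. (\<alpha>, \<gamma>) \<in> parcs G \<and> (\<gamma>, \<alpha>) \<in> parcs G} = t"
    and paths_arc: "\<lbrakk>\<alpha> \<in> pverts G; \<beta> \<in> pverts G; (\<alpha>, \<beta>) \<in> parcs G\<rbrakk> \<Longrightarrow>
      card {\<gamma> \<in> pverts G. (\<alpha>, \<gamma>) \<in> parcs G \<and> (\<gamma>, \<beta>) \<in> parcs G} = l"
    and paths_nonarc: "\<lbrakk>\<alpha> \<in> pverts G; \<beta> \<in> pverts G; \<alpha> \<noteq> \<beta>; (\<alpha>, \<beta>) \<notin> parcs G\<rbrakk> \<Longrightarrow>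
      card {\<gamma> \<in> pverts G. (\<alpha>, \<gamma>) \<in> parcs G \<and> (\<gamma>, \<beta>) \<in> parcs G} = m"

text \<open>As in \<^const>\<open>BijGroup\<close>, permutations of the vertex set are extensional functions, so that
  each permutation is represented exactly once.\<close>

definition digraph_aut_group :: "'a pair_pre_digraph \<Rightarrow> ('a \<Rightarrow> 'a) monoid" where
  "digraph_aut_group G = BijGroup (pverts G)
     \<lparr>carrier := {f \<in> Bij (pverts G).
        \<forall>\<alpha>\<in>pverts G. \<forall>\<beta>\<in>pverts G. (f \<alpha>, f \<beta>) \<in> parcs G \<longleftrightarrow> (\<alpha>, \<beta>) \<in> parcs G}\<rparr>"

section \<open>The projective semilinear group\<close>

definition semidirect_product ::
  "('a, 'c) monoid_scheme \<Rightarrow> ('b, 'd) monoid_scheme \<Rightarrow> ('b \<Rightarrow> 'a \<Rightarrow> 'a) \<Rightarrow> ('a \<times> 'b) monoid"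
where
  "semidirect_product N H \<phi> =
     \<lparr>carrier = carrier N \<times> carrier H,
      mult = (\<lambda>(x, h) (y, k). (x \<otimes>\<^bsub>N\<^esub> \<phi> h y, h \<otimes>\<^bsub>H\<^esub> k)),
      one = (\<one>\<^bsub>N\<^esub>, \<one>\<^bsub>H\<^esub>)\<rparr>"

definition field_aut_group :: "'f::field itself \<Rightarrow> ('f \<Rightarrow> 'f) monoid" where
  "field_aut_group _ = BijGroup UNIV \<lparr>carrier := {\<sigma> \<in> Bij UNIV. field_hom \<sigma>}\<rparr>"

definition GL :: "nat \<Rightarrow> 'f::field itself \<Rightarrow> 'f mat monoid" where
  "GL n F = units_of (ring_mat F n ())"

definition scalar_mats :: "nat \<Rightarrow> 'f::field itself \<Rightarrow> 'f mat set" where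
  "scalar_mats n _ = {c \<cdot>\<^sub>m 1\<^sub>m n | c. c \<noteq> 0}"

definition PGL :: "nat \<Rightarrow> 'f::field itself \<Rightarrow> 'f mat set monoid" where
  "PGL n F = GL n F Mod scalar_mats n F"

text \<open>A field automorphism acts on PGL by acting on the entries of every matrix in a coset.\<close>

definition PGammaL :: "nat \<Rightarrow> 'f::field itself \<Rightarrow> ('f mat set \<times> ('f \<Rightarrow> 'f)) monoid" where
  "PGammaL n F = semidirect_product (PGL n F) (field_aut_group F) (\<lambda>\<sigma> X. map_mat \<sigma> ` X)"

end

theory Submission
  imports Defs "HOL-Number_Theory.Number_Theory" "HOL-Computational_Algebra.Polynomial"
begin

text \<open>Put \<open>e = (p - 3) / 4\<close>, so that \<open>q = 1 + p * e\<close>, and let \<open>K\<close> be the subgroup of order \<open>e\<close> of the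
  multiplicative group of the field \<open>F\<close> with \<open>q\<close> elements; the \<open>e\<close>-th power map identifies the cosets
  of \<open>K\<close> with the group \<open>mu\<close> of \<open>p\<close>-th roots of unity. The vertices are the nonzero vectors of \<open>F\<^sup>2\<close>
  modulo \<open>K\<close>. They fall into \<open>q + 1\<close> fibres of \<open>p\<close> vertices, one for each line. Two vertices of different
  fibres are joined in both directions if their determinant lies in \<open>K\<close>; this is an antipodal
  distance-regular cover of the complete graph, due to Mathon. Inside a fibre, a torsor of the group \<open>mu\<close>
  of order \<open>p \<equiv> 3 (mod 4)\<close>, the arcs form the Paley tournament: from \<open>u\<close> to \<open>s u\<close> with \<open>s ^ e\<close> in the set
  \<open>S\<close> of the powers of a generator whose exponents are nonzero squares modulo \<open>p\<close>. The second digraph uses the inverses of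
  \<open>S\<close>. A path with two steps outside the fibres, two steps inside, or one of each contributes to the path
  counts, and the three contributions add up to the parameters because the Paley counts
  \<open>(p - 3) / 4 = e\<close> and \<open>(p + 1) / 4 = e + 1\<close> match the count \<open>e\<close> for the cover
  (\<open>card_path_vectors_independent\<close>, \<open>card_path_vectors_dependent\<close>, \<open>mathon_digraph_dsrg\<close>).

  A semilinear map, corrected by a power of its determinant, acts on the vertices and preserves both
  digraphs (\<open>adjacent_semilinear\<close>); scalars act trivially. For the arcs inside the fibres this needs that
  field automorphisms preserve \<open>S\<close>, i.e. that the characteristic \<open>r\<close> is a square modulo \<open>p\<close>. It is,
  because \<open>q\<close> lies strictly between \<open>(2 * e)\<^sup>2\<close> and \<open>(2 * e + 1)\<^sup>2\<close>, so \<open>q\<close> is an odd power of \<open>r\<close>,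
  while \<open>q \<equiv> 1 (mod p)\<close> (\<open>Legendre_CHAR\<close>).

  The main point is the converse: every isomorphism between two digraphs of this kind is induced by a
  semilinear map. Since such a map is also an automorphism of the source, it follows at once that the
  automorphism groups are as claimed and that the two digraphs are not isomorphic
  (\<open>mathon_digraph_aut_group\<close>, \<open>mathon_digraph_map_imp_eq\<close>). An isomorphism respects the fibres and
  the undirected part. Comparing vertices with a common neighbour shows that it acts on all fibres through
  one and the same endomorphism of \<open>mu\<close>, so it raises the \<open>e\<close>-th powers of determinants to a fixed
  power (\<open>cover_map_determinant_power\<close>). In coordinates this yields a bijection \<open>f\<close> of \<open>F\<close> that
  fixes \<open>0\<close> and \<open>1\<close> and satisfies \<open>(f x - f y) ^ e = (x - y) ^ (e * a)\<close>, and such an \<open>f\<close> is a field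
  automorphism (\<open>power_residue_map_imp_field_hom\<close>), in the manner of the theorems of Carlitz and
  McConnell.

  For this last step, consider for each \<open>s\<close> the span, over all \<open>x\<close>, of the functions
  \<open>y \<mapsto> (f x - f y) ^ (e * s)\<close>. By the equation for \<open>f\<close> it is also spanned by powers of \<open>x - y\<close>, hence it
  is invariant under translations and dilations of \<open>y\<close>. On the other hand it consists of polynomials in
  \<open>f\<close> whose exponents are restricted by the base-\<open>r\<close> digits of \<open>e * s\<close>. These digits are the digits of
  \<open>s / p\<close>. Unless \<open>q = r\<close>, they vary enough for the intersection of the spans for all \<open>s\<close> prime to \<open>r\<close>
  to be spanned by \<open>1\<close> and \<open>f\<close>. So the translates and dilates of \<open>f\<close> have the form \<open>b + c * f\<close>, which
  makes \<open>f\<close> additive and multiplicative. For \<open>q = r\<close> a comparison of degrees shows that \<open>f\<close> is the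
  identity.\<close>

hide_const (open) up_ring.monom up_ring.coeff

section \<open>Functions on a finite field as polynomials\<close>

lemma prime_CHAR_finite_field: "prime CHAR('f::{field,finite})"
  by (rule prime_CHAR_semidom) (rule finite_imp_CHAR_pos, simp)

lemma card_field_eq_CHAR_power:
  assumes "primepow CARD('f::{field,finite})"
  obtains d where "d \<ge> 1" and "CARD('f) = CHAR('f) ^ d"
proof -
  obtain r d where r: "prime r" "d \<ge> 1" "CARD('f) = r ^ d"
    using assms by (auto simp: primepow_def Suc_le_eq)
  have "CHAR('f) dvd r ^ d" using CHAR_dvd_CARD[where 'a='f] r by simp
  then have "CHAR('f) dvd r" using prime_CHAR_finite_field prime_dvd_power by blast
  then have "CHAR('f) = r" using r(1) prime_CHAR_finite_field primes_dvd_imp_eq by blast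
  then show ?thesis using r that by auto
qed

lemma card_nonzero_field: "card (UNIV - {0::'f::{field,finite}}) = CARD('f) - 1"
  by (simp add: card_Diff_singleton)

lemma card_field_gt_1: "CARD('f::{field,finite}) > 1"
proof -
  have "card {0::'f, 1} \<le> CARD('f)" by (rule card_mono) auto
  then show ?thesis by simp
qed

lemma field_power_card_minus_1:
  fixes x :: "'f::{field,finite}"
  assumes "x \<noteq> 0"
  shows "x ^ (CARD('f) - 1) = 1"
proof -
  let ?A = "UNIV - {0::'f}"
  have bij: "bij_betw (\<lambda>y. x * y) ?A ?A"
    by (rule bij_betw_byWitness[where f' = "\<lambda>y. y / x"]) (use assms in auto)
  have "\<Prod>?A = (\<Prod>y\<in>?A. x * y)"
    using prod.reindex_bij_betw[OF bij, of "\<lambda>y. y"] by simp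
  also have "\<dots> = x ^ card ?A * \<Prod>?A"
    by (simp add: prod.distrib)
  finally have "(x ^ card ?A - 1) * \<Prod>?A = 0"
    by (simp add: algebra_simps)
  moreover have "\<Prod>?A \<noteq> 0" by simp
  ultimately show ?thesis using card_nonzero_field[where 'f='f] by simp
qed

lemma field_power_add_card:
  fixes x :: "'f::{field,finite}"
  assumes "n \<ge> 1"
  shows "x ^ (n + (CARD('f) - 1) * k) = x ^ n"
  by (cases "x = 0") (use assms in \<open>auto simp: power_add power_mult field_power_card_minus_1 simp del: One_nat_def\<close>)

lemma poly_eq_of_agree:
  fixes P Q :: "'f::{field,finite} poly"
  assumes "degree P < CARD('f)" "degree Q < CARD('f)" "\<And>x. poly P x = poly Q x"
  shows "P = Q"
  by (rule poly_eqI_degree[of UNIV]) (use assms in auto)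

lemma ex_power_neq_1:
  assumes "0 < k" "k < CARD('f::{field,finite}) - 1"
  obtains g :: "'f::{field,finite}" where "g \<noteq> 0" "g ^ k \<noteq> 1"
proof (rule ccontr)
  assume "\<not> thesis"
  with that have all: "x ^ k = 1" if "x \<noteq> 0" for x :: 'f using \<open>x \<noteq> 0\<close> by blast
  define P :: "'f poly" where "P = monom 1 (Suc k) - monom 1 1"
  have "degree P \<le> Suc k" unfolding P_def by (intro degree_diff_le) (auto simp: degree_monom_eq)
  moreover have "poly P x = 0" for x
    using all[of x] by (cases "x = 0") (auto simp: P_def poly_monom)
  ultimately have "P = 0"
    using assms by (intro poly_eq_of_agree) auto
  moreover have "coeff P 1 = - 1" using assms by (simp add: P_def)
  ultimately show False by simp
qed

lemma sum_power_field:
  assumes "k < CARD('f::{field,finite}) - 1"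
  shows "(\<Sum>x\<in>(UNIV::'f set). x ^ k) = 0"
proof (cases "k = 0")
  case True
  have "of_nat CARD('f) = (0::'f)"
    using CHAR_dvd_CARD[where 'a='f] of_nat_eq_0_iff_char_dvd by blast
  then show ?thesis using True by simp
next
  case False
  then obtain g :: 'f where g: "g \<noteq> 0" "g ^ k \<noteq> 1" using ex_power_neq_1[of k] assms by auto
  have bij: "bij_betw (\<lambda>y. g * y) (UNIV::'f set) UNIV"
    by (rule bij_betw_byWitness[where f' = "\<lambda>y. y / g"]) (use g in auto)
  have "(\<Sum>x\<in>(UNIV::'f set). x ^ k) = (\<Sum>x\<in>UNIV. (g * x) ^ k)"
    using sum.reindex_bij_betw[OF bij, of "\<lambda>x. x ^ k"] by simp
  also have "\<dots> = g ^ k * (\<Sum>x\<in>UNIV. x ^ k)"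
    by (simp add: power_mult_distrib sum_distrib_left)
  finally have "(g ^ k - 1) * (\<Sum>x\<in>(UNIV::'f set). x ^ k) = 0" by (simp add: algebra_simps)
  then show ?thesis using g by simp
qed

lemma sum_power_field_card_minus_1:
  "(\<Sum>x\<in>(UNIV::'f::{field,finite} set). x ^ (CARD('f) - 1)) = - 1"
proof -
  have "(\<Sum>x\<in>(UNIV::'f set). x ^ (CARD('f) - 1)) = (\<Sum>x\<in>UNIV. 1 - (if x = (0::'f) then 1 else 0))"
    using card_field_gt_1[where 'f='f]
    by (intro sum.cong) (auto simp: field_power_card_minus_1 simp del: One_nat_def)
  also have "\<dots> = of_nat CARD('f) - 1" by (simp add: sum_subtractf)
  also have "of_nat CARD('f) = (0::'f)"
    using CHAR_dvd_CARD[where 'a='f] of_nat_eq_0_iff_char_dvd by blast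
  finally show ?thesis by simp
qed

lemma ex_poly_fun:
  fixes g :: "'f::{field,finite} \<Rightarrow> 'f"
  obtains P where "degree P < CARD('f)" "\<And>y. g y = poly P y"
proof -
  define q where "q = CARD('f)"
  have q: "q > 1" unfolding q_def by (rule card_field_gt_1)
  define P where "P = (\<Sum>x\<in>UNIV. smult (g x) (1 - [:- x, 1:] ^ (q - 1)))"
  have "degree P \<le> q - 1" unfolding P_def
  proof (rule degree_sum_le)
    fix x :: 'f
    have "degree ([:- x, 1:] ^ (q - 1)) \<le> q - 1"
      by (rule order_trans[OF degree_power_le]) simp
    then have "degree (1 - [:- x, 1:] ^ (q - 1)) \<le> q - 1" by (intro degree_diff_le) auto
    then show "degree (smult (g x) (1 - [:- x, 1:] ^ (q - 1))) \<le> q - 1"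
      by (rule order_trans[OF degree_smult_le])
  qed simp
  then have "degree P < CARD('f)" using q q_def by simp
  moreover have "g y = poly P y" for y
  proof -
    have "poly P y = (\<Sum>x\<in>UNIV. g x * (1 - (y - x) ^ (q - 1)))"
      by (simp add: P_def poly_sum)
    also have "\<dots> = (\<Sum>x\<in>UNIV. if x = y then g x else 0)"
      using q by (intro sum.cong) (auto simp: q_def field_power_card_minus_1 simp del: One_nat_def)
    finally show ?thesis by simp
  qed
  ultimately show ?thesis using that by blast
qed

lemma power_CHAR_power_add:
  fixes x y :: "'a::comm_ring_1"
  assumes "prime CHAR('a)"
  shows "(x + y) ^ (CHAR('a) ^ k) = x ^ (CHAR('a) ^ k) + y ^ (CHAR('a) ^ k)"
  using freshmans_dream'[OF assms refl] .

lemma power_CHAR_power_inj: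
  fixes x y :: "'f::{field,finite}"
  assumes "x ^ (CHAR('f) ^ k) = y ^ (CHAR('f) ^ k)"
  shows "x = y"
proof -
  have "((x - y) + y) ^ (CHAR('f) ^ k) = (x - y) ^ (CHAR('f) ^ k) + y ^ (CHAR('f) ^ k)"
    by (rule power_CHAR_power_add[OF prime_CHAR_finite_field])
  then have "(x - y) ^ (CHAR('f) ^ k) = 0" using assms by simp
  then show ?thesis by simp
qed

lemma card_roots_le:
  fixes c :: "'f::{field,finite}"
  assumes "n \<ge> 1"
  shows "card {x. x ^ n = c} \<le> n"
proof -
  define P where "P = monom 1 n - [:c:]"
  have "coeff P n = 1" unfolding P_def using assms by (simp add: coeff_pCons split: nat.split)
  then have "P \<noteq> 0" by auto
  then have "card {x. poly P x = 0} \<le> degree P" by (rule card_poly_roots_bound)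
  also have "degree P \<le> n" unfolding P_def by (intro degree_diff_le) (auto simp: degree_monom_eq)
  finally show ?thesis by (simp add: P_def poly_monom)
qed

lemma poly_of_degree_le_1:
  assumes "degree P \<le> 1"
  shows "poly P y = coeff P 0 + coeff P 1 * y"
proof -
  have "P = [:coeff P 0, coeff P 1:]"
    using assms by (intro poly_eqI) (auto simp: coeff_pCons coeff_eq_0 split: nat.split)
  then have "poly P y = poly [:coeff P 0, coeff P 1:] y" by (rule arg_cong)
  also have "\<dots> = coeff P 0 + coeff P 1 * y" by (simp add: mult.commute)
  finally show ?thesis .
qed

section \<open>Field automorphisms\<close>

lemma field_hom_surj:
  fixes \<sigma> :: "'f::{field,finite} \<Rightarrow> 'f"
  assumes "field_hom \<sigma>"
  shows "bij \<sigma>"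
proof -
  interpret field_hom \<sigma> by fact
  have "inj \<sigma>" by (rule injI) (simp add: eq_iff)
  then show ?thesis by (simp add: bij_def finite_UNIV_inj_surj)
qed

lemma field_hom_comp:
  assumes "field_hom \<sigma>" "field_hom \<tau>"
  shows "field_hom (\<sigma> \<circ> \<tau>)"
proof -
  interpret s: field_hom \<sigma> by fact
  interpret t: field_hom \<tau> by fact
  show ?thesis by unfold_locales (simp_all add: s.hom_add t.hom_add s.hom_mult t.hom_mult)
qed

text \<open>Multiplicativity, compared with the coefficients of the representing polynomial, leaves a single
  monomial \<open>y ^ i\<close>; writing \<open>i = r ^ k * m\<close> with \<open>m\<close> prime to the characteristic \<open>r\<close>, additivity
  becomes \<open>(1 + w) ^ m = 1 + w ^ m\<close> for all \<open>w\<close>, whose linear coefficient \<open>m\<close> forces \<open>m = 1\<close>.\<close>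
lemma field_hom_eq_CHAR_power:
  fixes s :: "'f::{field,finite} \<Rightarrow> 'f"
  assumes "field_hom s"
  obtains k where "\<And>y. s y = y ^ (CHAR('f) ^ k)"
proof -
  interpret field_hom s by fact
  obtain P where P: "degree P < CARD('f)" "\<And>y. s y = poly P y" using ex_poly_fun[of s] by blast
  have "P \<noteq> 0" using P(2)[of 1] by auto
  then obtain i where i: "coeff P i \<noteq> 0" "i < CARD('f)"
    using P(1) by (metis leading_coeff_neq_0)
  have sc: "s c = c ^ i" for c
  proof (cases "c = 0")
    case True
    have "i \<noteq> 0" using i(1) P(2)[of 0] hom_zero by (metis poly_0_coeff_0)
    then show ?thesis using True by simp
  next
    case False
    have "pcompose P [:0, c:] = smult (s c) P"
    proof (rule poly_eq_of_agree)
      show "degree (P \<circ>\<^sub>p [:0, c:]) < CARD('f)" using P(1) False by (simp add: degree_pcompose)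
      show "degree (smult (s c) P) < CARD('f)" using P(1) degree_smult_le le_less_trans by blast
      fix x
      have "poly P (c * x) = s c * poly P x" by (simp add: P(2)[symmetric] hom_mult)
      then show "poly (P \<circ>\<^sub>p [:0, c:]) x = poly (smult (s c) P) x"
        by (simp add: poly_pcompose mult.commute)
    qed
    moreover have "coeff (P \<circ>\<^sub>p [:0, c:]) i = c ^ i * coeff P i"
      by (rule coeff_pcompose_linear)
    ultimately show ?thesis using i(1) by (metis coeff_smult mult_right_cancel)
  qed
  define r where "r = CHAR('f)"
  have r: "prime r" unfolding r_def by (rule prime_CHAR_finite_field)
  have i0: "i \<noteq> 0" using sc[of 0] hom_zero by (cases i) auto
  define k where "k = multiplicity r i"
  define m where "m = i div r ^ k"
  have im: "i = r ^ k * m" unfolding k_def m_def by (simp add: multiplicity_dvd)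
  have rm: "\<not> r dvd m"
    using multiplicity_decompose[of i r] i0 r prime_gt_1_nat[OF r] unfolding m_def k_def by auto
  have fr: "inj (\<lambda>x::'f. x ^ (r ^ k))"
    unfolding inj_def r_def using power_CHAR_power_inj by blast
  have w: "(1 + w) ^ m = 1 + w ^ m" for w :: 'f
  proof -
    obtain x where x: "w = x ^ (r ^ k)"
      using finite_UNIV_inj_surj[OF _ fr] by (metis finite_code surjD)
    have "(1 + w) ^ m = ((1 + x) ^ (r ^ k)) ^ m"
      using power_CHAR_power_add[OF prime_CHAR_finite_field[where 'f='f], of 1 x k] by (simp add: x r_def)
    also have "\<dots> = s (1 + x)" by (simp add: sc im power_mult)
    also have "\<dots> = 1 + s x" by (simp add: hom_add)
    also have "s x = w ^ m" by (simp add: sc im x power_mult)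
    finally show ?thesis .
  qed
  have "m = 1"
  proof (rule ccontr)
    assume m1: "m \<noteq> 1"
    have m0: "m \<noteq> 0" using i0 im by auto
    have mq: "m < CARD('f)" using i(2) im r prime_gt_0_nat[OF r]
      by (metis dvd_imp_le dvd_triv_right i0 le_less_trans neq0_conv)
    have "[:1, 1:] ^ m = (1 + monom 1 m :: 'f poly)"
    proof (rule poly_eq_of_agree)
      show "degree ([:1, 1:] ^ m :: 'f poly) < CARD('f)"
        by (rule le_less_trans[OF degree_power_le]) (use mq in simp)
      show "degree (1 + monom 1 m :: 'f poly) < CARD('f)"
        by (rule le_less_trans[OF degree_add_le_max]) (use mq card_field_gt_1[where 'f='f] in \<open>simp add: degree_monom_eq\<close>)
      show "poly ([:1, 1:] ^ m) x = poly (1 + monom 1 m) x" for x :: 'f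
        using w[of x] by (simp add: poly_monom)
    qed
    then have "coeff ([:1, 1:] ^ m :: 'f poly) 1 = 0" using m1 by simp
    moreover have "coeff ([:1, 1:] ^ m :: 'f poly) 1 = of_nat m"
      using m0 by (simp add: coeff_linear_poly_power)
    ultimately show False using rm of_nat_eq_0_iff_char_dvd[of m, where 'a='f] r_def by auto
  qed
  then show ?thesis using that[of k] sc im r_def by simp
qed

section \<open>Spans of powers of differences\<close>

text \<open>For a bijection \<open>f\<close> this space is the space for the identity with \<open>f\<close> substituted for the
  variable. A relation between \<open>(f x - f y) ^ n\<close> and a power of \<open>x - y\<close> makes it in addition invariant
  under translations and dilations of the variable; the two descriptions together will determine \<open>f\<close>.\<close>
definition diff_power_span :: "('f::{field,finite} \<Rightarrow> 'f) \<Rightarrow> nat \<Rightarrow> ('f \<Rightarrow> 'f) set" where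
  "diff_power_span f n = {g. \<exists>w. \<forall>y. g y = (\<Sum>x\<in>UNIV. w x * (f x - f y) ^ n)}"

lemma coeff_mult_neq_0D:
  assumes "coeff (A * B) i \<noteq> 0"
  obtains j where "j \<le> i" "coeff A j \<noteq> 0" "coeff B (i - j) \<noteq> 0"
proof -
  have "\<exists>j\<in>{..i}. coeff A j * coeff B (i - j) \<noteq> 0"
    using assms sum.neutral[of "{..i}" "\<lambda>j. coeff A j * coeff B (i - j)"]
    unfolding coeff_mult by blast
  then show ?thesis using that by fastforce
qed

lemma coeff_power_dvd:
  fixes A :: "'a::comm_semiring_1 poly"
  assumes "\<And>j. coeff A j \<noteq> 0 \<Longrightarrow> R dvd j" and "coeff (A ^ m) j \<noteq> 0"
  shows "R dvd j"
  using assms(2)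
proof (induction m arbitrary: j)
  case 0
  then show ?case by (auto simp: one_pCons coeff_pCons split: nat.splits if_splits)
next
  case (Suc m)
  then obtain i where i: "i \<le> j" "coeff A i \<noteq> 0" "coeff (A ^ m) (j - i) \<noteq> 0"
    by (auto elim: coeff_mult_neq_0D)
  then have "R dvd i" "R dvd j - i" using assms(1) Suc.IH by auto
  then show ?case using i(1) by (metis dvd_add le_add_diff_inverse)
qed

text \<open>With \<open>R\<close> a power of the characteristic, \<open>(x - Y) ^ n\<close> is the product of
  \<open>(x - Y) ^ (n mod R)\<close> and a polynomial in \<open>Y ^ R\<close>.\<close>
lemma coeff_diff_power_residue:
  fixes x :: "'f::{field,finite}"
  assumes "coeff ([:x, -1:] ^ n) i \<noteq> 0"
  shows "i mod CHAR('f) ^ k \<le> n mod CHAR('f) ^ k"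
proof -
  define R where "R = CHAR('f) ^ k"
  have pr: "prime CHAR('f poly)" by (simp add: prime_CHAR_finite_field)
  have R0: "R > 0" unfolding R_def using prime_gt_0_nat[OF prime_CHAR_finite_field[where 'f='f]] by simp
  have "[:x, -1:] ^ R = ([:x:] + [:0, -1:]) ^ R" by simp
  also have "\<dots> = [:x:] ^ R + [:0, -1:] ^ R"
    using power_CHAR_power_add[OF pr, of "[:x:]" "[:0, -1:]" k] by (simp add: R_def)
  also have "[:0, -1:] ^ R = monom ((-1::'f) ^ R) R"
  proof -
    have "[:0, -1::'f:] = monom (-1) 1" by (simp add: monom_altdef)
    then show ?thesis by (simp add: monom_power)
  qed
  also have "[:x:] ^ R = [:x ^ R:]" by (simp add: poly_const_pow)
  finally have XR: "[:x, -1:] ^ R = [:x ^ R:] + monom ((-1) ^ R) R" .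
  have supp: "R dvd j" if "coeff ([:x, -1:] ^ R) j \<noteq> 0" for j
    using that unfolding XR by (auto simp: coeff_pCons split: nat.splits if_splits)
  have "[:x, -1:] ^ n = [:x, -1:] ^ (n mod R) * ([:x, -1:] ^ R) ^ (n div R)"
    by (simp flip: power_add power_mult)
  then obtain j where j: "j \<le> i" "coeff ([:x, -1:] ^ (n mod R)) j \<noteq> 0"
      "coeff (([:x, -1:] ^ R) ^ (n div R)) (i - j) \<noteq> 0"
    using assms coeff_mult_neq_0D by metis
  have "R dvd i - j" using coeff_power_dvd[OF supp j(3)] .
  moreover have jn: "j \<le> n mod R"
    using le_degree[OF j(2)] degree_power_le[of "[:x, -1:]" "n mod R"] by simp
  moreover have "j < R" using jn R0 by (meson le_less_trans mod_less_divisor)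
  ultimately have "i mod R = j" using j(1)
    by (metis dvd_imp_mod_0 le_add_diff_inverse mod_add_right_eq mod_less add_0_right)
  then show ?thesis using jn R_def by simp
qed

lemma diff_power_span_id_poly:
  assumes "g \<in> diff_power_span (\<lambda>x::'f::{field,finite}. x) n"
  shows "\<exists>P. degree P \<le> n \<and> (\<forall>y. g y = poly P y) \<and>
    (\<forall>k i. coeff P i \<noteq> 0 \<longrightarrow> i mod CHAR('f) ^ k \<le> n mod CHAR('f) ^ k)"
proof -
  obtain w where w: "\<And>y. g y = (\<Sum>x\<in>UNIV. w x * (x - y) ^ n)"
    using assms by (auto simp: diff_power_span_def)
  define P where "P = (\<Sum>x\<in>UNIV. smult (w x) ([:x, -1:] ^ n))"
  have "degree P \<le> n" unfolding P_def
  proof (rule degree_sum_le)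
    fix x :: 'f
    have "degree ([:x, -1:] ^ n) \<le> n" by (rule order_trans[OF degree_power_le]) simp
    then show "degree (smult (w x) ([:x, -1:] ^ n)) \<le> n" by (rule order_trans[OF degree_smult_le])
  qed simp
  moreover have "g y = poly P y" for y
    by (simp add: w P_def poly_sum)
  moreover have "i mod CHAR('f) ^ k \<le> n mod CHAR('f) ^ k" if "coeff P i \<noteq> 0" for k i
  proof -
    have "\<exists>x::'f. coeff ([:x, -1:] ^ n) i \<noteq> 0"
    proof (rule ccontr)
      assume "\<nexists>x::'f. coeff ([:x, -1:] ^ n) i \<noteq> 0"
      then have "coeff P i = 0" by (simp add: P_def coeff_sum)
      then show False using that by simp
    qed
    then show ?thesis using coeff_diff_power_residue by blast
  qed
  ultimately show ?thesis by blast
qed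

text \<open>The coefficient of \<open>y ^ i\<close> in \<open>(x - y) ^ n\<close> is extracted by a power sum over \<open>x\<close>.\<close>
lemma monomial_in_diff_power_span_id:
  assumes n: "n < CARD('f::{field,finite}) - 1" and i: "i \<le> n"
    and C: "of_nat (n choose i) \<noteq> (0::'f)"
  shows "(\<lambda>y::'f. y ^ i) \<in> diff_power_span (\<lambda>x. x) n"
proof -
  define q where "q = CARD('f) - 1"
  have T: "(\<Sum>x\<in>UNIV. x ^ (q - (n - i)) * x ^ (n - j)) = (if j = i then - 1 else (0::'f))"
    if "j \<le> n" for j
  proof -
    have e: "q - (n - i) + (n - j) = (if j \<le> i then (i - j) + q else q - (j - i))"
      using n i that by (auto simp: q_def)
    consider "j = i" | "j < i" | "j > i" by linarith
    then show ?thesis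
    proof cases
      case 1
      then show ?thesis using e sum_power_field_card_minus_1[where 'f='f]
        by (simp flip: power_add add: q_def)
    next
      case 2
      have "x ^ (q - (n - i)) * x ^ (n - j) = x ^ (i - j)" for x :: 'f
        using e 2 field_power_add_card[of "i - j" x 1] by (simp flip: power_add add: q_def)
      then show ?thesis using sum_power_field[of "i - j", where 'f='f] 2 i n by simp
    next
      case 3
      then show ?thesis using e sum_power_field[of "q - (j - i)", where 'f='f] n i that
        by (simp flip: power_add add: q_def)
    qed
  qed
  define c where "c = - 1 / (of_nat (n choose i) * (- 1) ^ i :: 'f)"
  have "y ^ i = (\<Sum>x\<in>UNIV. (c * x ^ (q - (n - i))) * (x - y) ^ n)" for y :: 'f
  proof -
    have ex: "(x - y) ^ n = (\<Sum>j\<le>n. of_nat (n choose j) * (- y) ^ j * x ^ (n - j))" for x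
      using binomial_ring[of "- y" x n] by simp
    have "(\<Sum>x\<in>UNIV. (c * x ^ (q - (n - i))) * (x - y) ^ n)
      = (\<Sum>x\<in>UNIV. \<Sum>j\<le>n. c * (of_nat (n choose j) * (- y) ^ j) * (x ^ (q - (n - i)) * x ^ (n - j)))"
      unfolding ex by (simp add: sum_distrib_left mult_ac)
    also have "\<dots> = (\<Sum>j\<le>n. c * (of_nat (n choose j) * (- y) ^ j) *
        (\<Sum>x\<in>UNIV. x ^ (q - (n - i)) * x ^ (n - j)))"
      by (subst sum.swap) (simp add: sum_distrib_left)
    also have "\<dots> = (\<Sum>j\<le>n. if j = i then c * (of_nat (n choose i) * (- y) ^ i) * - 1 else 0)"
      by (intro sum.cong) (auto simp: T)
    also have "\<dots> = c * (of_nat (n choose i) * (- y) ^ i) * - 1" using i by simp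
    also have "(- y) ^ i = (- 1) ^ i * y ^ i" by (simp flip: power_mult_distrib)
    finally show ?thesis using C by (simp add: c_def)
  qed
  then show ?thesis unfolding diff_power_span_def
    by (intro CollectI exI[of _ "\<lambda>x. c * x ^ (q - (n - i))"] allI)
qed

lemma diff_power_span_comp:
  assumes "bij f"
  shows "h \<circ> f \<in> diff_power_span f n \<longleftrightarrow> h \<in> diff_power_span (\<lambda>x. x) n"
proof
  assume "h \<in> diff_power_span (\<lambda>x. x) n"
  then obtain w where w: "\<And>y. h y = (\<Sum>x\<in>UNIV. w x * (x - y) ^ n)"
    by (auto simp: diff_power_span_def)
  have "(h \<circ> f) y = (\<Sum>x\<in>UNIV. (w \<circ> f) x * (f x - f y) ^ n)" for y
    using sum.reindex_bij_betw[OF assms, of "\<lambda>x. w x * (x - f y) ^ n"] by (simp add: w)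
  then show "h \<circ> f \<in> diff_power_span f n" unfolding diff_power_span_def by blast
next
  assume "h \<circ> f \<in> diff_power_span f n"
  then obtain w where w: "\<And>y. h (f y) = (\<Sum>x\<in>UNIV. w x * (f x - f y) ^ n)"
    by (auto simp: diff_power_span_def)
  have "h z = (\<Sum>x\<in>UNIV. (w \<circ> inv_into UNIV f) x * (x - z) ^ n)" for z
  proof -
    have "h z = (\<Sum>x\<in>UNIV. w x * (f x - z) ^ n)"
      using w[of "inv_into UNIV f z"] assms by (simp add: bij_is_surj surj_f_inv_f)
    also have "\<dots> = (\<Sum>x\<in>UNIV. w (inv_into UNIV f (f x)) * (f x - z) ^ n)"
      using assms by (simp add: bij_is_inj inv_f_f)
    also have "\<dots> = (\<Sum>x\<in>UNIV. (w \<circ> inv_into UNIV f) x * (x - z) ^ n)"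
      using sum.reindex_bij_betw[OF assms, of "\<lambda>x. (w \<circ> inv_into UNIV f) x * (x - z) ^ n"] by simp
    finally show ?thesis .
  qed
  then show "h \<in> diff_power_span (\<lambda>x. x) n" unfolding diff_power_span_def by blast
qed

lemma diff_power_span_translate:
  assumes "g \<in> diff_power_span (\<lambda>x. x) n"
  shows "(\<lambda>y. g (y + t)) \<in> diff_power_span (\<lambda>x. x) n"
proof -
  obtain w where w: "\<And>y. g y = (\<Sum>x\<in>UNIV. w x * (x - y) ^ n)"
    using assms by (auto simp: diff_power_span_def)
  have bij: "bij (\<lambda>x. x + t)" by (rule bij_betw_byWitness[where f' = "\<lambda>x. x - t"]) auto
  have "g (y + t) = (\<Sum>x\<in>UNIV. w (x + t) * (x - y) ^ n)" for y
    using sum.reindex_bij_betw[OF bij, of "\<lambda>x. w x * (x - (y + t)) ^ n"] by (simp add: w)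
  then show ?thesis unfolding diff_power_span_def
    by (intro CollectI exI[of _ "\<lambda>x. w (x + t)"]) simp
qed

lemma diff_power_span_dilate:
  assumes "g \<in> diff_power_span (\<lambda>x. x) n" and "c \<noteq> 0"
  shows "(\<lambda>y. g (c * y)) \<in> diff_power_span (\<lambda>x. x) n"
proof -
  obtain w where w: "\<And>y. g y = (\<Sum>x\<in>UNIV. w x * (x - y) ^ n)"
    using assms by (auto simp: diff_power_span_def)
  have bij: "bij (\<lambda>x. c * x)"
    by (rule bij_betw_byWitness[where f' = "\<lambda>x. x / c"]) (use assms in auto)
  have "g (c * y) = (\<Sum>x\<in>UNIV. (w (c * x) * c ^ n) * (x - y) ^ n)" for y
    using sum.reindex_bij_betw[OF bij, of "\<lambda>x. w x * (x - (c * y)) ^ n"]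
    by (simp add: w mult.assoc flip: power_mult_distrib right_diff_distrib)
  then show ?thesis unfolding diff_power_span_def
    by (intro CollectI exI[of _ "\<lambda>x. w (c * x) * c ^ n"]) simp
qed

section \<open>Base expansions of the multiples of a divisor of \<open>q - 1\<close>\<close>

text \<open>Since \<open>e * s = (r ^ d - 1) * s / p\<close>, the base-\<open>r\<close> digits of \<open>e * s\<close> for \<open>0 < s < p\<close> are those of
  the period of \<open>s / p\<close>. Here \<open>s\<close> is given by the remainder \<open>v\<close> of \<open>s / r ^ k\<close> modulo \<open>p\<close>, which
  determines the last \<open>k\<close> digits.\<close>
lemma multiple_mod_power:
  fixes p e r d k v :: nat
  assumes p: "prime p" and rp: "r > 0" and r: "1 + p * e = r ^ d"
    and k: "k \<le> d" and v: "v < p"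
  shows "(e * (r ^ k * v mod p)) mod r ^ k = r ^ k * v div p"
proof -
  define s m where "s = r ^ k * v mod p" and "m = r ^ k * v div p"
  have dm: "r ^ k * v = p * m + s" by (simp add: s_def m_def)
  have "r ^ k * v < r ^ k * p" using v rp by simp
  then have mlt: "m < r ^ k" unfolding m_def using prime_gt_0_nat[OF p]
    by (simp add: less_mult_imp_div_less)
  have cop: "coprime p (r ^ k)"
  proof -
    have "\<not> p dvd 1 + p * e"
    proof
      assume "p dvd 1 + p * e"
      then have "p dvd 1" using dvd_add_left_iff[of p "p * e" 1] dvd_triv_left[of p e] by blast
      then show False using p not_prime_unit by blast
    qed
    then have "coprime p (r ^ d)" unfolding r using p by (intro prime_imp_coprime)
    moreover have "r ^ k dvd r ^ d" using k by (rule le_imp_power_dvd)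
    ultimately show ?thesis using coprime_divisors dvd_refl by blast
  qed
  have "p * (e * s) + s = (1 + p * e) * s" by (simp add: algebra_simps)
  also have "\<dots> = r ^ k * (r ^ (d - k) * s)"
  proof -
    have "r ^ d = r ^ k * r ^ (d - k)" using k power_add[of r k "d - k"] by simp
    then show ?thesis unfolding r by (simp only: mult.assoc)
  qed
  finally have "p * (e * s) + r ^ k * v = p * m + r ^ k * (r ^ (d - k) * s)"
    using dm by linarith
  then have "(p * (e * s) + r ^ k * v) mod r ^ k = (p * m + r ^ k * (r ^ (d - k) * s)) mod r ^ k"
    by (rule arg_cong)
  then have "[p * (e * s) = p * m] (mod r ^ k)"
    unfolding cong_def mod_mult_self2 .
  then have "[e * s = m] (mod r ^ k)" using cong_mult_lcancel_nat[OF cop] by blast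
  then show ?thesis using mlt unfolding cong_def s_def[symmetric] m_def[symmetric] by simp
qed

text \<open>Multiplication by \<open>R\<close> cannot map \<open>{1..n}\<close> into itself: consecutive multiples of a small \<open>R\<close>
  must step over \<open>n\<close> without reaching \<open>p\<close>.\<close>
lemma ex_multiple_leaving_interval:
  fixes n R p :: nat
  assumes "2 \<le> R" "R < p" "1 \<le> n" "2 * n < p"
  obtains v where "1 \<le> v" "v \<le> n" "n < R * v mod p"
proof -
  define v where "v = (LEAST v. n < R * v)"
  have "2 * n \<le> R * n" using assms(1) by (rule mult_le_mono1)
  then have "n < R * n" using assms(3) by linarith
  then have v: "n < R * v" "v \<le> n" unfolding v_def by (rule LeastI, rule Least_le)
  have v1: "v \<ge> 1" using v(1) by (cases v) auto
  have "\<not> n < R * (v - 1)" using not_less_Least[of "v - 1" "\<lambda>v. n < R * v"] v1 by (simp add: v_def)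
  then have le: "R * v \<le> n + R" using v1 by (cases v) auto
  have "R * v < p"
  proof (cases "R > n")
    case True
    then have "v \<le> 1" unfolding v_def by (intro Least_le) simp
    then have "v = 1" using v1 by simp
    then show ?thesis using assms by simp
  next
    case False
    then show ?thesis using le assms by linarith
  qed
  then show ?thesis using that[of v] v v1 by simp
qed

text \<open>If \<open>l\<close> is the position of the leading base-\<open>r\<close> digit of \<open>i\<close>, some \<open>e * s\<close> has a nonzero last
  digit and the digit \<open>0\<close> at position \<open>l\<close> (the last digit \<open>1\<close>, if \<open>l = 0\<close>). The digit of \<open>e * s\<close> at a
  position is \<open>\<lfloor>r * u / p\<rfloor>\<close> for a remainder \<open>u\<close> of \<open>s\<close> times a power of \<open>r\<close>, so it vanishes iff
  \<open>u \<le> n = \<lfloor>p / r\<rfloor>\<close>; for \<open>l > 0\<close> it remains to find a \<open>v\<close> in \<open>{1..n}\<close> that multiplication by \<open>r ^ l\<close> moves beyond \<open>n\<close>.\<close>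
lemma ex_multiple_small_residue:
  fixes p e r d i :: nat
  assumes p: "prime p" and r: "prime r" and q: "1 + p * e = r ^ d" and rp: "r < p"
    and ord: "\<And>l. 1 \<le> l \<Longrightarrow> l < d \<Longrightarrow> r ^ l mod p \<noteq> 1"
    and i: "2 \<le> i" "i < r ^ d"
  obtains s k where "1 \<le> s" "s < p" "\<not> r dvd s" "(e * s) mod r ^ k < i mod r ^ k"
proof -
  define n where "n = p div r"
  have r2: "r \<ge> 2" using r by (rule prime_ge_2_nat)
  then have r0: "r > 0" by simp
  have n1: "1 \<le> n" unfolding n_def using rp r2 by (simp add: Suc_le_eq div_greater_zero_iff)
  have rndvd: "\<not> r dvd p" using p r rp primes_dvd_imp_eq by blast
  have pndvd: "\<not> p dvd r" using p r rp primes_dvd_imp_eq by blast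
  have "r * n \<le> p" unfolding n_def by simp
  moreover have "r * n \<noteq> p" using rndvd by auto
  ultimately have rn: "r * n < p" by simp
  have rn1: "p < r * (n + 1)" unfolding n_def using dividend_less_times_div[of r p] r2 by simp
  have "\<exists>l. r ^ l \<le> i \<and> i < r ^ (l + 1)"
    using ex_power_ivl1[of r i] r2 i by auto
  then obtain l where l: "r ^ l \<le> i" "i < r ^ (l + 1)" by blast
  have "r ^ l < r ^ d" using l(1) i(2) by (rule le_less_trans)
  then have ld: "l < d" using r2 by (simp add: power_strict_increasing_iff)
  show ?thesis
  proof (cases "l = 0")
    case True
    have ub: "r * (n + 1) < 2 * p" using rn rp by (simp add: algebra_simps)
    moreover have "2 * p \<le> r * p" using r2 by (rule mult_le_mono1)
    ultimately have "r * (n + 1) < r * p" by (rule less_le_trans)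
    then have vp: "n + 1 < p" by (simp only: mult_less_cancel1)
    \<comment> \<open>the smallest multiple of \<open>r\<close> beyond \<open>p\<close>: its quotient by \<open>p\<close> is the last digit \<open>1\<close>\<close>
    define s where "s = r * (n + 1) mod p"
    have dv: "r * (n + 1) div p = 1" using rn1 ub by (simp add: div_nat_eqI)
    have s: "s = r * (n + 1) - p" using dv unfolding s_def
      by (metis minus_div_mult_eq_mod mult_1)
    have "0 < s" "s < r" unfolding s using rn1 rn by (auto simp: algebra_simps)
    have "1 \<le> s" "s < p" "\<not> r dvd s"
      using \<open>0 < s\<close> \<open>s < r\<close> rp by (auto simp: nat_dvd_not_less)
    moreover have "(e * s) mod r ^ 1 < i mod r ^ 1"
    proof -
      have "1 \<le> d" using ld True by simp
      from multiple_mod_power[OF p r0 q this vp] have "(e * s) mod r ^ 1 = 1"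
        unfolding s_def power_one_right dv .
      moreover have "i mod r ^ 1 = i" using l(2) True by simp
      ultimately show ?thesis using i(1) by linarith
    qed
    ultimately show ?thesis by (rule that)
  next
    case False
    define R where "R = r ^ l mod p"
    have "\<not> p dvd r ^ l" using pndvd prime_dvd_power[OF p, of r l] by blast
    then have "R \<noteq> 0" unfolding R_def using mod_0_imp_dvd by blast
    moreover have "1 \<le> l" using False by simp
    then have "R \<noteq> 1" unfolding R_def using ld by (rule ord)
    ultimately have R: "2 \<le> R" by simp
    have Rp: "R < p" unfolding R_def using prime_gt_0_nat[OF p] by simp
    have "2 * n \<le> r * n" using r2 by (rule mult_le_mono1)
    then have "2 * n < p" using rn by linarith
    then obtain v where v: "1 \<le> v" "v \<le> n" "n < R * v mod p"
      using ex_multiple_leaving_interval[OF R Rp n1] by blast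
    define u where "u = R * v mod p"
    define s where "s = r ^ (l + 1) * v mod p"
    have up: "u < p" unfolding u_def using prime_gt_0_nat[OF p] by simp
    have su: "s = r * u mod p"
      unfolding s_def u_def R_def by (simp add: mod_mult_right_eq mod_mult_left_eq mult.assoc)
    \<comment> \<open>the last digit of \<open>e * s\<close>; it lies between \<open>1\<close> and \<open>r - 1\<close>, so \<open>r\<close> does not divide \<open>s\<close>\<close>
    define t where "t = r * u div p"
    have "n + 1 \<le> u" using v(3) u_def by simp
    then have "r * (n + 1) \<le> r * u" by (rule mult_le_mono2)
    then have "p \<le> r * u" using rn1 by linarith
    then have t1: "1 \<le> t" unfolding t_def using prime_gt_0_nat[OF p]
      by (simp add: Suc_le_eq div_greater_zero_iff)
    have tr: "t < r" unfolding t_def using up r2 by (simp add: less_mult_imp_div_less)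
    have ru: "r * u = p * t + s" unfolding t_def su by simp
    have rs: "\<not> r dvd s"
    proof
      assume "r dvd s"
      moreover have "r dvd p * t + s" unfolding ru[symmetric] by simp
      ultimately have "r dvd p * t" using dvd_add_left_iff[of r s "p * t"] by blast
      then have "r dvd t" using rndvd prime_dvd_mult_iff[OF r, of p t] by blast
      then have "r \<le> t" using t1 by (intro dvd_imp_le) auto
      then show False using tr by linarith
    qed
    then have "1 \<le> s" by (cases s) auto
    moreover have "s < p" unfolding s_def using prime_gt_0_nat[OF p] by simp
    moreover have "(e * s) mod r ^ (l + 1) < i mod r ^ (l + 1)"
    proof -
      have "n \<le> p div 2" unfolding n_def using r2 by (simp add: div_le_mono2)
      then have vp: "v < p" using v(2) prime_gt_1_nat[OF p] by linarith
      have "r * v \<le> r * n" using v(2) by (rule mult_le_mono2)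
      then have "r * v < p" using rn by (rule le_less_trans)
      then have "r ^ l * (r * v) < r ^ l * p" using r0 by simp
      then have "r ^ (l + 1) * v div p < r ^ l" by (simp add: less_mult_imp_div_less mult_ac)
      moreover have "l + 1 \<le> d" using ld by simp
      from multiple_mod_power[OF p r0 q this vp]
      have "(e * s) mod r ^ (l + 1) = r ^ (l + 1) * v div p" unfolding s_def .
      moreover have "i mod r ^ (l + 1) = i" using l(2) by (rule mod_less)
      ultimately show ?thesis using l(1) by linarith
    qed
    ultimately show ?thesis using rs that by blast
  qed
qed

section \<open>Bijections compatible with a power residue character\<close>

text \<open>The supports allowed by the different \<open>s\<close> have only the exponents \<open>0\<close> and \<open>1\<close> in common.\<close>
lemma diff_power_span_affine:
  fixes g :: "'f::{field,finite} \<Rightarrow> 'f"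
  assumes p: "prime p" and q: "CARD('f) = 1 + p * e" and d: "CARD('f) = CHAR('f) ^ d"
    and rp: "CHAR('f) < p"
    and ord: "\<And>l. 1 \<le> l \<Longrightarrow> l < d \<Longrightarrow> CHAR('f) ^ l mod p \<noteq> 1"
    and g: "\<And>s. 1 \<le> s \<Longrightarrow> s < p \<Longrightarrow> \<not> CHAR('f) dvd s \<Longrightarrow> g \<in> diff_power_span (\<lambda>x. x) (e * s)"
  obtains a b where "\<And>y. g y = a + b * y"
proof -
  have r: "prime CHAR('f)" by (rule prime_CHAR_finite_field)
  have q': "1 + p * e = CHAR('f) ^ d" using q d by simp
  have deg: "e * s < CARD('f)" if "s < p" for s
  proof -
    have "e * s \<le> e * p" using that by simp
    then show ?thesis using q mult.commute[of p e] by linarith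
  qed
  have "\<not> CHAR('f) dvd 1" using r not_prime_unit by blast
  then have "g \<in> diff_power_span (\<lambda>x. x) (e * 1)" using g[of 1] prime_gt_1_nat[OF p] by simp
  then obtain P where P: "degree P \<le> e * 1" "\<And>y. g y = poly P y"
    using diff_power_span_id_poly by metis
  have dP: "degree P < CARD('f)" using P(1) deg[of 1] prime_gt_1_nat[OF p] by linarith
  have "coeff P i = 0" if i2: "i \<ge> 2" for i
  proof (rule ccontr)
    assume c: "coeff P i \<noteq> 0"
    then have "i \<le> degree P" by (rule le_degree)
    then have "i < CHAR('f) ^ d" using dP d by simp
    then obtain s k where s: "1 \<le> s" "s < p" "\<not> CHAR('f) dvd s"
        "(e * s) mod CHAR('f) ^ k < i mod CHAR('f) ^ k"
      using ex_multiple_small_residue[OF p r q' rp ord i2] by blast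
    obtain Q where Q: "degree Q \<le> e * s" "\<And>y. g y = poly Q y"
        "\<And>k i. coeff Q i \<noteq> 0 \<Longrightarrow> i mod CHAR('f) ^ k \<le> (e * s) mod CHAR('f) ^ k"
      using diff_power_span_id_poly[OF g[OF s(1-3)]] by metis
    have "Q = P"
    proof (rule poly_eq_of_agree)
      show "degree Q < CARD('f)" using Q(1) deg[OF s(2)] by linarith
      show "degree P < CARD('f)" by (rule dP)
      show "poly Q x = poly P x" for x using P(2) Q(2) by metis
    qed
    then have "i mod CHAR('f) ^ k \<le> (e * s) mod CHAR('f) ^ k" using Q(3) c by blast
    then show False using s(4) by linarith
  qed
  then have "degree P \<le> 1" by (intro degree_le) auto
  then have "g y = coeff P 0 + coeff P 1 * y" for y
    unfolding P(2) by (rule poly_of_degree_le_1)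
  then show ?thesis by (rule that)
qed

text \<open>Comparing the two evaluations of \<open>f (y + t)\<close> gives \<open>f (y + t) = f y + f t + c * f y * f t\<close> with a
  constant \<open>c\<close>, which the characteristic forces to vanish.\<close>
lemma affine_shifts_imp_additive:
  fixes f :: "'f::{field,finite} \<Rightarrow> 'f"
  assumes f0: "f 0 = 0" and f1: "f 1 = 1"
    and aff: "\<And>t. \<exists>a b. \<forall>y. f (y + t) = a + b * f y"
  shows "f (x + y) = f x + f y"
proof -
  obtain b where b: "f (y + t) = f t + b t * f y" for y t
  proof -
    have "\<exists>b. \<forall>y. f (y + t) = f t + b * f y" for t
    proof -
      obtain a b where ab: "\<And>y. f (y + t) = a + b * f y" using aff[of t] by blast
      have "a = f t" using ab[of 0] f0 by simp
      then show ?thesis using ab by blast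
    qed
    then show ?thesis using that by metis
  qed
  define c where "c = b 1 - 1"
  have "b t = 1 + c * f t" for t
  proof -
    have "f t + b t * f 1 = f 1 + b 1 * f t" using b[of 1 t] b[of t 1] by (simp add: add.commute)
    then show ?thesis by (simp add: f1 c_def algebra_simps)
  qed
  then have fc: "f (y + t) = f t + f y + c * f t * f y" for y t
    using b[of y t] by (simp add: algebra_simps)
  \<comment> \<open>\<open>1 + c * f\<close> turns sums into products, so its value \<open>1 + c\<close> at \<open>1\<close> has a trivial \<open>r\<close>-th power,
    \<open>r\<close> being the characteristic\<close>
  have pw: "1 + c * f (of_nat n) = (1 + c) ^ n" for n
  proof (induction n)
    case (Suc n)
    have "1 + c * f (of_nat n + 1) = (1 + c * f 1) * (1 + c * f (of_nat n))"
      by (simp add: fc algebra_simps)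
    then show ?case using Suc f1 by (simp add: add.commute)
  qed (simp add: f0)
  have "(1 + c) ^ (CHAR('f) ^ 1) = 1 ^ (CHAR('f) ^ 1)"
    using pw[of "CHAR('f)"] f0 by simp
  then have "1 + c = 1" by (rule power_CHAR_power_inj)
  then show ?thesis using fc by (simp add: add.commute)
qed

text \<open>In a prime field the spans are the spaces of polynomials of bounded degree. If \<open>s\<close> inverts \<open>a\<close>
  modulo \<open>p\<close>, all powers \<open>f ^ j\<close> with \<open>j \<le> e * s\<close> lie in the span for \<open>e\<close>, so have degree at
  most \<open>e\<close>; but the powers of a nonlinear polynomial pass \<open>e\<close> before they reach the degree \<open>q\<close>, where
  reduction modulo \<open>y ^ q - y\<close> sets in.\<close>
lemma power_residue_map_prime_field:
  fixes f :: "'f::{field,finite} \<Rightarrow> 'f"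
  assumes p: "prime p" and q: "CARD('f) = 1 + p * e" and r: "CARD('f) = CHAR('f)"
    and f: "bij f" "f 0 = 0" "f 1 = 1"
    and a: "\<And>x y. (f x - f y) ^ e = (x - y) ^ (e * a)" and pa: "\<not> p dvd a"
  shows "f = (\<lambda>x. x)"
proof -
  have p2: "p \<ge> 2" using p by (rule prime_ge_2_nat)
  have e1: "e \<ge> 1" using q card_field_gt_1[where 'f='f] by (cases e) auto
  have "coprime a p" unfolding coprime_commute[of a p] using p pa by (rule prime_imp_coprime)
  then obtain s0 where s0: "[a * s0 = 1] (mod p)" using cong_solve_coprime_nat[of a p] by auto
  define s where "s = s0 mod p"
  have as: "[a * s = 1] (mod p)" using s0 unfolding s_def cong_def by (simp add: mod_mult_right_eq)
  have sp: "s < p" unfolding s_def using p2 by simp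
  have s1: "s \<ge> 1"
  proof (rule ccontr)
    assume "\<not> s \<ge> 1"
    then have "s = 0" by simp
    then show False using as p2 by (simp add: cong_def)
  qed
  have "a * s mod p = 1" using as p2 by (simp add: cong_def)
  then have asd: "a * s = 1 + p * (a * s div p)" using mult_div_mod_eq[of p "a * s"] by linarith
  have pw: "(f x - f y) ^ (e * s) = (x - y) ^ e" for x y
  proof -
    have "(f x - f y) ^ (e * s) = (x - y) ^ (e * (a * s))"
      by (simp add: power_mult a mult.assoc)
    also have "e * (a * s) = e + (CARD('f) - 1) * (a * s div p)"
      by (subst asd) (simp add: q algebra_simps)
    also have "(x - y) ^ \<dots> = (x - y) ^ e" using e1 by (rule field_power_add_card)
    finally show ?thesis .
  qed
  have es: "e * s < CARD('f) - 1" using sp e1 q by simp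
  have fj: "(\<lambda>y. f y ^ j) \<in> diff_power_span (\<lambda>x. x) e" if j: "j \<le> e * s" for j
  proof -
    have "\<not> CHAR('f) dvd (e * s choose j)"
    proof
      assume "CHAR('f) dvd (e * s choose j)"
      then have "CHAR('f) dvd fact (e * s)"
        unfolding binomial_fact_lemma[OF j, symmetric] by (rule dvd_mult)
      then have "CHAR('f) \<le> e * s" using prime_dvd_fact_iff[OF prime_CHAR_finite_field] by blast
      then show False using es r by simp
    qed
    then have "of_nat (e * s choose j) \<noteq> (0::'f)" by (simp add: of_nat_eq_0_iff_char_dvd)
    then have "(\<lambda>y::'f. y ^ j) \<in> diff_power_span (\<lambda>x. x) (e * s)"
      by (rule monomial_in_diff_power_span_id[OF es j])
    then have "(\<lambda>y. y ^ j) \<circ> f \<in> diff_power_span f (e * s)"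
      using diff_power_span_comp[OF f(1)] by blast
    then show ?thesis by (simp add: diff_power_span_def pw comp_def)
  qed
  obtain P where P: "degree P \<le> e" "\<And>y. f y = poly P y"
  proof -
    have "1 \<le> e * s" using e1 s1 by simp
    from diff_power_span_id_poly[OF fj[OF this]]
    obtain P where "degree P \<le> e" "\<And>y. f y ^ 1 = poly P y" by metis
    then show ?thesis using that[of P] by simp
  qed
  have "degree P \<le> 1"
  proof (rule ccontr)
    assume "\<not> degree P \<le> 1"
    then have n2: "degree P \<ge> 2" by simp
    define j where "j = e div degree P"
    have "j \<le> e div 2" unfolding j_def using n2 by (rule div_le_mono2[rotated]) simp
    moreover have "e \<ge> 2" using n2 P(1) by simp
    ultimately have "j + 1 \<le> e" by linarith
    also have "e \<le> e * s" using s1 by simp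
    finally have j1: "j + 1 \<le> e * s" .
    have big: "e < degree P * (j + 1)" unfolding j_def
      using dividend_less_times_div[of "degree P" e] n2 by simp
    have "degree P * j \<le> e" unfolding j_def by simp
    then have "degree P * (j + 1) \<le> 2 * e" using P(1) by (simp add: algebra_simps)
    also have "\<dots> \<le> p * e" using p2 by (rule mult_le_mono1)
    also have "\<dots> < CARD('f)" using q by simp
    finally have small: "degree P * (j + 1) < CARD('f)" .
    obtain Q where Q: "degree Q \<le> e" "\<And>y. f y ^ (j + 1) = poly Q y"
      using diff_power_span_id_poly[OF fj[OF j1]] by metis
    have "P ^ (j + 1) = Q"
    proof (rule poly_eq_of_agree)
      show "degree (P ^ (j + 1)) < CARD('f)"
        by (rule le_less_trans[OF degree_power_le small])
      show "degree Q < CARD('f)" using Q(1) big small by linarith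
      show "poly (P ^ (j + 1)) x = poly Q x" for x
        using Q(2)[of x] P(2)[of x] by (simp only: poly_power)
    qed
    moreover have "degree (P ^ (j + 1)) = degree P * (j + 1)"
      using n2 by (subst degree_power_eq) auto
    ultimately show False using Q(1) big by simp
  qed
  then have fy: "f y = coeff P 0 + coeff P 1 * y" for y
    unfolding P(2) by (rule poly_of_degree_le_1)
  have "coeff P 0 = 0" using fy[of 0] f(2) by simp
  moreover from this have "coeff P 1 = 1" using fy[of 1] f(3) by simp
  ultimately show ?thesis by (intro ext) (simp add: fy del: One_nat_def)
qed

text \<open>The functions of \<open>y\<close> that lie in all spans for \<open>f\<close> and \<open>e * s\<close>, with \<open>0 < s < p\<close> prime to the
  characteristic, have the form \<open>b + c * f y\<close>. The hypothesis identifies these spans with spans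
  for the identity and \<open>e * a * s\<close>, so the translates and dilates of \<open>f\<close> lie in all of them too. The
  prime field is a separate case: there the spans are nested, and their intersection is larger in general.\<close>
theorem power_residue_map_imp_field_hom:
  fixes f :: "'f::{field,finite} \<Rightarrow> 'f"
  assumes p: "prime p" and q: "CARD('f) = 1 + p * e" and ep: "e < p" and pp: "primepow CARD('f)"
    and f: "bij f" "f 0 = 0" "f 1 = 1"
    and a: "\<And>x y. (f x - f y) ^ e = (x - y) ^ (e * a)"
  shows "field_hom f"
proof -
  define r where "r = CHAR('f)"
  have r: "prime r" unfolding r_def by (rule prime_CHAR_finite_field)
  obtain d where d: "d \<ge> 1" "CARD('f) = CHAR('f) ^ d" using card_field_eq_CHAR_power[OF pp] by blast
  have p2: "p \<ge> 2" using p by (rule prime_ge_2_nat)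
  have e1: "e \<ge> 1" using q card_field_gt_1[where 'f='f] by (cases e) auto
  \<comment> \<open>otherwise the hypothesis at \<open>y = 0\<close> makes every nonzero element an \<open>e\<close>-th root of unity\<close>
  have pa: "\<not> p dvd a"
  proof
    assume "p dvd a"
    then obtain b where b: "a = p * b" by blast
    have one: "f x ^ e = 1" if "x \<noteq> 0" for x
    proof -
      have "f x ^ e = x ^ (e * a)" using a[of x 0] f(2) by simp
      also have "e * a = (CARD('f) - 1) * b" using b q by (simp add: algebra_simps)
      finally show ?thesis using that by (simp add: power_mult field_power_card_minus_1 del: One_nat_def)
    qed
    have "e * 2 \<le> e * p" using p2 by simp
    then have "e < CARD('f) - 1" using q e1 by (simp add: mult.commute)
    then obtain g :: 'f where g: "g \<noteq> 0" "g ^ e \<noteq> 1" using ex_power_neq_1[of e] e1 by auto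
    obtain x where "g = f x" using f(1) bij_is_surj by (metis surjD)
    then show False using one[of x] g f(2) by metis
  qed
  show ?thesis
  proof (cases "d = 1")
    case True
    then have "CARD('f) = CHAR('f)" using d(2) by simp
    then have "f = (\<lambda>x. x)" using power_residue_map_prime_field[OF p q _ f a pa] by blast
    then show ?thesis by unfold_locales auto
  next
    case False
    then have d2: "d \<ge> 2" using d(1) by simp
    have qpp: "CARD('f) < p * p"
    proof -
      have "p * (e + 1) \<le> p * p" using ep by (intro mult_le_mono2) simp
      then show ?thesis using q p2 by (simp add: algebra_simps)
    qed
    have rp: "r < p"
    proof (rule ccontr)
      assume "\<not> r < p"
      then have "p * p \<le> r * r" by (intro mult_le_mono) auto
      also have "\<dots> = r ^ 2" by (simp add: power2_eq_square)
      also have "\<dots> \<le> r ^ d" using d2 prime_gt_0_nat[OF r] by (intro power_increasing) auto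
      finally show False using qpp d(2) r_def by simp
    qed
    \<comment> \<open>\<open>r\<close> has order \<open>d\<close> modulo \<open>p\<close>: otherwise \<open>q\<close> is a product of two powers of \<open>r\<close> that are
      congruent to \<open>1\<close> and hence exceed \<open>p\<close>, contradicting \<open>q < p * p\<close>\<close>
    have big: "p < r ^ l" if "r ^ l mod p = 1" "l \<ge> 1" for l
    proof (rule ccontr)
      assume "\<not> p < r ^ l"
      then consider "r ^ l = p" | "r ^ l < p" by linarith
      then have "r ^ l = 1" using that(1) by cases auto
      moreover have "r ^ l > 1" using that(2) prime_gt_1_nat[OF r] by (intro one_less_power) auto
      ultimately show False by linarith
    qed
    have ord: "r ^ l mod p \<noteq> 1" if l: "1 \<le> l" "l < d" for l
    proof
      assume *: "r ^ l mod p = 1"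
      have qd: "r ^ d = r ^ l * r ^ (d - l)" using l power_add[of r l "d - l"] by simp
      have "r ^ d = 1 + p * e" using q d(2) r_def by simp
      then have "r ^ d mod p = 1" using p2 by (simp only: mod_mult_self2 mod_less)
      then have "(r ^ l mod p) * r ^ (d - l) mod p = 1" unfolding qd by (simp only: mod_mult_left_eq)
      then have "r ^ (d - l) mod p = 1" using * by simp
      then have "p < r ^ (d - l)" using big[of "d - l"] l by simp
      moreover have "p < r ^ l" using big[OF *] l by simp
      ultimately have "p * p < r ^ l * r ^ (d - l)" using p2
        by (intro mult_strict_mono) linarith+
      then show False using qpp d(2) qd r_def by simp
    qed
    have re: "\<not> r dvd e"
    proof
      assume "r dvd e"
      then have "r dvd p * e" by simp
      moreover have "r dvd 1 + p * e" using q d r_def by (metis dvd_power le_eq_less_or_eq less_one zero_less_one less_le_trans)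
      ultimately have "r dvd 1" using dvd_add_left_iff by blast
      then show False using r not_prime_unit by blast
    qed
    define W where "W = {g. \<forall>s. 1 \<le> s \<longrightarrow> s < p \<longrightarrow> \<not> CHAR('f) dvd s \<longrightarrow> g \<in> diff_power_span f (e * s)}"
    have span: "diff_power_span f (e * s) = diff_power_span (\<lambda>x. x) (e * a * s)" for s
      by (simp add: diff_power_span_def power_mult a)
    have W_affine: "\<exists>b c. \<forall>y. g y = b + c * f y" if "g \<in> W" for g
    proof -
      define h where "h = g \<circ> inv_into UNIV f"
      have gh: "g = h \<circ> f" unfolding h_def using f(1) by (auto simp: bij_is_inj inv_f_f)
      have "h \<in> diff_power_span (\<lambda>x. x) (e * s)" if "1 \<le> s" "s < p" "\<not> CHAR('f) dvd s" for s
        using \<open>g \<in> W\<close> that diff_power_span_comp[OF f(1)] unfolding gh W_def by blast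
      then obtain b c where "\<And>y. h y = b + c * y"
        using diff_power_span_affine[OF p q d(2), of h] rp ord unfolding r_def by metis
      then show ?thesis unfolding gh by (metis comp_apply)
    qed
    have fW: "f \<in> W" unfolding W_def
    proof (intro CollectI allI impI)
      fix s assume s: "1 \<le> s" "s < p" "\<not> CHAR('f) dvd s"
      have "\<not> CHAR('f) dvd e * s"
        using s(3) re prime_dvd_mult_iff[OF r, of e s] unfolding r_def by blast
      then have "of_nat (e * s choose 1) \<noteq> (0::'f)" unfolding of_nat_eq_0_iff_char_dvd by simp
      moreover have "e * s < CARD('f) - 1" using s(2) e1 q by simp
      moreover have "1 \<le> e * s" using s(1) e1 by simp
      ultimately have "(\<lambda>y::'f. y ^ 1) \<in> diff_power_span (\<lambda>x. x) (e * s)"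
        by (intro monomial_in_diff_power_span_id)
      then have "(\<lambda>y. y ^ 1) \<circ> f \<in> diff_power_span f (e * s)"
        using diff_power_span_comp[OF f(1)] by blast
      then show "f \<in> diff_power_span f (e * s)" by (simp add: comp_def)
    qed
    have tr: "(\<lambda>y. f (y + t)) \<in> W" for t
      using fW diff_power_span_translate unfolding W_def span by blast
    have dil: "(\<lambda>y. f (c * y)) \<in> W" if "c \<noteq> 0" for c
      using fW diff_power_span_dilate[OF _ that] unfolding W_def span by blast
    have add: "f (x + y) = f x + f y" for x y
      by (rule affine_shifts_imp_additive[OF f(2,3)]) (use W_affine[OF tr] in blast)
    have mult: "f (c * y) = f c * f y" for c y
    proof (cases "c = 0")
      case True
      then show ?thesis using f(2) by simp
    next
      case False
      obtain b b' where b: "\<And>y. f (c * y) = b + b' * f y" using W_affine[OF dil[OF False]] by blast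
      have "b = 0" using b[of 0] f(2) by simp
      moreover have "b' = f c" using b[of 1] f(3) \<open>b = 0\<close> by simp
      ultimately show ?thesis using b by simp
    qed
    show ?thesis by unfold_locales (simp_all add: add mult f(2,3))
  qed
qed

section \<open>The quadratic character modulo a prime \<open>p \<equiv> 3 (mod 4)\<close>\<close>

lemma int_dvd_abs_less_imp_0:
  fixes d x :: int
  assumes "d dvd x" "\<bar>x\<bar> < d"
  shows "x = 0"
proof (rule ccontr)
  assume "x \<noteq> 0"
  from dvd_imp_le_int[OF this assms(1)] assms(2) show False by simp
qed

lemma Legendre_values: "Legendre a p \<in> {-1, 0, 1}"
  by (simp add: Legendre_def)

lemma signs_eq_of_cong:
  fixes a b :: int
  assumes "a \<in> {-1, 0, 1}" "b \<in> {-1, 0, 1}" "2 < p" "[a = b] (mod int p)"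
  shows "a = b"
proof -
  have "int p dvd a - b" using assms(4) by (simp add: cong_iff_dvd_diff)
  moreover have "\<bar>a - b\<bar> < int p" using assms(1-3) by auto
  ultimately have "a - b = 0" by (rule int_dvd_abs_less_imp_0)
  then show ?thesis by simp
qed

lemma Legendre_cong:
  assumes "prime p" "2 < p" "[a = b] (mod int p)"
  shows "Legendre a (int p) = Legendre b (int p)"
proof (rule signs_eq_of_cong[OF Legendre_values Legendre_values assms(2)])
  have "[Legendre a (int p) = a ^ ((p - 1) div 2)] (mod int p)"
    using euler_criterion[OF assms(1,2)] .
  also have "[a ^ ((p - 1) div 2) = b ^ ((p - 1) div 2)] (mod int p)"
    using assms(3) by (rule cong_pow)
  also have "[b ^ ((p - 1) div 2) = Legendre b (int p)] (mod int p)"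
    using euler_criterion[OF assms(1,2)] by (rule cong_sym)
  finally show "[Legendre a (int p) = Legendre b (int p)] (mod int p)" .
qed

lemma Legendre_mult:
  assumes "prime p" "2 < p"
  shows "Legendre (a * b) (int p) = Legendre a (int p) * Legendre b (int p)"
proof (rule signs_eq_of_cong[OF Legendre_values _ assms(2)])
  show "Legendre a (int p) * Legendre b (int p) \<in> {-1, 0, 1}"
    using Legendre_values[of a "int p"] Legendre_values[of b "int p"] by auto
  have "[Legendre (a * b) (int p) = (a * b) ^ ((p - 1) div 2)] (mod int p)"
    using euler_criterion[OF assms] .
  also have "(a * b) ^ ((p - 1) div 2) = a ^ ((p - 1) div 2) * b ^ ((p - 1) div 2)"
    by (rule power_mult_distrib)
  also have "[\<dots> = Legendre a (int p) * Legendre b (int p)] (mod int p)"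
    by (rule cong_mult[OF cong_sym[OF euler_criterion[OF assms]] cong_sym[OF euler_criterion[OF assms]]])
  finally show "[Legendre (a * b) (int p) = Legendre a (int p) * Legendre b (int p)] (mod int p)" .
qed

lemma Legendre_eq_0_iff: "Legendre a m = 0 \<longleftrightarrow> m dvd a"
  by (simp add: Legendre_def cong_0_iff)

lemma Legendre_1: "prime p \<Longrightarrow> Legendre 1 (int p) = 1"
proof -
  assume "prime p"
  then have "\<not> int p dvd 1" using prime_gt_1_nat[of p] by simp
  moreover have "QuadRes (int p) 1" unfolding QuadRes_def by (rule exI[of _ 1]) simp
  ultimately show ?thesis by (simp add: Legendre_def cong_0_iff)
qed

lemma Legendre_minus_1:
  assumes "prime p" "p mod 4 = 3"
  shows "Legendre (-1) (int p) = -1"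
proof -
  have p2: "2 < p" using assms by presburger
  have "p = 4 * (p div 4) + 3" using assms(2) mult_div_mod_eq[of 4 p] by simp
  then have "(p - 1) div 2 = 2 * (p div 4) + 1" by linarith
  then have "odd ((p - 1) div 2)" by simp
  then have "[Legendre (-1) (int p) = -1] (mod int p)"
    using euler_criterion[OF assms(1) p2, of "-1"] by simp
  then show ?thesis by (intro signs_eq_of_cong[OF Legendre_values _ p2]) auto
qed

lemma sum_residues_affine:
  fixes g :: "int \<Rightarrow> int"
  assumes p: "prime p" and a: "\<not> int p dvd a" and g: "\<And>x. g (x mod int p) = g x"
  shows "(\<Sum>i\<in>{0..<int p}. g (a * i + b)) = (\<Sum>i\<in>{0..<int p}. g i)"
proof -
  have p0: "int p > 0" using prime_gt_0_nat[OF p] by simp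
  let ?h = "\<lambda>i. (a * i + b) mod int p"
  have inj: "inj_on ?h {0..<int p}"
  proof (rule inj_onI)
    fix x y assume xy: "x \<in> {0..<int p}" "y \<in> {0..<int p}" "?h x = ?h y"
    then have "int p dvd (a * x + b) - (a * y + b)" by (metis mod_eq_dvd_iff)
    then have "int p dvd a * (x - y)" by (simp add: algebra_simps)
    then have "int p dvd x - y" using a p prime_dvd_mult_iff[of "int p" a "x - y"] by simp
    moreover have "\<bar>x - y\<bar> < int p" using xy by auto
    ultimately have "x - y = 0" by (rule int_dvd_abs_less_imp_0)
    then show "x = y" by simp
  qed
  have "?h ` {0..<int p} \<subseteq> {0..<int p}" using p0 by auto
  then have "bij_betw ?h {0..<int p} {0..<int p}"
    unfolding bij_betw_def using inj endo_inj_surj[OF _ _ inj] by simp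
  from sum.reindex_bij_betw[OF this, of g] show ?thesis by (simp add: g)
qed

lemma sum_Legendre_shift:
  assumes p: "prime p" "p mod 4 = 3"
  shows "(\<Sum>i\<in>{0..<int p}. Legendre (i + b) (int p)) = 0"
proof -
  let ?L = "\<lambda>i. Legendre i (int p)"
  have p2: "2 < p" using assms by presburger
  have per: "?L (x mod int p) = ?L x" for x
    by (rule Legendre_cong[OF p(1) p2]) (simp add: cong_def)
  have nd1: "\<not> int p dvd 1" "\<not> int p dvd -1" using p2 by auto
  have "(\<Sum>i\<in>{0..<int p}. ?L i) = (\<Sum>i\<in>{0..<int p}. ?L (-1 * i + 0))"
    using sum_residues_affine[where g = ?L, OF p(1) nd1(2) per, of 0] by simp
  also have "\<dots> = (\<Sum>i\<in>{0..<int p}. - ?L i)"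
    using Legendre_mult[OF p(1) p2, of "-1"] Legendre_minus_1[OF p] by (intro sum.cong) auto
  finally have "(\<Sum>i\<in>{0..<int p}. ?L i) = 0" by (simp add: sum_negf)
  then show ?thesis using sum_residues_affine[where g = ?L, OF p(1) nd1(1) per, of b] by simp
qed

text \<open>Writing \<open>k = i * j\<close> turns the product into \<open>Legendre (i * i) p * Legendre (j - 1) p\<close>, and \<open>j\<close>
  runs through all nonzero residues together with \<open>i\<close>.\<close>
lemma sum_Legendre_Legendre:
  assumes p: "prime p" "p mod 4 = 3" and k: "\<not> int p dvd k"
  shows "(\<Sum>i\<in>{0..<int p}. Legendre i (int p) * Legendre (k - i) (int p)) = 1"
proof -
  let ?L = "\<lambda>i. Legendre i (int p)"
  have p2: "2 < p" using p(2) by presburger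
  have pp: "prime (int p)" using p(1) by simp
  have "\<exists>j\<in>{1..<int p}. [i * j = k] (mod int p)" if i: "i \<in> {1..<int p}" for i
  proof -
    have "\<not> int p dvd i" using i by (auto dest: zdvd_imp_le)
    then have "coprime i (int p)" using pp prime_imp_coprime coprime_commute by blast
    then obtain x where x: "[i * x = 1] (mod int p)" using cong_solve_coprime_int by blast
    have "[i * (x * k mod int p) = i * x * k] (mod int p)"
      by (simp add: cong_def mod_mult_right_eq mult.assoc)
    also have "[i * x * k = 1 * k] (mod int p)" using x by (rule cong_scalar_right)
    finally have *: "[i * (x * k mod int p) = k] (mod int p)" by simp
    have "x * k mod int p \<noteq> 0"
    proof
      assume "x * k mod int p = 0"
      then have "[0 = k] (mod int p)" using * by simp
      then show False using k cong_0_iff cong_sym by blast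
    qed
    moreover have "0 \<le> x * k mod int p" "x * k mod int p < int p" using p2 by auto
    ultimately have "x * k mod int p \<in> {1..<int p}" by simp
    then show ?thesis using * by blast
  qed
  then obtain j where j: "\<And>i. i \<in> {1..<int p} \<Longrightarrow> j i \<in> {1..<int p}"
      "\<And>i. i \<in> {1..<int p} \<Longrightarrow> [i * j i = k] (mod int p)"
    by metis
  have inj: "inj_on j {1..<int p}"
  proof (rule inj_onI)
    fix x y assume xy: "x \<in> {1..<int p}" "y \<in> {1..<int p}" "j x = j y"
    have "[x * j x = y * j x] (mod int p)" using j(2)[OF xy(1)] j(2)[OF xy(2)] xy(3)
      by (metis cong_sym cong_trans)
    then have "int p dvd (x - y) * j x" by (simp add: cong_iff_dvd_diff algebra_simps)
    moreover have "\<not> int p dvd j x" using j(1)[OF xy(1)] by (auto dest: zdvd_imp_le)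
    ultimately have "int p dvd x - y" using prime_dvd_mult_iff[OF pp] by blast
    moreover have "\<bar>x - y\<bar> < int p" using xy by auto
    ultimately have "x - y = 0" by (rule int_dvd_abs_less_imp_0)
    then show "x = y" by simp
  qed
  have "j ` {1..<int p} \<subseteq> {1..<int p}" using j(1) by auto
  then have bij: "bij_betw j {1..<int p} {1..<int p}"
    unfolding bij_betw_def using inj endo_inj_surj[OF _ _ inj] by simp
  have split: "{0..<int p} = insert 0 {1..<int p}" using p2 by auto
  have prod: "?L i * ?L (k - i) = ?L (j i + -1)" if i: "i \<in> {1..<int p}" for i
  proof -
    have "\<not> int p dvd i" using i by (auto dest: zdvd_imp_le)
    then have "?L i \<noteq> 0" by (simp add: Legendre_eq_0_iff)
    then have Li: "?L i * ?L i = 1" using Legendre_values[of i "int p"] by auto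
    have "[k - i = i * (j i + -1)] (mod int p)"
      using cong_diff[OF cong_sym[OF j(2)[OF i]] cong_refl[of i "int p"]] by (simp add: algebra_simps)
    then have "?L (k - i) = ?L (i * (j i + -1))" by (rule Legendre_cong[OF p(1) p2])
    also have "\<dots> = ?L i * ?L (j i + -1)" by (rule Legendre_mult[OF p(1) p2])
    finally show ?thesis using Li by (simp flip: mult.assoc)
  qed
  have "(\<Sum>i\<in>{0..<int p}. ?L i * ?L (k - i)) = (\<Sum>i\<in>{1..<int p}. ?L i * ?L (k - i))"
    unfolding split by (simp add: Legendre_eq_0_iff)
  also have "\<dots> = (\<Sum>i\<in>{1..<int p}. ?L (j i + -1))" using prod by (intro sum.cong) auto
  also have "\<dots> = (\<Sum>i\<in>{1..<int p}. ?L (i + -1))"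
    using sum.reindex_bij_betw[OF bij, of "\<lambda>i. ?L (i + -1)"] by simp
  also have "\<dots> = (\<Sum>i\<in>{0..<int p}. ?L (i + -1)) - ?L (-1)"
    unfolding split by simp
  also have "\<dots> = 1" using sum_Legendre_shift[OF p, of "-1"] Legendre_minus_1[OF p] by simp
  finally show ?thesis .
qed

text \<open>Summing \<open>(1 + Legendre i p) * (1 + Legendre (k - i) p)\<close> over all residues counts each solution
  four times; the residues \<open>0\<close> and \<open>k\<close> contribute \<open>1 + Legendre k p\<close> each.\<close>
lemma card_residue_sums:
  assumes p: "prime p" "p mod 4 = 3" and k: "\<not> int p dvd k"
  shows "4 * int (card {i \<in> {0..<int p}. Legendre i (int p) = 1 \<and> Legendre (k - i) (int p) = 1})
    = int p - 1 - 2 * Legendre k (int p)"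
proof -
  let ?L = "\<lambda>i. Legendre i (int p)"
  let ?I = "{0..<int p}"
  have p2: "2 < p" using p(2) by presburger
  define k' where "k' = k mod int p"
  have k': "k' \<in> ?I" "k' \<noteq> 0" using p2 k unfolding k'_def by (auto simp: dvd_eq_mod_eq_0)
  have Lk: "?L k' = ?L k" unfolding k'_def
    by (rule Legendre_cong[OF p(1) p2]) (simp add: cong_def)
  have kk: "int p dvd k - i \<longleftrightarrow> i = k'" if "i \<in> ?I" for i
    unfolding k'_def using that by (metis atLeastLessThan_iff mod_eq_dvd_iff mod_pos_pos_trivial)
  have summand: "(1 + ?L i) * (1 + ?L (k - i)) =
      (if ?L i = 1 \<and> ?L (k - i) = 1 then 4 else 0) + (if i = 0 then 1 + ?L k else 0)
      + (if i = k' then 1 + ?L k else 0)" if i: "i \<in> ?I" for i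
  proof -
    have "?L i = 0 \<longleftrightarrow> i = 0" using i by (auto simp: Legendre_eq_0_iff dest: zdvd_imp_le)
    moreover have "?L (k - i) = 0 \<longleftrightarrow> i = k'" using kk[OF i] by (simp add: Legendre_eq_0_iff)
    moreover have "?L i \<in> {-1, 0, 1}" "?L (k - i) \<in> {-1, 0, 1}" by (rule Legendre_values)+
    ultimately show ?thesis using k'(2) Lk by (cases "i = 0"; cases "i = k'") auto
  qed
  have per: "?L (x mod int p) = ?L x" for x
    by (rule Legendre_cong[OF p(1) p2]) (simp add: cong_def)
  have nd: "\<not> int p dvd -1" using p2 by auto
  have s1: "(\<Sum>i\<in>?I. ?L i) = 0" using sum_Legendre_shift[OF p, of 0] by simp
  have s2: "(\<Sum>i\<in>?I. ?L (k - i)) = 0"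
    using sum_residues_affine[where g = ?L, OF p(1) nd per, of k] s1 by simp
  have "(\<Sum>i\<in>?I. (1 + ?L i) * (1 + ?L (k - i))) = (\<Sum>i\<in>?I. 1 + ?L i + ?L (k - i) + ?L i * ?L (k - i))"
    by (intro sum.cong) (auto simp: algebra_simps)
  also have "\<dots> = int p + 1"
    using s1 s2 sum_Legendre_Legendre[OF p k] by (simp add: sum.distrib)
  finally have tot: "(\<Sum>i\<in>?I. (1 + ?L i) * (1 + ?L (k - i))) = int p + 1" .
  have "(\<Sum>i\<in>?I. (1 + ?L i) * (1 + ?L (k - i)))
     = (\<Sum>i\<in>?I. if ?L i = 1 \<and> ?L (k - i) = 1 then 4 else 0) + (1 + ?L k) + (1 + ?L k)"
    using k' p2 by (simp add: summand sum.distrib)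
  also have "(\<Sum>i\<in>?I. if ?L i = 1 \<and> ?L (k - i) = 1 then 4 else 0)
     = 4 * int (card {i \<in> ?I. ?L i = 1 \<and> ?L (k - i) = 1})"
    by (simp add: sum.If_cases Int_def)
  finally show ?thesis using tot by simp
qed

section \<open>Power residues and Paley sets\<close>

text \<open>Below, \<open>K\<close> stands for the group \<open>{x. x ^ e = 1}\<close> of \<open>p\<close>-th powers. The power \<open>x ^ e\<close>, an element of
  the group \<open>mu\<close> of \<open>p\<close>-th roots of unity, serves as a name for the coset of \<open>x\<close> modulo \<open>K\<close>.\<close>
locale mathon_field =
  fixes p e :: nat and F :: "'f::{field,finite} itself"
  assumes p: "prime p" and pe: "p = 4 * e + 3" and q: "CARD('f) = 1 + p * e"
    and pp: "primepow CARD('f)"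

context mathon_field
begin

lemma e_ge_1: "e \<ge> 1"
  using q card_field_gt_1[where 'f='f] by (cases e) auto

lemma zero_power_e [simp]: "(0::'f) ^ e = 0"
  using e_ge_1 by (simp add: power_0_left)

lemma p_mod_4: "p mod 4 = 3"
  by (simp add: pe)

lemma p_gt_2: "2 < p"
  by (simp add: pe)

definition mu :: "'f set" where
  "mu = {z. z ^ p = 1}"

lemma power_e_in_mu: "x \<noteq> 0 \<Longrightarrow> x ^ e \<in> mu"
  using field_power_card_minus_1[of x] q by (simp add: mu_def mult.commute flip: power_mult)

lemma power_p_power_e: "x \<noteq> 0 \<Longrightarrow> (x ^ p) ^ e = 1" for x :: 'f
  using field_power_card_minus_1[of x] q by (simp flip: power_mult)

lemma mu_neq_0: "z \<in> mu \<Longrightarrow> z \<noteq> 0"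
  using p_gt_2 by (auto simp: mu_def power_0_left)

lemma mu_1: "1 \<in> mu"
  by (simp add: mu_def)

lemma mu_power:
  assumes "z \<in> mu"
  shows "z ^ n \<in> mu"
proof -
  have "(z ^ n) ^ p = (z ^ p) ^ n" by (simp only: power_mult[symmetric] mult.commute)
  then show ?thesis using assms by (simp add: mu_def)
qed

lemma mu_inverse: "z \<in> mu \<Longrightarrow> inverse z \<in> mu"
  by (simp add: mu_def power_inverse)

lemma minus_1_power_e: "(- 1 :: 'f) ^ e = 1"
proof -
  have "(- 1 :: 'f) = (- 1) ^ p" using p_gt_2 p by (simp add: pe)
  then show ?thesis using power_p_power_e[of "- 1"] by simp
qed

lemma minus_power_e: "(- x) ^ e = x ^ e" for x :: 'f
  using minus_1_power_e power_mult_distrib[of "- 1" x e] by simp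

text \<open>Both numbers are upper bounds, as numbers of roots; the fibres of \<open>x \<mapsto> x ^ e\<close> over \<open>mu\<close>
  partition the \<open>p * e\<close> nonzero elements, which forces equality.\<close>
lemma card_fibre_and_mu:
  shows "card mu = p" and "z \<in> mu \<Longrightarrow> card {x. x ^ e = z} = e"
proof -
  have le: "card {x. x ^ e = z} \<le> e" for z :: 'f using e_ge_1 by (rule card_roots_le)
  have mle: "card mu \<le> p" unfolding mu_def using p_gt_2 by (intro card_roots_le) simp
  have part: "UNIV - {0::'f} = (\<Union>z\<in>mu. {x. x ^ e = z})"
    using power_e_in_mu e_ge_1 by (auto simp: power_0_left dest: mu_neq_0)
  have tot: "p * e = (\<Sum>z\<in>mu. card {x. x ^ e = z})"
  proof -
    have "p * e = card (UNIV - {0::'f})" using card_nonzero_field[where 'f='f] q by simp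
    also have "\<dots> = (\<Sum>z\<in>mu. card {x. x ^ e = z})" unfolding part by (rule card_UN_disjoint) auto
    finally show ?thesis .
  qed
  also have "\<dots> \<le> card mu * e" using sum_bounded_above[of mu "\<lambda>z. card {x. x ^ e = z}" e] le by simp
  finally have "p * e \<le> card mu * e" .
  then have "p \<le> card mu" using e_ge_1 by simp
  then show cm: "card mu = p" using mle by simp
  have "(\<Sum>z\<in>mu. e - card {x. x ^ e = z}) = card mu * e - p * e"
    using sum_subtractf_nat[of mu "\<lambda>z. card {x. x ^ e = z}" "\<lambda>z. e"] le tot by simp
  then have "(\<Sum>z\<in>mu. e - card {x. x ^ e = z}) = 0" using cm by simp
  then have "\<forall>z\<in>mu. e - card {x. x ^ e = z} = 0" by simp
  then show "card {x. x ^ e = z} = e" if "z \<in> mu" using that le[of z] by auto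
qed

lemma ex_power_e:
  assumes "z \<in> mu"
  obtains x where "x \<noteq> 0" "x ^ e = z"
proof -
  have "card {x. x ^ e = z} \<noteq> 0" using card_fibre_and_mu(2)[OF assms] e_ge_1 by simp
  then have "{x. x ^ e = z} \<noteq> {}" by (metis card.empty)
  then obtain x where x: "x ^ e = z" by blast
  moreover have "x \<noteq> 0" using x mu_neq_0[OF assms] e_ge_1 by (auto simp: power_0_left)
  ultimately show ?thesis using that by blast
qed

text \<open>These are the properties of the connection set of the Paley tournament that enter the proof: it
  is a tournament, it has the path counts of the Paley tournament, and field automorphisms preserve
  it. They are inherited by the set of inverses, which gives the second digraph.\<close>
definition paley_set :: "'f set \<Rightarrow> bool" where
  "paley_set S \<longleftrightarrow> S \<subseteq> mu \<and> 1 \<notin> S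
     \<and> (\<forall>z\<in>mu. z \<noteq> 1 \<longrightarrow> (inverse z \<in> S \<longleftrightarrow> z \<notin> S))
     \<and> (\<forall>w\<in>mu. w \<noteq> 1 \<longrightarrow> card {z\<in>S. w / z \<in> S} = (if w \<in> S then e else e + 1))
     \<and> (\<forall>\<sigma>. field_hom \<sigma> \<longrightarrow> (\<forall>z\<in>mu. \<sigma> z \<in> S \<longleftrightarrow> z \<in> S))"

lemma mu_power_eq_iff:
  assumes "z \<in> mu" "z \<noteq> 1"
  shows "z ^ m = z ^ n \<longleftrightarrow> [m = n] (mod p)"
proof -
  have per: "z ^ m = z ^ (m mod p)" for m
  proof -
    have "z ^ m = z ^ (p * (m div p) + m mod p)" by simp
    also have "\<dots> = z ^ (m mod p)" using assms(1) unfolding power_add power_mult mu_def by simp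
    finally show ?thesis .
  qed
  have ord: "z ^ k \<noteq> 1" if k: "0 < k" "k < p" for k
  proof
    assume "z ^ k = 1"
    have "\<not> p dvd k" using k by (auto dest: dvd_imp_le)
    then have "coprime k p" unfolding coprime_commute[of k p] using p by (intro prime_imp_coprime)
    then obtain x where "[k * x = 1] (mod p)" using cong_solve_coprime_nat[of k p] by auto
    then have "k * x mod p = 1" using p_gt_2 by (simp add: cong_def)
    then have "z = z ^ (k * x)" using per[of "k * x"] by simp
    then show False using \<open>z ^ k = 1\<close> assms(2) by (simp add: power_mult)
  qed
  have ne: "z ^ i \<noteq> z ^ j" if "i < j" "j < p" for i j
  proof
    assume "z ^ i = z ^ j"
    moreover have "z ^ j = z ^ i * z ^ (j - i)" using that by (simp flip: power_add)
    ultimately have "z ^ (j - i) = 1" using mu_neq_0[OF assms(1)] by simp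
    then show False using ord[of "j - i"] that by simp
  qed
  have mp: "x mod p < p" for x using p_gt_2 by simp
  have "z ^ m = z ^ n \<longleftrightarrow> z ^ (m mod p) = z ^ (n mod p)" by (simp only: per[symmetric])
  also have "\<dots> \<longleftrightarrow> m mod p = n mod p" using ne mp by (metis linorder_neqE_nat)
  finally show ?thesis by (simp add: cong_def)
qed

lemma mu_eq_powers:
  assumes "z \<in> mu" "z \<noteq> 1"
  shows "bij_betw (\<lambda>n. z ^ n) {..<p} mu"
proof -
  have inj: "inj_on (\<lambda>n. z ^ n) {..<p}"
    by (rule inj_onI) (auto simp: mu_power_eq_iff[OF assms] cong_def)
  have "(\<lambda>n. z ^ n) ` {..<p} \<subseteq> mu"
    using mu_power[OF assms(1)] by auto
  then have "(\<lambda>n. z ^ n) ` {..<p} = mu"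
    using card_fibre_and_mu(1) card_image[OF inj] by (intro card_subset_eq) auto
  then show ?thesis using inj by (simp add: bij_betw_def)
qed

lemma ex_mu_neq_1: "\<exists>z\<in>mu. z \<noteq> 1"
proof (rule ccontr)
  assume "\<not> ?thesis"
  then have "mu \<subseteq> {1}" by auto
  then have "card mu \<le> 1" using card_mono[of "{1}" mu] by simp
  then show False using card_fibre_and_mu(1) p_gt_2 by simp
qed

text \<open>The number of elements lies strictly between \<open>(2 * e)\<^sup>2\<close> and \<open>(2 * e + 1)\<^sup>2\<close>.\<close>
lemma card_not_square: "CARD('f) \<noteq> y ^ 2"
proof
  assume y: "CARD('f) = y ^ 2"
  have q': "CARD('f) = 4 * (e * e) + 3 * e + 1" using q pe by (simp add: algebra_simps)
  have "(2 * e) ^ 2 < y ^ 2" unfolding y[symmetric] q' by (simp add: power2_eq_square)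
  then have "2 * e < y" by (rule power_less_imp_less_base) simp
  moreover have "y ^ 2 < (2 * e + 1) ^ 2" unfolding y[symmetric] q' using e_ge_1
    by (simp add: power2_eq_square)
  then have "y < 2 * e + 1" by (rule power_less_imp_less_base) simp
  ultimately show False by simp
qed

text \<open>The field has \<open>r ^ d \<equiv> 1 (mod p)\<close> elements, \<open>r\<close> being the characteristic, and \<open>d\<close> is odd since
  this is not a square. So \<open>r\<close> is a square modulo \<open>p\<close>.\<close>
lemma Legendre_CHAR: "Legendre (int CHAR('f)) (int p) = 1"
proof -
  let ?L = "\<lambda>i. Legendre i (int p)"
  obtain d where d: "CARD('f) = CHAR('f) ^ d" using card_field_eq_CHAR_power[OF pp] by blast
  have odd: "odd d"
  proof
    assume "even d"
    then obtain c where "d = c * 2" by (metis dvdE mult.commute)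
    then have "CARD('f) = (CHAR('f) ^ c) ^ 2" by (simp add: d power_mult)
    then show False using card_not_square by blast
  qed
  have Lpow: "?L (int CHAR('f) ^ n) = ?L (int CHAR('f)) ^ n" for n
    by (induction n) (simp_all add: Legendre_1[OF p] Legendre_mult[OF p p_gt_2])
  have "int CHAR('f) ^ d = 1 + int p * int e" using d q by (metis of_nat_1 of_nat_add of_nat_mult of_nat_power)
  then have "[int CHAR('f) ^ d = 1] (mod int p)" by (simp add: cong_def)
  then have "?L (int CHAR('f)) ^ d = 1"
    using Legendre_cong[OF p p_gt_2] Legendre_1[OF p] Lpow by metis
  moreover have "?L (int CHAR('f)) \<in> {-1, 0, 1}" by (rule Legendre_values)
  ultimately show ?thesis using odd by (auto simp: power_0_left split: if_splits)
qed

text \<open>The powers \<open>z ^ n\<close> of a generator \<open>z\<close> of \<open>mu\<close> with \<open>n\<close> a nonzero square modulo \<open>p\<close>. A field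
  automorphism raises \<open>z\<close> to a power of the characteristic, which is a square modulo \<open>p\<close>.\<close>
lemma ex_paley_set: "\<exists>S. paley_set S"
proof -
  let ?L = "\<lambda>i. Legendre i (int p)"
  obtain z where z: "z \<in> mu" "z \<noteq> 1" using ex_mu_neq_1 by blast
  define S where "S = {z ^ n | n. ?L (int n) = 1}"
  have Lcong: "?L a = ?L b" if "[a = b] (mod int p)" for a b
    by (rule Legendre_cong[OF p p_gt_2 that])
  have inS: "z ^ n \<in> S \<longleftrightarrow> ?L (int n) = 1" for n
  proof
    assume "z ^ n \<in> S"
    then obtain m where m: "z ^ n = z ^ m" "?L (int m) = 1" by (auto simp: S_def)
    then have "[int n = int m] (mod int p)" using mu_power_eq_iff[OF z] by (simp add: cong_int_iff)
    then show "?L (int n) = 1" using Lcong m(2) by metis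
  qed (auto simp: S_def)
  have bij: "bij_betw (\<lambda>n. z ^ n) {..<p} mu" by (rule mu_eq_powers[OF z])
  have ex: "\<exists>n<p. w = z ^ n" if "w \<in> mu" for w
    using that bij_betw_imp_surj_on[OF bij] by (metis imageE lessThan_iff)
  have Smu: "S \<subseteq> mu" using mu_power[OF z(1)] by (auto simp: S_def)
  have z1: "z ^ n = 1 \<longleftrightarrow> p dvd n" for n
    using mu_power_eq_iff[OF z, of n 0] by (simp add: cong_0_iff)
  have inv: "inverse (z ^ n) = z ^ (p - n)" if "n \<le> p" for n
  proof -
    have "z ^ n * z ^ (p - n) = z ^ p" using that by (simp flip: power_add)
    also have "z ^ p = 1" using z(1) by (simp add: mu_def)
    finally show ?thesis by (metis inverse_unique)
  qed
  have Lneg: "?L (int (p - n)) = - ?L (int n)" if "n \<le> p" for n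
  proof -
    have "[int (p - n) = -1 * int n] (mod int p)" using that by (simp add: cong_iff_dvd_diff of_nat_diff)
    then have "?L (int (p - n)) = ?L (-1 * int n)" by (rule Lcong)
    then show ?thesis unfolding Legendre_mult[OF p p_gt_2] Legendre_minus_1[OF p p_mod_4] by simp
  qed
  have "paley_set S" unfolding paley_set_def
  proof (intro conjI ballI impI allI)
    show "S \<subseteq> mu" by (rule Smu)
    show "1 \<notin> S" using inS[of 0] by (simp add: Legendre_eq_0_iff[THEN iffD2])
    fix w assume w: "w \<in> mu" "w \<noteq> 1"
    obtain k where k: "k < p" "w = z ^ k" using ex[OF w(1)] by blast
    have nk: "\<not> int p dvd int k" using w(2) k z1 by auto
    then have "?L (int k) \<noteq> 0" by (simp add: Legendre_eq_0_iff)
    then have Lk: "?L (int k) = 1 \<or> ?L (int k) = -1" using Legendre_values[of "int k" "int p"] by auto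
    have invk: "inverse w = z ^ (p - k)" using inv[of k] k by simp
    have "inverse w \<in> S \<longleftrightarrow> ?L (int (p - k)) = 1" unfolding invk by (rule inS)
    moreover have "w \<in> S \<longleftrightarrow> ?L (int k) = 1" unfolding k(2) by (rule inS)
    moreover have "?L (int (p - k)) = - ?L (int k)" using k(1) by (intro Lneg) simp
    ultimately show "inverse w \<in> S \<longleftrightarrow> w \<notin> S" using Lk by auto
    have cs: "{x\<in>S. w / x \<in> S} = (\<lambda>n. z ^ n) ` {n. n < p \<and> ?L (int n) = 1 \<and> ?L (int k - int n) = 1}"
    proof -
      have "w / z ^ n \<in> S \<longleftrightarrow> ?L (int k - int n) = 1" if "n < p" for n
      proof -
        have "w / z ^ n = z ^ (k + (p - n))"
          by (simp only: divide_inverse inv[OF less_imp_le[OF that]] k(2) power_add)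
        moreover have "[int (k + (p - n)) = int k - int n] (mod int p)"
          using that by (simp add: cong_iff_dvd_diff of_nat_diff)
        ultimately show ?thesis using inS Lcong by metis
      qed
      then show ?thesis using ex Smu inS by (auto simp: image_iff subset_iff) metis+
    qed
    have "int ` {n. n < p \<and> ?L (int n) = 1 \<and> ?L (int k - int n) = 1}
       = {i \<in> {0..<int p}. ?L i = 1 \<and> ?L (int k - i) = 1}"
      by (auto simp: image_iff) (metis nat_less_iff zero_le_imp_eq_int of_nat_less_iff)
    moreover have "card (int ` {n. n < p \<and> ?L (int n) = 1 \<and> ?L (int k - int n) = 1})
       = card {n. n < p \<and> ?L (int n) = 1 \<and> ?L (int k - int n) = 1}"
      by (rule card_image) simp
    ultimately have "card {n. n < p \<and> ?L (int n) = 1 \<and> ?L (int k - int n) = 1}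
       = card {i \<in> {0..<int p}. ?L i = 1 \<and> ?L (int k - i) = 1}" by simp
    moreover have "card {x\<in>S. w / x \<in> S} = card {n. n < p \<and> ?L (int n) = 1 \<and> ?L (int k - int n) = 1}"
      unfolding cs by (rule card_image, rule inj_on_subset[OF bij_betw_imp_inj_on[OF bij]]) auto
    ultimately have "4 * int (card {x\<in>S. w / x \<in> S}) = int p - 1 - 2 * ?L (int k)"
      using card_residue_sums[OF p p_mod_4 nk] by simp
    then show "card {x\<in>S. w / x \<in> S} = (if w \<in> S then e else e + 1)"
      using Lk pe unfolding k(2) inS by auto
  next
    fix \<sigma> :: "'f \<Rightarrow> 'f" and w assume \<sigma>: "field_hom \<sigma>" and w: "w \<in> mu"
    obtain k where k: "\<And>y. \<sigma> y = y ^ (CHAR('f) ^ k)" using field_hom_eq_CHAR_power[OF \<sigma>] by blast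
    obtain n where n: "w = z ^ n" using ex[OF w] by blast
    have "?L (int n * int CHAR('f) ^ k) = ?L (int n)"
      by (induction k) (simp_all add: Legendre_mult[OF p p_gt_2] Legendre_CHAR Legendre_1[OF p])
    then have "?L (int (n * CHAR('f) ^ k)) = ?L (int n)" by simp
    moreover have "\<sigma> w = z ^ (n * CHAR('f) ^ k)" by (simp add: k n power_mult)
    ultimately show "\<sigma> w \<in> S \<longleftrightarrow> w \<in> S" using inS n by metis
  qed
  then show ?thesis by blast
qed

lemma card_paley_set:
  assumes "paley_set S"
  shows "card S = 2 * e + 1"
proof -
  have S: "S \<subseteq> mu" "1 \<notin> S" "\<And>z. z \<in> mu \<Longrightarrow> z \<noteq> 1 \<Longrightarrow> (inverse z \<in> S \<longleftrightarrow> z \<notin> S)"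
    using assms by (auto simp: paley_set_def)
  have "mu = insert 1 (S \<union> inverse ` S)"
  proof -
    have "x \<in> inverse ` S" if "x \<in> mu" "x \<noteq> 1" "x \<notin> S" for x
      using S(3)[OF that(1,2)] that(3) by (metis imageI inverse_inverse_eq)
    then show ?thesis using S(1) mu_1 mu_inverse by auto
  qed
  moreover have "S \<inter> inverse ` S = {}" using S by (auto simp: subset_iff)
  moreover have "1 \<notin> S \<union> inverse ` S" using S(2) by auto
  moreover have "card (inverse ` S) = card S" by (rule card_image) (simp add: inj_on_def)
  ultimately show ?thesis using card_fibre_and_mu(1) pe by (simp add: card_Un_disjoint)
qed

lemma paley_set_inverse:
  assumes "paley_set S"
  shows "paley_set (inverse ` S)"
proof -
  have S: "S \<subseteq> mu" "1 \<notin> S" "\<And>z. z \<in> mu \<Longrightarrow> z \<noteq> 1 \<Longrightarrow> (inverse z \<in> S \<longleftrightarrow> z \<notin> S)"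
    "\<And>w. w \<in> mu \<Longrightarrow> w \<noteq> 1 \<Longrightarrow> card {z\<in>S. w / z \<in> S} = (if w \<in> S then e else e + 1)"
    "\<And>\<sigma> z. field_hom \<sigma> \<Longrightarrow> z \<in> mu \<Longrightarrow> \<sigma> z \<in> S \<longleftrightarrow> z \<in> S"
    using assms unfolding paley_set_def by blast+
  have im: "x \<in> inverse ` A \<longleftrightarrow> inverse x \<in> A" for x :: 'f and A by (metis imageE imageI inverse_inverse_eq)
  show ?thesis unfolding paley_set_def
  proof (intro conjI ballI impI allI)
    show "inverse ` S \<subseteq> mu" using S(1) mu_inverse by auto
    show "1 \<notin> inverse ` S" using S(2) im by simp
    fix w assume w: "w \<in> mu" "w \<noteq> 1"
    show "inverse w \<in> inverse ` S \<longleftrightarrow> w \<notin> inverse ` S" unfolding im using S(3)[OF w] by auto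
    have "{x \<in> inverse ` S. w / x \<in> inverse ` S} = inverse ` {x \<in> S. inverse w / x \<in> S}"
      by (rule Set.set_eqI) (simp add: im divide_inverse mult.commute)
    then have "card {x \<in> inverse ` S. w / x \<in> inverse ` S} = card {x \<in> S. inverse w / x \<in> S}"
      by (simp add: card_image inj_on_def)
    then show "card {x \<in> inverse ` S. w / x \<in> inverse ` S} = (if w \<in> inverse ` S then e else e + 1)"
      unfolding im using S(4)[of "inverse w"] mu_inverse[OF w(1)] w(2) by simp
  next
    fix \<sigma> :: "'f \<Rightarrow> 'f" and w assume \<sigma>: "field_hom \<sigma>" and w: "w \<in> mu"
    interpret field_hom \<sigma> by fact
    show "\<sigma> w \<in> inverse ` S \<longleftrightarrow> w \<in> inverse ` S"
      unfolding im using S(5)[OF \<sigma> mu_inverse[OF w]] by (simp add: hom_inverse)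
  qed
qed

end

section \<open>Pairs of vectors, matrices and determinants\<close>

definition det2 :: "'f::{field,finite} \<times> 'f \<Rightarrow> 'f \<times> 'f \<Rightarrow> 'f" where
  "det2 u v = fst u * snd v - snd u * fst v"

definition scale2 :: "'f::{field,finite} \<Rightarrow> 'f \<times> 'f \<Rightarrow> 'f \<times> 'f" where
  "scale2 c u = (c * fst u, c * snd u)"

lemma det2_scale2 [simp]: "det2 (scale2 c u) v = c * det2 u v" "det2 u (scale2 c v) = c * det2 u v"
  by (simp_all add: det2_def scale2_def algebra_simps)

lemma scale2_scale2 [simp]: "scale2 c (scale2 d u) = scale2 (c * d) u"
  by (simp add: scale2_def mult.assoc)

lemma scale2_1 [simp]: "scale2 1 u = u"
  by (simp add: scale2_def)

lemma scale2_eq_0_iff [simp]: "scale2 c u = (0, 0) \<longleftrightarrow> c = 0 \<or> u = (0, 0)"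
  by (cases u) (auto simp: scale2_def)

lemma scale2_eq_iff: "u \<noteq> (0, 0) \<Longrightarrow> scale2 c u = scale2 d u \<longleftrightarrow> c = d"
  by (cases u) (auto simp: scale2_def)

lemma det2_self [simp]: "det2 u u = 0"
  by (simp add: det2_def)

lemma det2_swap: "det2 v u = - det2 u v"
  by (simp add: det2_def)

lemma det2_0 [simp]: "det2 (0, 0) v = 0" "det2 u (0, 0) = 0"
  by (simp_all add: det2_def)

lemma det2_eq_0D:
  assumes "det2 u v = 0" "u \<noteq> (0, 0)"
  obtains c where "v = scale2 c u"
proof (cases "fst u = 0")
  case True
  then have s: "snd u \<noteq> 0" using assms(2) by (cases u) auto
  then have "fst v = 0" using assms(1) True by (simp add: det2_def)
  then have "v = scale2 (snd v / snd u) u" using True s by (cases v) (simp add: scale2_def)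
  then show ?thesis by (rule that)
next
  case False
  then have "snd v = fst v / fst u * snd u" using assms(1) by (simp add: det2_def field_simps)
  then have "v = scale2 (fst v / fst u) u" using False by (cases v) (simp add: scale2_def)
  then show ?thesis by (rule that)
qed

definition comb2 :: "'f::{field,finite} \<times> 'f \<Rightarrow> 'f \<times> 'f \<Rightarrow> 'f \<times> 'f \<Rightarrow> 'f \<times> 'f" where
  "comb2 u v w = (fst w * fst u + snd w * fst v, fst w * snd u + snd w * snd v)"

lemma det2_comb2 [simp]: "det2 u (comb2 u v w) = snd w * det2 u v" "det2 (comb2 u v w) v = fst w * det2 u v"
  by (simp_all add: det2_def comb2_def algebra_simps)

lemma comb2_eq_scale2 [simp]: "comb2 u v (a, 0) = scale2 a u" "comb2 u v (0, b) = scale2 b v"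
  by (simp_all add: comb2_def scale2_def)

text \<open>By Cramer's rule the coordinates of a vector are quotients of determinants.\<close>
lemma bij_comb2:
  assumes "det2 u v \<noteq> 0"
  shows "bij (comb2 u v)"
proof -
  have "inj (comb2 u v)"
  proof (rule injI)
    fix w w' assume "comb2 u v w = comb2 u v w'"
    then have "snd w * det2 u v = snd w' * det2 u v" "fst w * det2 u v = fst w' * det2 u v"
      by (metis det2_comb2)+
    then show "w = w'" using assms by (simp add: prod_eq_iff)
  qed
  then show ?thesis by (simp add: bij_def finite_UNIV_inj_surj)
qed

lemma ex_det2_eq_1:
  assumes "u \<noteq> (0, 0)"
  obtains v where "det2 u v = 1"
proof (cases "fst u = 0")
  case True
  then have "det2 u (- 1 / snd u, 0) = 1" using assms by (cases u) (simp add: det2_def)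
  then show ?thesis by (rule that)
next
  case False
  then have "det2 u (0, 1 / fst u) = 1" by (simp add: det2_def)
  then show ?thesis by (rule that)
qed

lemma ex_independent_common:
  assumes "u \<noteq> (0, 0)" "v \<noteq> (0, 0)"
  obtains w where "w \<noteq> (0, 0)" "det2 u w \<noteq> 0" "det2 v w \<noteq> 0"
proof (cases "det2 u v = 0")
  case True
  then obtain c where c: "v = scale2 c u" using det2_eq_0D assms(1) by blast
  obtain w where w: "det2 u w = 1" using ex_det2_eq_1[OF assms(1)] by blast
  have "c \<noteq> 0" using c assms(2) by auto
  then have "det2 v w \<noteq> 0" using w c by simp
  moreover have "w \<noteq> (0, 0)" using w by auto
  ultimately show ?thesis using that w by simp
next
  case False
  have "det2 u (comb2 u v (1, 1)) \<noteq> 0" using False by simp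
  moreover have "det2 v (comb2 u v (1, 1)) \<noteq> 0"
    using False det2_swap[of v "comb2 u v (1, 1)"] by simp
  moreover from calculation have "comb2 u v (1, 1) \<noteq> (0, 0)" by auto
  ultimately show ?thesis using that by blast
qed

definition mat_vec2 :: "'f::{field,finite} mat \<Rightarrow> 'f \<times> 'f \<Rightarrow> 'f \<times> 'f" where
  "mat_vec2 A v = (A $$ (0, 0) * fst v + A $$ (0, 1) * snd v, A $$ (1, 0) * fst v + A $$ (1, 1) * snd v)"

definition mat_det2 :: "'f::{field,finite} mat \<Rightarrow> 'f" where
  "mat_det2 A = A $$ (0, 0) * A $$ (1, 1) - A $$ (0, 1) * A $$ (1, 0)"

lemma det2_mat_vec2: "det2 (mat_vec2 A u) (mat_vec2 A v) = mat_det2 A * det2 u v"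
  by (simp add: det2_def mat_vec2_def mat_det2_def algebra_simps)

lemma mat_vec2_scale2: "mat_vec2 A (scale2 c v) = scale2 c (mat_vec2 A v)"
  by (simp add: mat_vec2_def scale2_def algebra_simps)

lemma mat_vec2_smult:
  assumes "A \<in> carrier_mat 2 2"
  shows "mat_vec2 (c \<cdot>\<^sub>m A) v = scale2 c (mat_vec2 A v)"
  using assms by (simp add: mat_vec2_def scale2_def algebra_simps)

lemma mult_mat_2_entries:
  assumes "A \<in> carrier_mat 2 2" "B \<in> carrier_mat 2 2"
  shows "(A * B) $$ (0, 0) = A $$ (0, 0) * B $$ (0, 0) + A $$ (0, 1) * B $$ (1, 0)"
    "(A * B) $$ (0, 1) = A $$ (0, 0) * B $$ (0, 1) + A $$ (0, 1) * B $$ (1, 1)"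
    "(A * B) $$ (1, 0) = A $$ (1, 0) * B $$ (0, 0) + A $$ (1, 1) * B $$ (1, 0)"
    "(A * B) $$ (1, 1) = A $$ (1, 0) * B $$ (0, 1) + A $$ (1, 1) * B $$ (1, 1)"
  using assms by (simp_all add: scalar_prod_def numeral_2_eq_2)

lemma eq_mat_2I:
  assumes "A \<in> carrier_mat 2 2" "B \<in> carrier_mat 2 2"
    "A $$ (0, 0) = B $$ (0, 0)" "A $$ (0, 1) = B $$ (0, 1)"
    "A $$ (1, 0) = B $$ (1, 0)" "A $$ (1, 1) = B $$ (1, 1)"
  shows "A = B"
proof (rule eq_matI)
  fix i j assume "i < dim_row B" "j < dim_col B"
  then have "i \<in> {0, 1}" "j \<in> {0, 1}" using assms(2) by auto
  then show "A $$ (i, j) = B $$ (i, j)" using assms(3-) by auto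
qed (use assms(1,2) in auto)

lemma mat_det2_mult:
  assumes "A \<in> carrier_mat 2 2" "B \<in> carrier_mat 2 2"
  shows "mat_det2 (A * B) = mat_det2 A * mat_det2 B"
  unfolding mat_det2_def mult_mat_2_entries[OF assms] by (simp add: algebra_simps)

lemma mat_det2_one: "mat_det2 (1\<^sub>m 2) = 1"
  by (simp add: mat_det2_def)

lemma mat_det2_smult:
  assumes "A \<in> carrier_mat 2 2"
  shows "mat_det2 (c \<cdot>\<^sub>m A) = c * c * mat_det2 A"
  using assms by (simp add: mat_det2_def algebra_simps)

lemma mat_det2_map_mat:
  assumes "field_hom \<sigma>" "A \<in> carrier_mat 2 2"
  shows "mat_det2 (map_mat \<sigma> A) = \<sigma> (mat_det2 A)"
proof -
  interpret field_hom \<sigma> by fact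
  show ?thesis using assms(2) by (simp add: mat_det2_def hom_minus hom_mult)
qed

section \<open>Digraphs and their automorphism groups\<close>

lemma out_degree_pair:
  assumes "pair_wf_digraph G"
  shows "out_degree (with_proj G) \<alpha> = card {\<gamma> \<in> pverts G. (\<alpha>, \<gamma>) \<in> parcs G}"
proof -
  interpret pair_wf_digraph G by fact
  have "out_arcs (with_proj G) \<alpha> = Pair \<alpha> ` {\<gamma> \<in> pverts G. (\<alpha>, \<gamma>) \<in> parcs G}"
    using in_arcsD2 by (auto simp: out_arcs_def)
  then show ?thesis by (simp add: out_degree_def card_image inj_on_def)
qed

lemma in_degree_pair:
  assumes "pair_wf_digraph G"
  shows "in_degree (with_proj G) \<alpha> = card {\<gamma> \<in> pverts G. (\<gamma>, \<alpha>) \<in> parcs G}"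
proof -
  interpret pair_wf_digraph G by fact
  have "in_arcs (with_proj G) \<alpha> = (\<lambda>\<gamma>. (\<gamma>, \<alpha>)) ` {\<gamma> \<in> pverts G. (\<gamma>, \<alpha>) \<in> parcs G}"
    using in_arcsD1 by (auto simp: in_arcs_def)
  then show ?thesis by (simp add: in_degree_def card_image inj_on_def)
qed

lemma carrier_digraph_aut_group:
  "carrier (digraph_aut_group G) = {f \<in> extensional (pverts G). bij_betw f (pverts G) (pverts G) \<and>
     (\<forall>\<alpha>\<in>pverts G. \<forall>\<beta>\<in>pverts G. (f \<alpha>, f \<beta>) \<in> parcs G \<longleftrightarrow> (\<alpha>, \<beta>) \<in> parcs G)}"
  by (auto simp: digraph_aut_group_def Bij_def)

lemma mult_digraph_aut_group:
  assumes "f \<in> carrier (digraph_aut_group G)" "g \<in> carrier (digraph_aut_group G)"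
  shows "f \<otimes>\<^bsub>digraph_aut_group G\<^esub> g = compose (pverts G) f g"
  using assms by (simp add: digraph_aut_group_def BijGroup_def)

lemma digraph_iso_with_projE:
  assumes "digraph_iso (with_proj G) (with_proj H)"
  obtains \<phi> where "bij_betw \<phi> (pverts G) (pverts H)"
    "\<And>u v. u \<in> pverts G \<Longrightarrow> v \<in> pverts G \<Longrightarrow> (\<phi> u, \<phi> v) \<in> parcs H \<longleftrightarrow> (u, v) \<in> parcs G"
proof -
  obtain f where f: "pre_digraph.digraph_isomorphism (with_proj G) f" "with_proj H = app_iso f (with_proj G)"
    using assms by (auto simp: digraph_iso_def)
  let ?\<phi> = "iso_verts f"
  have wf: "wf_digraph (with_proj G)" and inj: "inj_on ?\<phi> (pverts G)"
    and ends: "\<And>a. a \<in> parcs G \<Longrightarrow> ?\<phi> (fst a) = iso_tail f (iso_arcs f a) \<and> ?\<phi> (snd a) = iso_head f (iso_arcs f a)"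
    using f(1) by (simp_all add: pre_digraph.digraph_isomorphism_def)
  interpret pair_wf_digraph G using wf by (simp add: wf_digraph_wp_iff)
  have V: "pverts H = ?\<phi> ` pverts G" and E: "parcs H = iso_arcs f ` parcs G"
    and t: "iso_tail f = fst" and h: "iso_head f = snd"
    using f(2) by (simp_all add: with_proj_def app_iso_def)
  have im: "iso_arcs f (u, v) = (?\<phi> u, ?\<phi> v)" if "(u, v) \<in> parcs G" for u v
    using ends[OF that] by (simp add: t h prod_eq_iff)
  show ?thesis
  proof (rule that[of ?\<phi>])
    show "bij_betw ?\<phi> (pverts G) (pverts H)" using inj V by (simp add: bij_betw_def)
    fix u v assume uv: "u \<in> pverts G" "v \<in> pverts G"
    show "(?\<phi> u, ?\<phi> v) \<in> parcs H \<longleftrightarrow> (u, v) \<in> parcs G"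
    proof
      assume "(?\<phi> u, ?\<phi> v) \<in> parcs H"
      then obtain u' v' where *: "(u', v') \<in> parcs G" "(?\<phi> u, ?\<phi> v) = iso_arcs f (u', v')"
        unfolding E by auto
      then have "?\<phi> u = ?\<phi> u'" "?\<phi> v = ?\<phi> v'" using im[OF *(1)] by simp_all
      then have "u = u'" "v = v'" using inj_onD[OF inj] uv in_arcsD1[OF *(1)] in_arcsD2[OF *(1)] by auto
      then show "(u, v) \<in> parcs G" using *(1) by simp
    next
      assume "(u, v) \<in> parcs G"
      then show "(?\<phi> u, ?\<phi> v) \<in> parcs H" unfolding E using im by (metis imageI)
    qed
  qed
qed

text \<open>This inverts an isomorphism that starts at a semidirect product, whose closure is at hand from the
  formula for its multiplication.\<close>
lemma iso_converse_of_closed: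
  assumes h: "h \<in> iso G H"
    and cl: "\<And>x y. x \<in> carrier G \<Longrightarrow> y \<in> carrier G \<Longrightarrow> x \<otimes>\<^bsub>G\<^esub> y \<in> carrier G"
  shows "H \<cong> G"
proof -
  let ?i = "inv_into (carrier G) h"
  have hom: "h \<in> hom G H" and bij: "bij_betw h (carrier G) (carrier H)" using h by (auto simp: iso_def)
  have ibij: "bij_betw ?i (carrier H) (carrier G)" using bij by (rule bij_betw_inv_into)
  have "?i \<in> hom H G"
  proof (rule homI)
    fix x y assume xy: "x \<in> carrier H" "y \<in> carrier H"
    have i: "?i x \<in> carrier G" "?i y \<in> carrier G" using xy bij_betwE[OF ibij] by auto
    have "h (?i x \<otimes>\<^bsub>G\<^esub> ?i y) = h (?i x) \<otimes>\<^bsub>H\<^esub> h (?i y)" by (rule hom_mult[OF hom i])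
    also have "\<dots> = x \<otimes>\<^bsub>H\<^esub> y" using xy bij by (simp add: bij_betw_inv_into_right)
    finally show "?i (x \<otimes>\<^bsub>H\<^esub> y) = ?i x \<otimes>\<^bsub>G\<^esub> ?i y"
      using bij_betw_inv_into_left[OF bij cl[OF i]] by simp
  qed (use bij_betwE[OF ibij] in auto)
  then have "?i \<in> iso H G" using ibij by (simp add: iso_def)
  then show ?thesis by (rule is_isoI)
qed

section \<open>The digraphs of the construction\<close>

context mathon_field
begin

text \<open>The vertices are the classes modulo \<open>K\<close> of nonzero vectors; an arbitrary injection turns
  these classes into natural numbers.\<close>
definition class_number :: "('f \<times> 'f) set \<Rightarrow> nat" where
  "class_number = (SOME f. inj f)"

definition vclass :: "'f \<times> 'f \<Rightarrow> nat" where
  "vclass u = class_number {scale2 k u | k. k ^ e = 1}"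

definition vertices :: "nat set" where
  "vertices = vclass ` (- {(0, 0)})"

text \<open>The first alternative gives Mathon's antipodal cover of the complete graph on the \<open>q + 1\<close> lines, the
  second one a tournament on each fibre.\<close>
definition adjacent :: "'f set \<Rightarrow> 'f \<times> 'f \<Rightarrow> 'f \<times> 'f \<Rightarrow> bool" where
  "adjacent S u v \<longleftrightarrow> det2 u v ^ e = 1 \<or> (\<exists>s. s ^ e \<in> S \<and> v = scale2 s u)"

definition mathon_digraph :: "'f set \<Rightarrow> nat pair_pre_digraph" where
  "mathon_digraph S = \<lparr>pverts = vertices,
     parcs = {(vclass u, vclass v) | u v. u \<noteq> (0, 0) \<and> v \<noteq> (0, 0) \<and> adjacent S u v}\<rparr>"

lemma inj_class_number: "inj class_number"
proof -
  have "\<exists>f :: ('f \<times> 'f) set \<Rightarrow> nat. inj f"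
    using finite_imp_inj_to_nat_seg[of "UNIV :: ('f \<times> 'f) set set"] by auto
  then show ?thesis unfolding class_number_def by (rule someI_ex)
qed

lemma power_e_eq_1_neq_0: "k ^ e = 1 \<Longrightarrow> k \<noteq> 0" for k :: 'f
  using e_ge_1 by (auto simp: power_0_left)

lemma vclass_eq_iff: "vclass u = vclass v \<longleftrightarrow> (\<exists>k. k ^ e = 1 \<and> v = scale2 k u)"
proof -
  let ?C = "\<lambda>u :: 'f \<times> 'f. {scale2 k u | k. k ^ e = 1}"
  have "vclass u = vclass v \<longleftrightarrow> ?C u = ?C v"
    unfolding vclass_def using inj_class_number by (rule inj_eq)
  also have "\<dots> \<longleftrightarrow> (\<exists>k. k ^ e = 1 \<and> v = scale2 k u)"
  proof
    assume "?C u = ?C v"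
    moreover have "v \<in> ?C v" by (rule CollectI, rule exI[of _ 1]) simp
    ultimately show "\<exists>k. k ^ e = 1 \<and> v = scale2 k u" by blast
  next
    assume "\<exists>k. k ^ e = 1 \<and> v = scale2 k u"
    then obtain k where k: "k ^ e = 1" "v = scale2 k u" by blast
    have k0: "k \<noteq> 0" by (rule power_e_eq_1_neq_0[OF k(1)])
    show "?C u = ?C v"
    proof (intro equalityI subsetI)
      fix w assume "w \<in> ?C u"
      then obtain l where l: "l ^ e = 1" "w = scale2 l u" by blast
      then have "w = scale2 (l / k) v" "(l / k) ^ e = 1" using k k0 by (simp_all add: power_divide)
      then show "w \<in> ?C v" by blast
    next
      fix w assume "w \<in> ?C v"
      then obtain l where l: "l ^ e = 1" "w = scale2 l v" by blast
      then have "w = scale2 (l * k) u" "(l * k) ^ e = 1" using k by (simp_all add: power_mult_distrib)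
      then show "w \<in> ?C u" by blast
    qed
  qed
  finally show ?thesis .
qed

lemma vclass_scale2: "k ^ e = 1 \<Longrightarrow> vclass (scale2 k u) = vclass u"
  using vclass_eq_iff[of u "scale2 k u"] by auto

lemma vclass_scale2_eq_iff:
  assumes "u \<noteq> (0, 0)" "a \<noteq> 0"
  shows "vclass (scale2 a u) = vclass (scale2 b u) \<longleftrightarrow> a ^ e = b ^ e"
proof
  assume "vclass (scale2 a u) = vclass (scale2 b u)"
  then obtain k where "k ^ e = 1" "scale2 b u = scale2 (k * a) u"
    unfolding vclass_eq_iff by auto
  then show "a ^ e = b ^ e" using scale2_eq_iff[OF assms(1)] by (simp add: power_mult_distrib)
next
  assume *: "a ^ e = b ^ e"
  have "(b / a) ^ e = b ^ e / a ^ e" by (rule power_divide)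
  also have "\<dots> = 1" unfolding *[symmetric] using assms(2) by simp
  finally have "(b / a) ^ e = 1" .
  then have "vclass (scale2 (b / a) (scale2 a u)) = vclass (scale2 a u)" by (rule vclass_scale2)
  then show "vclass (scale2 a u) = vclass (scale2 b u)" using assms(2) by simp
qed

lemma card_vclass:
  assumes "u \<noteq> (0, 0)"
  shows "card {w. w \<noteq> (0, 0) \<and> vclass w = vclass u} = e"
proof -
  have "{w. w \<noteq> (0, 0) \<and> vclass w = vclass u} = (\<lambda>k. scale2 k u) ` {k. k ^ e = 1}"
  proof (rule Set.set_eqI)
    fix w
    have "w \<noteq> (0, 0)" if "w = scale2 k u" "k ^ e = 1" for k
      using that assms power_e_eq_1_neq_0 by simp
    moreover have "vclass w = vclass u \<longleftrightarrow> (\<exists>k. k ^ e = 1 \<and> w = scale2 k u)"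
      unfolding eq_commute[of "vclass w" "vclass u"] by (rule vclass_eq_iff)
    ultimately show "w \<in> {w. w \<noteq> (0, 0) \<and> vclass w = vclass u} \<longleftrightarrow> w \<in> (\<lambda>k. scale2 k u) ` {k. k ^ e = 1}"
      by blast
  qed
  moreover have "inj_on (\<lambda>k. scale2 k u) {k. k ^ e = 1}"
    using scale2_eq_iff[OF assms] by (auto simp: inj_on_def)
  ultimately show ?thesis using card_fibre_and_mu(2)[OF mu_1] by (simp add: card_image)
qed

lemma finite_vertices: "finite vertices"
  by (simp add: vertices_def)

lemma vertexE:
  assumes "\<alpha> \<in> vertices"
  obtains u where "u \<noteq> (0, 0)" "\<alpha> = vclass u"
  using assms by (auto simp: vertices_def)

lemma vertexI [intro]: "u \<noteq> (0, 0) \<Longrightarrow> vclass u \<in> vertices"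
  by (auto simp: vertices_def)

lemma card_vertex_set:
  assumes "A \<subseteq> vertices"
  shows "e * card A = card {w. w \<noteq> (0, 0) \<and> vclass w \<in> A}"
proof -
  have fin: "finite A" using assms finite_vertices by (rule finite_subset)
  have "{w. w \<noteq> (0, 0) \<and> vclass w \<in> A} = (\<Union>\<alpha>\<in>A. {w. w \<noteq> (0, 0) \<and> vclass w = \<alpha>})" by blast
  also have "card \<dots> = (\<Sum>\<alpha>\<in>A. card {w. w \<noteq> (0, 0) \<and> vclass w = \<alpha>})"
    using fin by (intro card_UN_disjoint) auto
  also have "\<dots> = (\<Sum>\<alpha>\<in>A. e)"
  proof (rule sum.cong[OF refl])
    fix \<alpha> assume "\<alpha> \<in> A"
    then have "\<alpha> \<in> vertices" using assms by blast
    then obtain u where "u \<noteq> (0, 0)" "\<alpha> = vclass u" by (rule vertexE)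
    then show "card {w. w \<noteq> (0, 0) \<and> vclass w = \<alpha>} = e" using card_vclass by simp
  qed
  finally show ?thesis by simp
qed

lemma card_vertex_Collect:
  assumes "\<And>w. w \<noteq> (0, 0) \<Longrightarrow> Q (vclass w) \<longleftrightarrow> P w" and "\<not> P (0, 0)"
  shows "e * card {\<gamma> \<in> vertices. Q \<gamma>} = card {w. P w}"
proof -
  have "e * card {\<gamma> \<in> vertices. Q \<gamma>} = card {w. w \<noteq> (0, 0) \<and> vclass w \<in> {\<gamma> \<in> vertices. Q \<gamma>}}"
    by (rule card_vertex_set) simp
  also have "{w. w \<noteq> (0, 0) \<and> vclass w \<in> {\<gamma> \<in> vertices. Q \<gamma>}} = {w. P w}"
  proof (rule Collect_cong)
    fix w
    show "w \<noteq> (0, 0) \<and> vclass w \<in> {\<gamma> \<in> vertices. Q \<gamma>} \<longleftrightarrow> P w"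
      using assms(1)[of w] assms(2) vertexI[of w] by (cases "w = (0, 0)") simp_all
  qed
  finally show ?thesis .
qed

lemma card_vertices: "card vertices = (CARD('f) + 1) * p"
proof -
  have "e * card {\<gamma> \<in> vertices. True} = card {w::'f \<times> 'f. w \<noteq> (0, 0)}"
    by (rule card_vertex_Collect) simp_all
  also have "{w::'f \<times> 'f. w \<noteq> (0, 0)} = UNIV - {(0, 0)}" by blast
  also have "card \<dots> = CARD('f) * CARD('f) - 1" by (simp add: card_Diff_singleton)
  also have "\<dots> = e * ((CARD('f) + 1) * p)" by (simp add: q algebra_simps)
  finally show ?thesis using e_ge_1 by simp
qed

lemma adjacent_scale2:
  assumes k: "k ^ e = 1" and l: "l ^ e = 1"
  shows "adjacent S (scale2 k u) (scale2 l v) \<longleftrightarrow> adjacent S u v"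
proof -
  have k0: "k \<noteq> 0" and l0: "l \<noteq> 0" using k l power_e_eq_1_neq_0 by auto
  have "det2 (scale2 k u) (scale2 l v) ^ e = det2 u v ^ e" using k l by (simp add: power_mult_distrib)
  moreover have "(\<exists>s. s ^ e \<in> S \<and> scale2 l v = scale2 s (scale2 k u)) \<longleftrightarrow> (\<exists>s. s ^ e \<in> S \<and> v = scale2 s u)"
  proof
    assume "\<exists>s. s ^ e \<in> S \<and> scale2 l v = scale2 s (scale2 k u)"
    then obtain s where s: "s ^ e \<in> S" "scale2 l v = scale2 (s * k) u" by auto
    have "v = scale2 (inverse l) (scale2 l v)" using l0 by simp
    also have "\<dots> = scale2 (inverse l * (s * k)) u" using s(2) by simp
    finally have "v = scale2 (inverse l * (s * k)) u" .
    moreover have "(inverse l * (s * k)) ^ e = s ^ e"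
      using k l by (simp add: power_mult_distrib power_inverse)
    ultimately show "\<exists>s. s ^ e \<in> S \<and> v = scale2 s u" using s(1) by metis
  next
    assume "\<exists>s. s ^ e \<in> S \<and> v = scale2 s u"
    then obtain s where s: "s ^ e \<in> S" "v = scale2 s u" by auto
    have "scale2 l v = scale2 (l * s * inverse k) (scale2 k u)" using s(2) k0 by (simp add: mult.assoc)
    moreover have "(l * s * inverse k) ^ e = s ^ e"
      using k l by (simp add: power_mult_distrib power_inverse)
    ultimately show "\<exists>s. s ^ e \<in> S \<and> scale2 l v = scale2 s (scale2 k u)" using s(1) by metis
  qed
  ultimately show ?thesis unfolding adjacent_def by argo
qed

lemma mathon_arc_iff:
  assumes "u \<noteq> (0, 0)" "v \<noteq> (0, 0)"
  shows "(vclass u, vclass v) \<in> parcs (mathon_digraph S) \<longleftrightarrow> adjacent S u v"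
proof
  assume "(vclass u, vclass v) \<in> parcs (mathon_digraph S)"
  then obtain u' v' where *: "vclass u = vclass u'" "vclass v = vclass v'" "adjacent S u' v'"
    by (auto simp: mathon_digraph_def)
  then obtain k l where "k ^ e = 1" "u' = scale2 k u" "l ^ e = 1" "v' = scale2 l v"
    unfolding vclass_eq_iff by auto
  then show "adjacent S u v" using adjacent_scale2 *(3) by blast
next
  assume "adjacent S u v"
  then show "(vclass u, vclass v) \<in> parcs (mathon_digraph S)"
    unfolding mathon_digraph_def pair_pre_digraph.simps using assms by blast
qed

lemma pverts_mathon [simp]: "pverts (mathon_digraph S) = vertices"
  by (simp add: mathon_digraph_def)

lemma mathon_arcE:
  assumes "a \<in> parcs (mathon_digraph S)"
  obtains u v where "a = (vclass u, vclass v)" "u \<noteq> (0, 0)" "v \<noteq> (0, 0)" "adjacent S u v"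
  using assms by (auto simp: mathon_digraph_def)

end

section \<open>Counting paths\<close>

lemma card_Collect_bij:
  assumes "bij f"
  shows "card {w. P w} = card {x. P (f x)}"
proof -
  have "{w. P w} = f ` {x. P (f x)}"
  proof (intro equalityI subsetI)
    fix w assume w: "w \<in> {w. P w}"
    obtain x where "w = f x" using surjD[OF bij_is_surj[OF assms], of w] by blast
    then show "w \<in> f ` {x. P (f x)}" using w by simp
  qed auto
  then show ?thesis using card_image[OF inj_on_subset[OF bij_is_inj[OF assms] subset_UNIV]] by metis
qed

context mathon_field
begin

lemma card_power_e_mem:
  assumes "T \<subseteq> mu"
  shows "card {x. x ^ e \<in> T} = e * card T"
proof -
  have "{x. x ^ e \<in> T} = (\<Union>z\<in>T. {x. x ^ e = z})" by auto
  also have "card \<dots> = (\<Sum>z\<in>T. card {x. x ^ e = z})" by (rule card_UN_disjoint) auto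
  also have "\<dots> = (\<Sum>z\<in>T. e)" using assms card_fibre_and_mu(2) by (intro sum.cong) auto
  finally show ?thesis by simp
qed

lemma card_det2_power_e:
  fixes u :: "'f \<times> 'f"
  assumes "u \<noteq> (0, 0)"
  shows "card {w. det2 u w ^ e = 1} = e * CARD('f)"
proof -
  obtain v where v: "det2 u v = 1" using ex_det2_eq_1[OF assms] by blast
  have bij: "bij (comb2 u v)" using v by (intro bij_comb2) simp
  have "card {w. det2 u w ^ e = 1} = card {x. det2 u (comb2 u v x) ^ e = 1}"
    by (rule card_Collect_bij[OF bij])
  also have "{x. det2 u (comb2 u v x) ^ e = 1} = (UNIV::'f set) \<times> {k. k ^ e = 1}" using v by auto
  also have "card \<dots> = CARD('f) * e" using card_fibre_and_mu(2)[OF mu_1] by (simp add: card_cartesian_product)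
  finally show ?thesis by simp
qed

lemma paley_set_mu: "paley_set S \<Longrightarrow> z \<in> S \<Longrightarrow> z \<in> mu"
  by (auto simp: paley_set_def)

lemma adjacent_power_neq_0:
  "paley_set S \<Longrightarrow> s ^ e \<in> S \<Longrightarrow> s \<noteq> 0"
  using paley_set_mu[of S "s ^ e"] mu_neq_0[of "s ^ e"] by (cases "s = 0") auto

lemma not_adjacent_self:
  assumes "paley_set S" "u \<noteq> (0, 0)"
  shows "\<not> adjacent S u u"
proof
  assume "adjacent S u u"
  then consider "(0::'f) ^ e = 1" | s where "s ^ e \<in> S" "u = scale2 s u"
    by (auto simp: adjacent_def)
  then show False
  proof cases
    case 1
    then show False using e_ge_1 by (simp add: power_0_left)
  next
    case 2
    then have "s = 1" using scale2_eq_iff[OF assms(2), of 1 s] by simp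
    then show False using 2 assms(1) by (simp add: paley_set_def)
  qed
qed

lemma card_out_vectors:
  assumes S: "paley_set S" and u: "u \<noteq> (0, 0)"
  shows "card {w. adjacent S u w} = e * (CARD('f) + (2 * e + 1))"
proof -
  let ?A = "{w. det2 u w ^ e = 1}" and ?B = "(\<lambda>s. scale2 s u) ` {s. s ^ e \<in> S}"
  have "{w. adjacent S u w} = ?A \<union> ?B" by (auto simp: adjacent_def)
  moreover have "?A \<inter> ?B = {}" using e_ge_1 by (auto simp: power_0_left)
  moreover have "card ?B = card {s. s ^ e \<in> S}"
    by (rule card_image) (use scale2_eq_iff[OF u] in \<open>auto simp: inj_on_def\<close>)
  moreover have "card {s. s ^ e \<in> S} = e * card S"
    using S by (intro card_power_e_mem) (simp add: paley_set_def)
  ultimately show ?thesis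
    using card_det2_power_e[OF u] card_paley_set[OF S] by (simp add: card_Un_disjoint algebra_simps)
qed

text \<open>This reduces indegrees to outdegrees.\<close>
lemma adjacent_swap:
  assumes "paley_set S"
  shows "adjacent S u v \<longleftrightarrow> adjacent (inverse ` S) v u"
proof -
  have 1: "\<exists>s. s ^ e \<in> inverse ` S \<and> u = scale2 s v" if "s ^ e \<in> S" "v = scale2 s u" "s \<noteq> 0"
    for s :: 'f and S u v
    by (rule exI[of _ "inverse s"]) (use that in \<open>auto simp: power_inverse\<close>)
  have "inverse ` inverse ` S = S" by (auto simp: image_iff)
  then have "(\<exists>s. s ^ e \<in> S \<and> v = scale2 s u) \<longleftrightarrow> (\<exists>s. s ^ e \<in> inverse ` S \<and> u = scale2 s v)"
    using 1[of _ S v u] 1[of _ "inverse ` S" u v] adjacent_power_neq_0[OF assms]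
      adjacent_power_neq_0[OF paley_set_inverse[OF assms]] by metis
  moreover have "det2 v u ^ e = det2 u v ^ e" by (subst det2_swap) (rule minus_power_e)
  ultimately show ?thesis by (simp add: adjacent_def)
qed

text \<open>In the coordinates \<open>w = a u + b v\<close>, the middle vertex is outside both fibres (\<open>a\<close>, \<open>b\<close> both nonzero),
  in the fibre of \<open>u\<close> (\<open>b = 0\<close>) or in the fibre of \<open>v\<close> (\<open>a = 0\<close>). The first case has \<open>e * e\<close> vectors;
  with \<open>D = det2 u v\<close>, the other two are possible if the inverse of \<open>D ^ e\<close> and if \<open>D ^ e\<close>,
  respectively, lies in \<open>S\<close>, that is, exactly one of them unless \<open>D ^ e = 1\<close>.\<close>
lemma card_path_vectors_independent:
  assumes S: "paley_set S" and D: "det2 u v \<noteq> 0"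
  shows "card {w. adjacent S u w \<and> adjacent S w v} = (if det2 u v ^ e = 1 then e * e else e * (e + 1))"
proof -
  define D where "D = det2 u v"
  have D0: "D \<noteq> 0" using D D_def by simp
  have Dmu: "D ^ e \<in> mu" using D0 by (rule power_e_in_mu)
  have bij: "bij (comb2 u v)" using D by (rule bij_comb2)
  let ?K = "{x. (x * D) ^ e = 1}"
  let ?P1 = "{a. a ^ e \<in> S \<and> (a * D) ^ e = 1}" and ?P2 = "{b. inverse b ^ e \<in> S \<and> (b * D) ^ e = 1}"
  have S0: "0 \<notin> S" using paley_set_mu[OF S, of 0] mu_neq_0 by auto
  have adj1: "adjacent S u (comb2 u v (a, b)) \<longleftrightarrow> (b * D) ^ e = 1 \<or> (b = 0 \<and> a ^ e \<in> S)" for a b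
  proof -
    have "comb2 u v (a, b) = scale2 s u \<longleftrightarrow> (a, b) = (s, 0)" for s
      using bij_is_inj[OF bij] by (metis comb2_eq_scale2(1) injD)
    then show ?thesis by (auto simp: adjacent_def D_def)
  qed
  have adj2: "adjacent S (comb2 u v (a, b)) v \<longleftrightarrow> (a * D) ^ e = 1 \<or> (a = 0 \<and> inverse b ^ e \<in> S)" for a b
  proof -
    have "v = scale2 s (comb2 u v (a, b)) \<longleftrightarrow> (0, 1) = (s * a, s * b)" for s
    proof -
      have "v = comb2 u v (0, 1)" by simp
      moreover have "scale2 s (comb2 u v (a, b)) = comb2 u v (s * a, s * b)"
        by (simp add: comb2_def scale2_def algebra_simps)
      ultimately show ?thesis using bij_is_inj[OF bij] by (metis injD)
    qed
    moreover have "(\<exists>s. s ^ e \<in> S \<and> (0, 1) = (s * a, s * b)) \<longleftrightarrow> a = 0 \<and> inverse b ^ e \<in> S"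
    proof
      assume "\<exists>s. s ^ e \<in> S \<and> (0, 1) = (s * a, s * b)"
      then obtain s where s: "s ^ e \<in> S" "s * a = 0" "s * b = 1" by auto
      then have "s \<noteq> 0" by auto
      moreover have "s = inverse b" using s(3) by (metis inverse_unique mult.commute)
      ultimately show "a = 0 \<and> inverse b ^ e \<in> S" using s by simp
    next
      assume *: "a = 0 \<and> inverse b ^ e \<in> S"
      then have "b \<noteq> 0" using S0 by auto
      then show "\<exists>s. s ^ e \<in> S \<and> (0, 1) = (s * a, s * b)" using * by (intro exI[of _ "inverse b"]) simp
    qed
    ultimately show ?thesis by (simp add: adjacent_def D_def)
  qed
  have eqD: "(x * D) ^ e = 1 \<longleftrightarrow> x ^ e = inverse (D ^ e)" for x
    using D0 by (auto simp: power_mult_distrib field_simps)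
  have K0: "0 \<notin> ?K" by simp
  let ?X = "{w. adjacent S u (comb2 u v w) \<and> adjacent S (comb2 u v w) v}"
  have "card {w. adjacent S u w \<and> adjacent S w v} = card ?X"
    by (rule card_Collect_bij[OF bij])
  also have "?X = ?K \<times> ?K \<union> (?P1 \<times> {0} \<union> {0} \<times> ?P2)"
  proof (intro Set.set_eqI)
    fix w :: "'f \<times> 'f"
    obtain a b where w: "w = (a, b)" by (cases w)
    show "w \<in> ?X \<longleftrightarrow> w \<in> ?K \<times> ?K \<union> (?P1 \<times> {0} \<union> {0} \<times> ?P2)"
      unfolding w using adj1[of a b] adj2[of a b] S0 by auto
  qed
  also have "card \<dots> = card ?K * card ?K + (card ?P1 + card ?P2)"
  proof -
    have "0 \<notin> ?P1" "0 \<notin> ?P2" by auto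
    then have d: "?K \<times> ?K \<inter> (?P1 \<times> {0} \<union> {0} \<times> ?P2) = {}" "?P1 \<times> {0} \<inter> {0} \<times> ?P2 = {}"
      using K0 by blast+
    show ?thesis
      using card_Un_disjoint[OF finite finite d(1)] card_Un_disjoint[OF finite finite d(2)]
      by (simp add: card_cartesian_product)
  qed
  also have "card ?K = e"
  proof -
    have "?K = {x. x ^ e = inverse (D ^ e)}" by (simp add: eqD)
    then show ?thesis using card_fibre_and_mu(2)[OF mu_inverse[OF Dmu]] by simp
  qed
  also have "card ?P1 = (if inverse (D ^ e) \<in> S then e else 0)"
  proof -
    have "?P1 = (if inverse (D ^ e) \<in> S then {x. x ^ e = inverse (D ^ e)} else {})"
      by (auto simp: eqD)
    then show ?thesis using card_fibre_and_mu(2)[OF mu_inverse[OF Dmu]] by simp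
  qed
  also have "card ?P2 = (if D ^ e \<in> S then e else 0)"
  proof -
    have "inverse b ^ e \<in> S \<and> (b * D) ^ e = 1 \<longleftrightarrow> D ^ e \<in> S \<and> b ^ e = inverse (D ^ e)" for b
      by (auto simp: eqD power_inverse)
    then have "?P2 = (if D ^ e \<in> S then {x. x ^ e = inverse (D ^ e)} else {})" by auto
    then show ?thesis using card_fibre_and_mu(2)[OF mu_inverse[OF Dmu]] by simp
  qed
  finally have *: "card {w. adjacent S u w \<and> adjacent S w v} =
      e * e + ((if inverse (D ^ e) \<in> S then e else 0) + (if D ^ e \<in> S then e else 0))" .
  show ?thesis
  proof (cases "D ^ e = 1")
    case True
    then show ?thesis using * S by (simp add: D_def paley_set_def)
  next
    case False
    then have "inverse (D ^ e) \<in> S \<longleftrightarrow> D ^ e \<notin> S" using S Dmu by (simp add: paley_set_def)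
    then show ?thesis using * False by (auto simp: D_def)
  qed
qed

text \<open>A path between vertices of one fibre stays in the fibre, where it is counted by the Paley property,
  or leaves it; in the latter case both steps belong to the same matching between two fibres and the path is
  closed.\<close>
lemma card_path_vectors_dependent:
  assumes S: "paley_set S" and u: "u \<noteq> (0, 0)" and c: "c \<noteq> 0"
  shows "card {w. adjacent S u w \<and> adjacent S w (scale2 c u)} =
    (if c ^ e = 1 then e * CARD('f) else if c ^ e \<in> S then e * e else e * (e + 1))"
proof -
  have cmu: "c ^ e \<in> mu" using c by (rule power_e_in_mu)
  let ?A = "{w. det2 u w ^ e = 1 \<and> c ^ e = 1}"
  let ?T = "{z \<in> S. c ^ e / z \<in> S}"
  let ?B = "(\<lambda>s. scale2 s u) ` {s. s ^ e \<in> ?T}"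
  have "{w. adjacent S u w \<and> adjacent S w (scale2 c u)} = ?A \<union> ?B"
  proof (intro Set.set_eqI)
    fix w
    show "w \<in> {w. adjacent S u w \<and> adjacent S w (scale2 c u)} \<longleftrightarrow> w \<in> ?A \<union> ?B"
    proof (cases "det2 u w = 0")
      case True
      then obtain s where s: "w = scale2 s u" using det2_eq_0D u by blast
      have "adjacent S u w \<longleftrightarrow> s ^ e \<in> S"
        using True scale2_eq_iff[OF u] by (auto simp: adjacent_def s)
      moreover have "adjacent S w (scale2 c u) \<longleftrightarrow> (c / s) ^ e \<in> S" if "s ^ e \<in> S"
      proof -
        have s0: "s \<noteq> 0" using adjacent_power_neq_0[OF S that] .
        have "scale2 c u = scale2 t w \<longleftrightarrow> t = c / s" for t
          using s0 scale2_eq_iff[OF u] by (auto simp: s field_simps)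
        then show ?thesis by (auto simp: adjacent_def s)
      qed
      moreover have "w \<in> ?B \<longleftrightarrow> s ^ e \<in> ?T" using scale2_eq_iff[OF u] by (auto simp: s)
      moreover have "w \<notin> ?A" using True by simp
      ultimately show ?thesis by (auto simp: power_divide)
    next
      case False
      have nB: "w \<notin> ?B" using False by auto
      have "adjacent S u w \<longleftrightarrow> det2 u w ^ e = 1" using False by (auto simp: adjacent_def)
      moreover have "adjacent S w (scale2 c u) \<longleftrightarrow> c ^ e * det2 u w ^ e = 1"
      proof -
        have "scale2 c u \<noteq> scale2 s w" for s
        proof
          assume "scale2 c u = scale2 s w"
          then have "det2 (scale2 c u) w = det2 (scale2 s w) w" by simp
          then show False using False c by simp
        qed
        moreover have "det2 w (scale2 c u) = - (c * det2 u w)" by (simp add: det2_swap[of w u])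
        ultimately show ?thesis by (auto simp: adjacent_def minus_power_e power_mult_distrib)
      qed
      ultimately show ?thesis using nB by auto
    qed
  qed
  moreover have "?A \<inter> ?B = {}" by auto
  moreover have "card ?B = card {s. s ^ e \<in> ?T}"
    by (rule card_image) (use scale2_eq_iff[OF u] in \<open>auto simp: inj_on_def\<close>)
  moreover have "card {s. s ^ e \<in> ?T} = e * card ?T"
    using paley_set_mu[OF S] by (intro card_power_e_mem) auto
  ultimately have *: "card {w. adjacent S u w \<and> adjacent S w (scale2 c u)} = card ?A + e * card ?T"
    by (simp add: card_Un_disjoint)
  show ?thesis
  proof (cases "c ^ e = 1")
    case True
    have "?T = {}" using S True unfolding paley_set_def by (auto simp: inverse_eq_divide)
    then show ?thesis using * True card_det2_power_e[OF u] by simp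
  next
    case False
    then have "card ?T = (if c ^ e \<in> S then e else e + 1)" using S cmu by (simp add: paley_set_def)
    then show ?thesis using * False by simp
  qed
qed

theorem mathon_digraph_dsrg:
  assumes S: "paley_set S"
  shows "directed_strongly_regular_graph (mathon_digraph S)
    ((CARD('f) + 1) * p) (CARD('f) + (p - 1) div 2) (CARD('f)) e (e + 1)"
proof -
  let ?G = "mathon_digraph S"
  have h: "(p - 1) div 2 = 2 * e + 1" by (simp add: pe)
  have not_adj_0: "\<not> adjacent T w (0, 0)" if T: "paley_set T" and w: "w \<noteq> (0, 0)" for w T
  proof
    assume "adjacent T w (0, 0)"
    then obtain s where "s ^ e \<in> T" "(0, 0) = scale2 s w" by (auto simp: adjacent_def)
    then show False using adjacent_power_neq_0[OF T, of s] w scale2_eq_0_iff[of s w] by simp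
  qed
  have paths: "e * card {\<gamma> \<in> vertices. (vclass u, \<gamma>) \<in> parcs ?G \<and> (\<gamma>, vclass v) \<in> parcs ?G}
      = card {w. adjacent S u w \<and> adjacent S w v}" if "u \<noteq> (0, 0)" "v \<noteq> (0, 0)" for u v
    using mathon_arc_iff that not_adj_0[OF S that(1)] by (intro card_vertex_Collect) blast+
  have outdeg: "card {\<gamma> \<in> vertices. (vclass u, \<gamma>) \<in> parcs (mathon_digraph T)} = CARD('f) + (2 * e + 1)"
    if T: "paley_set T" and u: "u \<noteq> (0, 0)" for u T
  proof -
    have "e * card {\<gamma> \<in> vertices. (vclass u, \<gamma>) \<in> parcs (mathon_digraph T)} = card {w. adjacent T u w}"
      using mathon_arc_iff[OF u] not_adj_0[OF T u] by (intro card_vertex_Collect) blast+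
    then show ?thesis using e_ge_1 unfolding card_out_vectors[OF T u] mult_cancel1 by auto
  qed
  have wf: "pair_digraph ?G"
  proof
    fix a assume "a \<in> parcs ?G"
    then obtain u v where a: "a = (vclass u, vclass v)" "u \<noteq> (0, 0)" "v \<noteq> (0, 0)" "adjacent S u v"
      by (rule mathon_arcE)
    then show "fst a \<in> pverts ?G" "snd a \<in> pverts ?G" by auto
    show "fst a \<noteq> snd a"
    proof
      assume "fst a = snd a"
      then have "(vclass u, vclass u) \<in> parcs ?G" using \<open>a \<in> parcs ?G\<close> a(1) by simp
      then show False using mathon_arc_iff a(2) not_adjacent_self[OF S a(2)] by blast
    qed
  next
    show "finite (pverts ?G)" using finite_vertices by simp
    moreover have "parcs ?G \<subseteq> pverts ?G \<times> pverts ?G" by (auto elim!: mathon_arcE)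
    ultimately show "finite (parcs ?G)" using finite_subset finite_cartesian_product by blast
  qed
  interpret pair_digraph ?G by (rule wf)
  have wf': "pair_wf_digraph ?G" by unfold_locales
  show ?thesis
  proof
    show "card (pverts ?G) = (CARD('f) + 1) * p" by (simp add: card_vertices)
  next
    fix \<alpha> assume "\<alpha> \<in> pverts ?G"
    then have "\<alpha> \<in> vertices" by simp
    then obtain u where u: "u \<noteq> (0, 0)" "\<alpha> = vclass u" by (rule vertexE)
    show "out_degree (with_proj ?G) \<alpha> = CARD('f) + (p - 1) div 2"
      using outdeg[OF S u(1)] u(2) h by (simp add: out_degree_pair[OF wf'])
    have "{\<gamma> \<in> vertices. (\<gamma>, \<alpha>) \<in> parcs ?G} = {\<gamma> \<in> vertices. (\<alpha>, \<gamma>) \<in> parcs (mathon_digraph (inverse ` S))}"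
    proof -
      have "(\<gamma>, \<alpha>) \<in> parcs ?G \<longleftrightarrow> (\<alpha>, \<gamma>) \<in> parcs (mathon_digraph (inverse ` S))"
        if vert: "\<gamma> \<in> vertices" for \<gamma>
      proof -
        obtain w where w: "w \<noteq> (0, 0)" "\<gamma> = vclass w" using vert by (rule vertexE)
        show ?thesis unfolding u(2) w(2) mathon_arc_iff[OF u(1) w(1)] mathon_arc_iff[OF w(1) u(1)]
          by (rule adjacent_swap[OF S])
      qed
      then show ?thesis by blast
    qed
    then show "in_degree (with_proj ?G) \<alpha> = CARD('f) + (p - 1) div 2"
      using outdeg[OF paley_set_inverse[OF S] u(1)] u(2) h by (simp add: in_degree_pair[OF wf'])
    show "card {\<gamma> \<in> pverts ?G. (\<alpha>, \<gamma>) \<in> parcs ?G \<and> (\<gamma>, \<alpha>) \<in> parcs ?G} = CARD('f)"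
      using paths[OF u(1) u(1)] card_path_vectors_dependent[OF S u(1), of 1] e_ge_1 u(2) by simp
  next
    fix \<alpha> \<beta> assume ab: "\<alpha> \<in> pverts ?G" "\<beta> \<in> pverts ?G"
    then have "\<alpha> \<in> vertices" "\<beta> \<in> vertices" by simp_all
    then obtain u v where u: "u \<noteq> (0, 0)" "\<alpha> = vclass u" and v: "v \<noteq> (0, 0)" "\<beta> = vclass v"
      by (metis vertexE)
    let ?N = "card {\<gamma> \<in> pverts ?G. (\<alpha>, \<gamma>) \<in> parcs ?G \<and> (\<gamma>, \<beta>) \<in> parcs ?G}"
    have "e * ?N = e * (if adjacent S u v then e else e + 1)" if "\<alpha> \<noteq> \<beta>"
    proof (cases "det2 u v = 0")
      case False
      then have "adjacent S u v \<longleftrightarrow> det2 u v ^ e = 1" by (auto simp: adjacent_def)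
      then show ?thesis using paths[OF u(1) v(1)] card_path_vectors_independent[OF S False] u(2) v(2) by simp
    next
      case True
      then obtain c where c: "v = scale2 c u" using det2_eq_0D u(1) by blast
      then have c0: "c \<noteq> 0" using v(1) by auto
      have "c ^ e \<noteq> 1" using that u v vclass_scale2 c by metis
      moreover have "adjacent S u v \<longleftrightarrow> c ^ e \<in> S"
        using True e_ge_1 scale2_eq_iff[OF u(1)] by (auto simp: adjacent_def power_0_left c)
      ultimately show ?thesis
        using paths[OF u(1) v(1)] card_path_vectors_dependent[OF S u(1) c0] u(2) v(2) c by simp
    qed
    then have N: "?N = (if adjacent S u v then e else e + 1)" if "\<alpha> \<noteq> \<beta>"
      using that e_ge_1 unfolding mult_cancel1 by auto
    show "?N = e" if "(\<alpha>, \<beta>) \<in> parcs ?G"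
    proof -
      have "adjacent S u v" using that u v mathon_arc_iff by blast
      moreover have "\<alpha> \<noteq> \<beta>" using pair_no_loops[OF that] by simp
      ultimately show ?thesis using N by simp
    qed
    show "?N = e + 1" if "\<alpha> \<noteq> \<beta>" "(\<alpha>, \<beta>) \<notin> parcs ?G"
      using N that u v mathon_arc_iff by simp
  qed
qed

end

section \<open>The action of semilinear maps\<close>

context mathon_field
begin

text \<open>The power of the determinant makes scalar matrices act trivially on the classes: the scalar
  \<open>c\<close> acts as \<open>c ^ (2 * ((p - 1) div 2)) * c = c ^ p\<close>, a \<open>p\<close>-th power.\<close>
definition semilinear :: "'f mat \<Rightarrow> ('f \<Rightarrow> 'f) \<Rightarrow> 'f \<times> 'f \<Rightarrow> 'f \<times> 'f" where
  "semilinear A \<sigma> v = scale2 (mat_det2 A ^ ((p - 1) div 2)) (mat_vec2 A (map_prod \<sigma> \<sigma> v))"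

lemma det2_semilinear:
  assumes "field_hom \<sigma>"
  shows "det2 (semilinear A \<sigma> u) (semilinear A \<sigma> v) = mat_det2 A ^ p * \<sigma> (det2 u v)"
proof -
  interpret field_hom \<sigma> by fact
  have h: "p = (p - 1) div 2 + (p - 1) div 2 + 1" by (simp add: pe)
  have "det2 (map_prod \<sigma> \<sigma> u) (map_prod \<sigma> \<sigma> v) = \<sigma> (det2 u v)"
    by (simp add: det2_def hom_minus hom_mult)
  then have "det2 (semilinear A \<sigma> u) (semilinear A \<sigma> v)
      = mat_det2 A ^ ((p - 1) div 2 + (p - 1) div 2 + 1) * \<sigma> (det2 u v)"
    by (simp add: semilinear_def det2_mat_vec2 power_add mult_ac)
  then show ?thesis by (simp only: h[symmetric])
qed

lemma semilinear_scale2: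
  assumes "field_hom \<sigma>"
  shows "semilinear A \<sigma> (scale2 c v) = scale2 (\<sigma> c) (semilinear A \<sigma> v)"
proof -
  interpret field_hom \<sigma> by fact
  have "map_prod \<sigma> \<sigma> (scale2 c v) = scale2 (\<sigma> c) (map_prod \<sigma> \<sigma> v)"
    by (simp add: scale2_def hom_mult map_prod_def split_beta)
  then show ?thesis by (simp add: semilinear_def mat_vec2_scale2 mult_ac)
qed

lemma semilinear_neq_0:
  assumes \<sigma>: "field_hom \<sigma>" and A: "mat_det2 A \<noteq> 0" and u: "u \<noteq> (0, 0)"
  shows "semilinear A \<sigma> u \<noteq> (0, 0)"
proof
  interpret field_hom \<sigma> by (rule \<sigma>)
  assume *: "semilinear A \<sigma> u = (0, 0)"
  obtain v where "det2 u v = 1" using ex_det2_eq_1[OF u] by blast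
  then have "det2 (semilinear A \<sigma> u) (semilinear A \<sigma> v) = mat_det2 A ^ p" using det2_semilinear[OF \<sigma>] by simp
  then show False using * A by simp
qed

lemma det2_semilinear_power_e:
  assumes \<sigma>: "field_hom \<sigma>" and A: "mat_det2 A \<noteq> 0"
  shows "det2 (semilinear A \<sigma> u) (semilinear A \<sigma> v) ^ e = \<sigma> (det2 u v ^ e)"
proof -
  interpret field_hom \<sigma> by (rule \<sigma>)
  show ?thesis unfolding det2_semilinear[OF \<sigma>] power_mult_distrib power_p_power_e[OF A] by (simp add: hom_power)
qed

lemma adjacent_semilinear:
  assumes S: "paley_set S" and \<sigma>: "field_hom \<sigma>" and A: "mat_det2 A \<noteq> 0" and u: "u \<noteq> (0, 0)"
  shows "adjacent S (semilinear A \<sigma> u) (semilinear A \<sigma> v) \<longleftrightarrow> adjacent S u v"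
proof -
  interpret field_hom \<sigma> by (rule \<sigma>)
  have inv: "\<sigma> z \<in> S \<longleftrightarrow> z \<in> S" if "z \<in> mu" for z using S \<sigma> that by (simp add: paley_set_def)
  have "det2 (semilinear A \<sigma> u) (semilinear A \<sigma> v) ^ e = 1 \<longleftrightarrow> det2 u v ^ e = 1"
    unfolding det2_semilinear_power_e[OF \<sigma> A] by (metis eq_iff hom_one)
  moreover have "(\<exists>s. s ^ e \<in> S \<and> semilinear A \<sigma> v = scale2 s (semilinear A \<sigma> u)) \<longleftrightarrow>
    (\<exists>s. s ^ e \<in> S \<and> v = scale2 s u)"
  proof
    assume "\<exists>s. s ^ e \<in> S \<and> v = scale2 s u"
    then obtain s where s: "s ^ e \<in> S" "v = scale2 s u" by blast
    have "\<sigma> s ^ e \<in> S" using inv[OF paley_set_mu[OF S s(1)]] s(1) by (simp add: hom_power)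
    then show "\<exists>s. s ^ e \<in> S \<and> semilinear A \<sigma> v = scale2 s (semilinear A \<sigma> u)"
      using semilinear_scale2[OF \<sigma>] s(2) by blast
  next
    assume "\<exists>s. s ^ e \<in> S \<and> semilinear A \<sigma> v = scale2 s (semilinear A \<sigma> u)"
    then obtain s where s: "s ^ e \<in> S" "semilinear A \<sigma> v = scale2 s (semilinear A \<sigma> u)" by blast
    have "det2 (semilinear A \<sigma> u) (semilinear A \<sigma> v) = 0" using s(2) by simp
    then have "\<sigma> (det2 u v) = 0" using det2_semilinear[OF \<sigma>, of A u v] A by simp
    then have "det2 u v = 0" by simp
    then obtain t where t: "v = scale2 t u" using det2_eq_0D u by blast
    have "s = \<sigma> t" using s(2) scale2_eq_iff[OF semilinear_neq_0[OF \<sigma> A u]]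
      unfolding t semilinear_scale2[OF \<sigma>] by metis
    then have "\<sigma> (t ^ e) \<in> S" using s(1) by (simp add: hom_power)
    moreover have "t \<noteq> 0" using adjacent_power_neq_0[OF S s(1)] \<open>s = \<sigma> t\<close> by auto
    ultimately have "t ^ e \<in> S" using inv[OF power_e_in_mu] by blast
    then show "\<exists>s. s ^ e \<in> S \<and> v = scale2 s u" using t by blast
  qed
  ultimately show ?thesis unfolding adjacent_def by argo
qed

lemma semilinear_vclass_cong:
  assumes \<sigma>: "field_hom \<sigma>" and "vclass u = vclass v"
  shows "vclass (semilinear A \<sigma> u) = vclass (semilinear A \<sigma> v)"
proof -
  interpret field_hom \<sigma> by (rule \<sigma>)
  obtain k where k: "k ^ e = 1" "v = scale2 k u" using assms(2) unfolding vclass_eq_iff by auto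
  have "\<sigma> k ^ e = 1" using k(1) by (metis hom_one hom_power)
  then show ?thesis unfolding k(2) semilinear_scale2[OF \<sigma>] using vclass_scale2 by simp
qed

lemma semilinear_smult:
  assumes "A \<in> carrier_mat 2 2"
  shows "semilinear (c \<cdot>\<^sub>m A) \<sigma> v = scale2 (c ^ p) (semilinear A \<sigma> v)"
proof -
  have h: "p = (p - 1) div 2 + (p - 1) div 2 + 1" by (simp add: pe)
  have "semilinear (c \<cdot>\<^sub>m A) \<sigma> v = scale2 (c ^ ((p - 1) div 2 + (p - 1) div 2 + 1)) (semilinear A \<sigma> v)"
    by (simp add: semilinear_def mat_vec2_smult[OF assms] mat_det2_smult[OF assms]
        power_mult_distrib power_add mult_ac)
  then show ?thesis by (simp only: h[symmetric])
qed

lemma semilinear_comp: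
  assumes A: "A \<in> carrier_mat 2 2" and B: "B \<in> carrier_mat 2 2" and \<sigma>: "field_hom \<sigma>"
  shows "semilinear A \<sigma> (semilinear B \<tau> v) = semilinear (A * map_mat \<sigma> B) (\<sigma> \<circ> \<tau>) v"
proof -
  interpret field_hom \<sigma> by (rule \<sigma>)
  have mB: "map_mat \<sigma> B \<in> carrier_mat 2 2" using B by simp
  have "mat_vec2 (A * map_mat \<sigma> B) (map_prod (\<sigma> \<circ> \<tau>) (\<sigma> \<circ> \<tau>) v)
      = mat_vec2 A (map_prod \<sigma> \<sigma> (mat_vec2 B (map_prod \<tau> \<tau> v)))"
    unfolding mat_vec2_def mult_mat_2_entries[OF A mB] using B
    by (simp add: hom_add hom_mult algebra_simps)
  moreover have "map_prod \<sigma> \<sigma> (scale2 c w) = scale2 (\<sigma> c) (map_prod \<sigma> \<sigma> w)" for c w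
    by (cases w) (simp add: scale2_def hom_mult)
  ultimately show ?thesis
    by (simp add: semilinear_def mat_vec2_scale2 mat_det2_mult[OF A mB] mat_det2_map_mat[OF \<sigma> B]
        power_mult_distrib hom_power)
qed

end

section \<open>Rigidity\<close>

context mathon_field
begin

lemma mutually_adjacent_iff:
  assumes S: "paley_set S" and u: "u \<noteq> (0, 0)"
  shows "adjacent S u v \<and> adjacent S v u \<longleftrightarrow> det2 u v ^ e = 1"
proof
  assume "det2 u v ^ e = 1"
  moreover have "det2 v u ^ e = det2 u v ^ e" by (subst det2_swap) (rule minus_power_e)
  ultimately show "adjacent S u v \<and> adjacent S v u" by (simp add: adjacent_def)
next
  assume *: "adjacent S u v \<and> adjacent S v u"
  show "det2 u v ^ e = 1"
  proof (rule ccontr)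
    assume n: "det2 u v ^ e \<noteq> 1"
    moreover have "det2 v u ^ e = det2 u v ^ e" by (subst det2_swap) (rule minus_power_e)
    ultimately obtain s t where s: "s ^ e \<in> S" "v = scale2 s u" and t: "t ^ e \<in> S" "u = scale2 t v"
      using * unfolding adjacent_def by metis
    have "scale2 1 u = scale2 (t * s) u" by (simp only: scale2_1 scale2_scale2[symmetric] s(2)[symmetric] t(2)[symmetric])
    then have "t * s = 1" using scale2_eq_iff[OF u] by metis
    then have "t = inverse s" by (metis inverse_unique mult.commute)
    then have "inverse (s ^ e) \<in> S" using t(1) by (simp add: power_inverse)
    moreover have "s ^ e \<noteq> 1" using s(1) S by (auto simp: paley_set_def)
    ultimately show False using s(1) S paley_set_mu[OF S s(1)] by (auto simp: paley_set_def)
  qed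
qed

lemma dependent_iff:
  assumes S: "paley_set S" and u: "u \<noteq> (0, 0)" and v: "v \<noteq> (0, 0)"
  shows "det2 u v = 0 \<longleftrightarrow> vclass u = vclass v \<or> (adjacent S u v \<longleftrightarrow> \<not> adjacent S v u)"
proof
  assume z: "det2 u v = 0"
  then obtain s where s: "v = scale2 s u" using det2_eq_0D u by blast
  have s0: "s \<noteq> 0" using s v by auto
  have us: "u = scale2 (inverse s) v" using s s0 by simp
  have 1: "adjacent S u v \<longleftrightarrow> s ^ e \<in> S"
    using z scale2_eq_iff[OF u] by (auto simp: adjacent_def s)
  have 2: "adjacent S v u \<longleftrightarrow> inverse (s ^ e) \<in> S"
  proof -
    have "det2 v u = 0" using z det2_swap[of v u] by simp
    then have "adjacent S v u \<longleftrightarrow> (\<exists>t. t ^ e \<in> S \<and> scale2 (inverse s) v = scale2 t v)"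
      unfolding adjacent_def us[symmetric] by simp
    then show ?thesis using scale2_eq_iff[OF v] by (auto simp: power_inverse)
  qed
  show "vclass u = vclass v \<or> (adjacent S u v \<longleftrightarrow> \<not> adjacent S v u)"
  proof (cases "s ^ e = 1")
    case True
    then show ?thesis using vclass_scale2 s by simp
  next
    case False
    then show ?thesis using 1 2 S power_e_in_mu[OF s0] by (simp add: paley_set_def)
  qed
next
  assume *: "vclass u = vclass v \<or> (adjacent S u v \<longleftrightarrow> \<not> adjacent S v u)"
  show "det2 u v = 0"
  proof (rule ccontr)
    assume n: "det2 u v \<noteq> 0"
    then have "det2 v u \<noteq> 0" using det2_swap[of v u] by simp
    then have "adjacent S u v \<longleftrightarrow> det2 u v ^ e = 1" "adjacent S v u \<longleftrightarrow> det2 v u ^ e = 1"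
      using n by (auto simp: adjacent_def)
    moreover have "det2 v u ^ e = det2 u v ^ e" by (subst det2_swap) (rule minus_power_e)
    ultimately have "vclass u = vclass v" using * by simp
    then show False using n unfolding vclass_eq_iff by auto
  qed
qed

text \<open>An isomorphism, described on representatives. The determinant condition with value \<open>1\<close> is the
  undirected part of the digraph; the fibres (dependent vectors) are recognized by the property that
  distinct vertices of a fibre are joined by exactly one arc, other vertices by none or two.\<close>
definition cover_map :: "('f \<times> 'f \<Rightarrow> 'f \<times> 'f) \<Rightarrow> bool" where
  "cover_map g \<longleftrightarrow> (\<forall>u. u \<noteq> (0, 0) \<longrightarrow> g u \<noteq> (0, 0)) \<and>
     (\<forall>u v. u \<noteq> (0, 0) \<longrightarrow> v \<noteq> (0, 0) \<longrightarrow>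
        (det2 (g u) (g v) ^ e = 1 \<longleftrightarrow> det2 u v ^ e = 1) \<and>
        (det2 (g u) (g v) = 0 \<longleftrightarrow> det2 u v = 0) \<and>
        (vclass u = vclass v \<longrightarrow> vclass (g u) = vclass (g v)))"

lemma digraph_map_imp_cover_map:
  assumes S: "paley_set S" and S': "paley_set S'"
    and bij: "bij_betw \<phi> vertices vertices"
    and arcs: "\<And>\<alpha> \<beta>. \<alpha> \<in> vertices \<Longrightarrow> \<beta> \<in> vertices \<Longrightarrow>
      (\<phi> \<alpha>, \<phi> \<beta>) \<in> parcs (mathon_digraph S') \<longleftrightarrow> (\<alpha>, \<beta>) \<in> parcs (mathon_digraph S)"
  obtains g where "cover_map g" "\<And>u. u \<noteq> (0, 0) \<Longrightarrow> \<phi> (vclass u) = vclass (g u)"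
proof -
  have "\<exists>w. w \<noteq> (0, 0) \<and> \<phi> (vclass u) = vclass w" if "u \<noteq> (0, 0)" for u
  proof -
    have "\<phi> (vclass u) \<in> vertices" using bij_betwE[OF bij] vertexI[OF that] by blast
    then show ?thesis by (metis vertexE)
  qed
  then obtain g where g: "\<And>u. u \<noteq> (0, 0) \<Longrightarrow> g u \<noteq> (0, 0)"
      "\<And>u. u \<noteq> (0, 0) \<Longrightarrow> \<phi> (vclass u) = vclass (g u)"
    by metis
  have adj: "adjacent S' (g u) (g v) \<longleftrightarrow> adjacent S u v" if "u \<noteq> (0, 0)" "v \<noteq> (0, 0)" for u v
    using arcs[OF vertexI[OF that(1)] vertexI[OF that(2)]] mathon_arc_iff[OF that]
      mathon_arc_iff[OF g(1)[OF that(1)] g(1)[OF that(2)]] g(2)[OF that(1)] g(2)[OF that(2)] by simp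
  have cl: "vclass (g u) = vclass (g v) \<longleftrightarrow> vclass u = vclass v" if "u \<noteq> (0, 0)" "v \<noteq> (0, 0)" for u v
    using bij_betw_imp_inj_on[OF bij] vertexI[OF that(1)] vertexI[OF that(2)] g(2)[OF that(1)] g(2)[OF that(2)]
    by (metis inj_on_eq_iff)
  have "cover_map g" unfolding cover_map_def
  proof (intro conjI allI impI)
    fix u v :: "'f \<times> 'f" assume u: "u \<noteq> (0, 0)" and v: "v \<noteq> (0, 0)"
    show "det2 (g u) (g v) ^ e = 1 \<longleftrightarrow> det2 u v ^ e = 1"
      unfolding mutually_adjacent_iff[OF S u, symmetric] mutually_adjacent_iff[OF S' g(1)[OF u], symmetric]
        adj[OF u v] adj[OF v u] ..
    show "det2 (g u) (g v) = 0 \<longleftrightarrow> det2 u v = 0"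
      unfolding dependent_iff[OF S u v] dependent_iff[OF S' g(1)[OF u] g(1)[OF v]]
        adj[OF u v] adj[OF v u] cl[OF u v] ..
    show "vclass (g u) = vclass (g v)" if "vclass u = vclass v" using cl[OF u v] that by simp
  qed (rule g(1))
  then show ?thesis using that g(2) by blast
qed

lemma det2_power_e_cong:
  assumes "vclass u = vclass u'" "vclass v = vclass v'"
  shows "det2 u v ^ e = det2 u' v' ^ e"
proof -
  obtain k l where "k ^ e = 1" "u' = scale2 k u" "l ^ e = 1" "v' = scale2 l v"
    using assms unfolding vclass_eq_iff by auto
  then show ?thesis by (simp add: power_mult_distrib)
qed

lemma vclass_scale2_cong:
  assumes "vclass u = vclass v" "s ^ e = t ^ e" "u \<noteq> (0, 0)" "s \<noteq> 0"
  shows "vclass (scale2 s u) = vclass (scale2 t v)"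
proof -
  obtain k where k: "k ^ e = 1" "v = scale2 k u" using assms(1) unfolding vclass_eq_iff by auto
  have "s ^ e = (t * k) ^ e" using k(1) assms(2) by (simp add: power_mult_distrib)
  then have "vclass (scale2 s u) = vclass (scale2 (t * k) u)"
    using vclass_scale2_eq_iff[OF assms(3,4)] by simp
  then show ?thesis by (simp add: k(2))
qed

text \<open>Moving a vertex along its fibre by \<open>s\<close> moves its image by some \<open>t\<close>, and a priori \<open>t ^ e\<close>
  depends on the vertex. If \<open>u\<close> and \<open>w\<close> are matched, so are \<open>s u\<close> and \<open>s\<inverse> w\<close>; hence two
  vertices with a common neighbour \<open>w\<close> have the same \<open>t ^ e\<close>, and any two vertices are joined
  through common neighbours.\<close>
lemma cover_map_determinant_power:
  assumes g: "cover_map g"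
  obtains a where "a \<ge> 1"
    "\<And>u v. u \<noteq> (0, 0) \<Longrightarrow> v \<noteq> (0, 0) \<Longrightarrow> det2 (g u) (g v) ^ e = det2 u v ^ (e * a)"
    "\<And>u s. u \<noteq> (0, 0) \<Longrightarrow> s \<noteq> 0 \<Longrightarrow> \<exists>t. g (scale2 s u) = scale2 t (g u) \<and> t ^ e = s ^ (e * a)"
proof -
  have g0: "g u \<noteq> (0, 0)" if "u \<noteq> (0, 0)" for u
    using g that unfolding cover_map_def by blast
  have M: "det2 (g u) (g v) ^ e = 1 \<longleftrightarrow> det2 u v ^ e = 1" if "u \<noteq> (0, 0)" "v \<noteq> (0, 0)" for u v
    using g that unfolding cover_map_def by blast
  have Z: "det2 (g u) (g v) = 0 \<longleftrightarrow> det2 u v = 0" if "u \<noteq> (0, 0)" "v \<noteq> (0, 0)" for u v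
    using g that unfolding cover_map_def by blast
  have cl: "vclass (g u) = vclass (g v)" if "u \<noteq> (0, 0)" "v \<noteq> (0, 0)" "vclass u = vclass v" for u v
    using g that unfolding cover_map_def by blast
  have "\<exists>t. t \<noteq> 0 \<and> g (scale2 s u) = scale2 t (g u)" if us: "u \<noteq> (0, 0)" "s \<noteq> 0" for u s
  proof -
    have su: "scale2 s u \<noteq> (0, 0)" using us by simp
    have "det2 (g u) (g (scale2 s u)) = 0" using Z[OF us(1) su] by simp
    then obtain t where "g (scale2 s u) = scale2 t (g u)" using det2_eq_0D g0[OF us(1)] by blast
    moreover from this have "t \<noteq> 0" using g0[OF su] by auto
    ultimately show ?thesis by blast
  qed
  then obtain \<tau> where \<tau>: "\<And>u s. u \<noteq> (0, 0) \<Longrightarrow> s \<noteq> 0 \<Longrightarrow> \<tau> u s \<noteq> 0"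
      "\<And>u s. u \<noteq> (0, 0) \<Longrightarrow> s \<noteq> 0 \<Longrightarrow> g (scale2 s u) = scale2 (\<tau> u s) (g u)"
    by metis
  have edge: "(\<tau> u s) ^ e * (\<tau> w (inverse s)) ^ e = 1"
    if "u \<noteq> (0, 0)" "w \<noteq> (0, 0)" "s \<noteq> 0" "det2 u w ^ e = 1" for u w s
  proof -
    have inv: "inverse s \<noteq> 0" using that by simp
    have nz: "scale2 s u \<noteq> (0, 0)" "scale2 (inverse s) w \<noteq> (0, 0)" using that by simp_all
    have d: "det2 (scale2 s u) (scale2 (inverse s) w) = det2 u w" using that(3) by simp
    have "det2 (scale2 s u) (scale2 (inverse s) w) ^ e = 1" unfolding d by (rule that(4))
    then have "det2 (g (scale2 s u)) (g (scale2 (inverse s) w)) ^ e = 1" unfolding M[OF nz] .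
    then have "(\<tau> u s) ^ e * (\<tau> w (inverse s)) ^ e * det2 (g u) (g w) ^ e = 1"
      unfolding \<tau>(2)[OF that(1,3)] \<tau>(2)[OF that(2) inv] by (simp add: power_mult_distrib mult_ac)
    moreover have "det2 (g u) (g w) ^ e = 1" using M[OF that(1,2)] that(4) by simp
    ultimately show ?thesis by simp
  qed
  have indep: "(\<tau> u s) ^ e = (\<tau> v s) ^ e"
    if "u \<noteq> (0, 0)" "v \<noteq> (0, 0)" "s \<noteq> 0" "det2 u v \<noteq> 0" for u v s
  proof -
    define w where "w = comb2 u v (inverse (det2 u v), inverse (det2 u v))"
    have 1: "det2 u w = 1" unfolding w_def using that(4) by simp
    have "det2 w v = 1" unfolding w_def using that(4) by simp
    then have "det2 v w = - 1" using det2_swap[of v w] by simp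
    then have 2: "det2 v w ^ e = 1" by (simp add: minus_1_power_e)
    have w0: "w \<noteq> (0, 0)" using 1 by auto
    have "(\<tau> u s) ^ e * (\<tau> w (inverse s)) ^ e = (\<tau> v s) ^ e * (\<tau> w (inverse s)) ^ e"
      using edge[OF that(1) w0 that(3)] edge[OF that(2) w0 that(3) 2] 1 by simp
    moreover have "\<tau> w (inverse s) \<noteq> 0" using \<tau>(1)[OF w0] that(3) by simp
    ultimately show ?thesis by simp
  qed
  have E1: "(1, 0) \<noteq> (0::'f, 0::'f)" and E2: "(0, 1) \<noteq> (0::'f, 0::'f)" by simp_all
  define \<Theta> where "\<Theta> s = (\<tau> (1, 0) s) ^ e" for s
  have \<Theta>: "(\<tau> u s) ^ e = \<Theta> s" if us: "u \<noteq> (0, 0)" "s \<noteq> 0" for u s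
  proof -
    obtain w where w: "w \<noteq> (0, 0)" "det2 u w \<noteq> 0" "det2 (1, 0) w \<noteq> 0"
      using ex_independent_common[OF us(1) E1] by blast
    show ?thesis unfolding \<Theta>_def
      using indep[OF us(1) w(1) us(2) w(2)] indep[OF E1 w(1) us(2) w(3)] by simp
  qed
  have \<Theta>_inverse: "\<Theta> (inverse s) = inverse (\<Theta> s)" if "s \<noteq> 0" for s
  proof -
    have "det2 (1, 0) (0, 1) ^ e = (1::'f)" by (simp add: det2_def)
    then have "\<Theta> s * \<Theta> (inverse s) = 1" using edge[OF E1 E2 that] \<Theta>[OF E1 that] \<Theta>[OF E2, of "inverse s"] that by simp
    then show ?thesis by (metis inverse_unique)
  qed
  have \<Theta>_mult: "\<Theta> (s * t) = \<Theta> s * \<Theta> t" if "s \<noteq> 0" "t \<noteq> 0" for s t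
  proof -
    have tu: "scale2 t (1, 0) \<noteq> (0, 0)" using that by simp
    have "scale2 (\<tau> (1, 0) (s * t)) (g (1, 0)) = g (scale2 (s * t) (1, 0))"
      using \<tau>(2)[OF E1, of "s * t"] that by simp
    also have "\<dots> = g (scale2 s (scale2 t (1, 0)))" by simp
    also have "\<dots> = scale2 (\<tau> (scale2 t (1, 0)) s * \<tau> (1, 0) t) (g (1, 0))"
      unfolding \<tau>(2)[OF tu that(1)] \<tau>(2)[OF E1 that(2)] by simp
    finally have "\<tau> (1, 0) (s * t) = \<tau> (scale2 t (1, 0)) s * \<tau> (1, 0) t"
      using scale2_eq_iff[OF g0[OF E1]] by blast
    then have "\<Theta> (s * t) = \<tau> (scale2 t (1, 0)) s ^ e * \<Theta> t" by (simp add: \<Theta>_def power_mult_distrib)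
    then show ?thesis using \<Theta>[OF tu that(1)] by simp
  qed
  have \<Theta>_cong: "\<Theta> s = \<Theta> t" if "s \<noteq> 0" "t \<noteq> 0" "s ^ e = t ^ e" for s t
  proof -
    have nz: "scale2 s (1, 0) \<noteq> (0, 0)" "scale2 t (1, 0) \<noteq> (0, 0)" using that by simp_all
    have "vclass (scale2 s (1, 0)) = vclass (scale2 t (1, 0))"
      using vclass_scale2_eq_iff[OF E1 that(1)] that(3) by simp
    then have "vclass (g (scale2 s (1, 0))) = vclass (g (scale2 t (1, 0)))" by (rule cl[OF nz])
    then have "vclass (scale2 (\<tau> (1, 0) s) (g (1, 0))) = vclass (scale2 (\<tau> (1, 0) t) (g (1, 0)))"
      unfolding \<tau>(2)[OF E1 that(1)] \<tau>(2)[OF E1 that(2)] .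
    then show ?thesis unfolding \<Theta>_def vclass_scale2_eq_iff[OF g0[OF E1] \<tau>(1)[OF E1 that(1)]] .
  qed
  obtain z where z: "z \<in> mu" "z \<noteq> 1" using ex_mu_neq_1 by blast
  obtain x where x: "x \<noteq> 0" "x ^ e = z" using ex_power_e[OF z(1)] by blast
  have "\<Theta> x \<in> mu" unfolding \<Theta>_def using \<tau>(1)[OF E1 x(1)] by (rule power_e_in_mu)
  then obtain a0 where a0: "\<Theta> x = z ^ a0"
    using bij_betw_imp_surj_on[OF mu_eq_powers[OF z]] by (metis imageE)
  \<comment> \<open>adding \<open>p\<close> changes nothing in \<open>mu\<close> and makes the exponent positive, as dependent vectors require\<close>
  define a where "a = a0 + p"
  have a: "\<Theta> x = z ^ a" using a0 z(1) by (simp add: a_def power_add mu_def)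
  have \<Theta>_pow: "\<Theta> (x ^ n) = \<Theta> x ^ n" for n
  proof (induction n)
    case 0
    have "\<Theta> 1 * \<Theta> 1 = \<Theta> 1" using \<Theta>_mult[of 1 1] by simp
    moreover have "\<Theta> 1 \<noteq> 0" unfolding \<Theta>_def using \<tau>(1)[OF E1, of 1] by simp
    ultimately show ?case by simp
  next
    case (Suc n)
    then show ?case using \<Theta>_mult[of x "x ^ n"] x(1) by simp
  qed
  have \<Theta>_a: "\<Theta> s = s ^ (e * a)" if "s \<noteq> 0" for s
  proof -
    have "s ^ e \<in> mu" using that by (rule power_e_in_mu)
    then obtain n where n: "s ^ e = z ^ n"
      using bij_betw_imp_surj_on[OF mu_eq_powers[OF z]] by (metis imageE)
    have "s ^ e = (x ^ n) ^ e" unfolding n x(2)[symmetric] by (simp flip: power_mult add: mult.commute)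
    then have "\<Theta> s = \<Theta> (x ^ n)" using that x(1) by (intro \<Theta>_cong) auto
    also have "\<dots> = (z ^ n) ^ a" unfolding \<Theta>_pow a by (simp flip: power_mult add: mult.commute)
    finally show ?thesis by (simp add: power_mult n)
  qed
  show ?thesis
  proof (rule that[of a])
    show "1 \<le> a" using p_gt_2 by (simp add: a_def)
    show "\<exists>t. g (scale2 s u) = scale2 t (g u) \<and> t ^ e = s ^ (e * a)"
      if us: "u \<noteq> (0, 0)" "s \<noteq> 0" for u s
      using \<tau>(2)[OF us] \<Theta>[OF us] \<Theta>_a[OF us(2)] by metis
    fix u v :: "'f \<times> 'f" assume u: "u \<noteq> (0, 0)" and v: "v \<noteq> (0, 0)"
    show "det2 (g u) (g v) ^ e = det2 u v ^ (e * a)"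
    proof (cases "det2 u v = 0")
      case True
      then show ?thesis using Z[OF u v] p_gt_2 by (auto simp: power_mult a_def power_0_left)
    next
      case False
      define D where "D = det2 u v"
      have D0: "D \<noteq> 0" "inverse D \<noteq> 0" using False by (simp_all add: D_def)
      have nz: "scale2 (inverse D) u \<noteq> (0, 0)" using D0 u by simp
      have "det2 (scale2 (inverse D) u) v ^ e = 1" using D0 by (simp add: D_def)
      then have "det2 (g (scale2 (inverse D) u)) (g v) ^ e = 1" unfolding M[OF nz v] .
      then have "\<Theta> (inverse D) * det2 (g u) (g v) ^ e = 1"
        unfolding \<tau>(2)[OF u D0(2)] using \<Theta>[OF u D0(2)] by (simp add: power_mult_distrib)
      then have "inverse (\<Theta> D) * det2 (g u) (g v) ^ e = 1" unfolding \<Theta>_inverse[OF D0(1)] .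
      moreover have "\<Theta> D \<noteq> 0" using \<Theta>_a D0(1) by simp
      ultimately have "det2 (g u) (g v) ^ e = \<Theta> D" by (simp add: field_simps)
      then show ?thesis using \<Theta>_a D0(1) by (simp add: D_def)
    qed
  qed
qed

text \<open>In coordinates with respect to the images \<open>b1\<close>, \<open>b2\<close> of \<open>(1, 0)\<close> and \<open>(0, 1)\<close>, the class of \<open>(y, 1)\<close>
  is mapped to a class \<open>(f y, 1)\<close>, and \<open>(f x - f y) ^ e = (x - y) ^ (e * a)\<close>. After division by \<open>f 1\<close>
  this makes \<open>f\<close> a field automorphism. Every vector is a multiple of \<open>(1, 0)\<close> or of some \<open>(y, 1)\<close>.\<close>
theorem cover_map_semilinear:
  assumes g: "cover_map g"
  obtains A \<sigma> where "A \<in> carrier_mat 2 2" "mat_det2 A \<noteq> 0" "field_hom \<sigma>"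
    "\<And>u. u \<noteq> (0, 0) \<Longrightarrow> vclass (g u) = vclass (semilinear A \<sigma> u)"
proof -
  obtain a where a: "a \<ge> 1"
    and ga: "\<And>u v. u \<noteq> (0, 0) \<Longrightarrow> v \<noteq> (0, 0) \<Longrightarrow> det2 (g u) (g v) ^ e = det2 u v ^ (e * a)"
    and gs: "\<And>u s. u \<noteq> (0, 0) \<Longrightarrow> s \<noteq> 0 \<Longrightarrow> \<exists>t. g (scale2 s u) = scale2 t (g u) \<and> t ^ e = s ^ (e * a)"
    using cover_map_determinant_power[OF g] by metis
  have g0: "g u \<noteq> (0, 0)" if "u \<noteq> (0, 0)" for u
    using g that unfolding cover_map_def by blast
  define b1 b2 where "b1 = g (1, 0)" and "b2 = g (0, 1)"
  define b where "b = det2 b1 b2"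
  have b: "b ^ e = 1" using ga[of "(1, 0)" "(0, 1)"] by (simp add: b_def b1_def b2_def det2_def)
  have b0: "b \<noteq> 0" by (rule power_e_eq_1_neq_0[OF b])
  have bij: "bij (comb2 b1 b2)" using b0 unfolding b_def by (rule bij_comb2)
  have "\<exists>c. vclass (g (y, 1)) = vclass (comb2 b1 b2 (c, 1)) \<and> (y = 0 \<longrightarrow> c = 0)" for y
  proof -
    obtain \<alpha> \<beta> where \<alpha>: "g (y, 1) = comb2 b1 b2 (\<alpha>, \<beta>)"
      using surjD[OF bij_is_surj[OF bij], of "g (y, 1)"] by (metis surj_pair)
    have "det2 b1 (g (y, 1)) ^ e = 1" unfolding b1_def using ga[of "(1, 0)" "(y, 1)"] by (simp add: det2_def)
    then have "(\<beta> * b) ^ e = 1" unfolding \<alpha> by (simp add: b_def)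
    then have \<beta>: "\<beta> ^ e = 1" using b by (simp add: power_mult_distrib)
    have "comb2 b1 b2 (\<alpha>, \<beta>) = scale2 \<beta> (comb2 b1 b2 (\<alpha> / \<beta>, 1))"
      using power_e_eq_1_neq_0[OF \<beta>] by (simp add: comb2_def scale2_def algebra_simps)
    then have "vclass (g (y, 1)) = vclass (comb2 b1 b2 (\<alpha> / \<beta>, 1))"
      unfolding \<alpha> using vclass_scale2[OF \<beta>] by simp
    moreover have "\<alpha> / \<beta> = 0" if "y = 0"
    proof -
      have "comb2 b1 b2 (\<alpha>, \<beta>) = comb2 b1 b2 (0, 1)" using \<alpha> that by (simp add: b2_def)
      then have "(\<alpha>, \<beta>) = (0, 1)" by (rule injD[OF bij_is_inj[OF bij]])
      then show ?thesis by simp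
    qed
    ultimately show ?thesis by blast
  qed
  then obtain f where f: "\<And>y. vclass (g (y, 1)) = vclass (comb2 b1 b2 (f y, 1))" and f0: "f 0 = 0"
    by metis
  have fa: "(f x - f y) ^ e = (x - y) ^ (e * a)" for x y
  proof -
    have "det2 (comb2 b1 b2 (f x, 1)) (comb2 b1 b2 (f y, 1)) = (f x - f y) * b"
      by (simp add: det2_def comb2_def b_def algebra_simps)
    then have "(f x - f y) ^ e = det2 (comb2 b1 b2 (f x, 1)) (comb2 b1 b2 (f y, 1)) ^ e"
      using b by (simp add: power_mult_distrib)
    also have "\<dots> = det2 (g (x, 1)) (g (y, 1)) ^ e"
      by (rule det2_power_e_cong) (simp_all add: f)
    also have "\<dots> = (x - y) ^ (e * a)" using ga[of "(x, 1)" "(y, 1)"] by (simp add: det2_def)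
    finally show ?thesis .
  qed
  define c where "c = f 1"
  have ce: "c ^ e = 1" using fa[of 1 0] f0 by (simp add: c_def)
  have c0: "c \<noteq> 0" by (rule power_e_eq_1_neq_0[OF ce])
  define \<sigma> where "\<sigma> y = f y / c" for y
  have fc: "f y = c * \<sigma> y" for y using c0 by (simp add: \<sigma>_def)
  have \<sigma>a: "(\<sigma> x - \<sigma> y) ^ e = (x - y) ^ (e * a)" for x y
  proof -
    have "\<sigma> x - \<sigma> y = (f x - f y) / c" by (simp add: \<sigma>_def diff_divide_distrib)
    then show ?thesis using fa ce by (simp add: power_divide)
  qed
  have "inj \<sigma>"
  proof (rule injI)
    fix x y assume "\<sigma> x = \<sigma> y"
    then have "(x - y) ^ (e * a) = 0" using \<sigma>a[of x y] by simp
    then show "x = y" by simp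
  qed
  then have "bij \<sigma>" by (simp add: bij_def finite_UNIV_inj_surj)
  moreover have "\<sigma> 0 = 0" "\<sigma> 1 = 1" using f0 c0 by (simp_all add: \<sigma>_def c_def)
  moreover have "e < p" by (simp add: pe)
  ultimately have \<sigma>: "field_hom \<sigma>" using power_residue_map_imp_field_hom[OF p q _ pp] \<sigma>a by blast
  interpret field_hom \<sigma> by (rule \<sigma>)
  define A where "A = mat 2 2 (\<lambda>(i, j). if i = 0 then (if j = 0 then c * fst b1 else fst b2)
      else (if j = 0 then c * snd b1 else snd b2))"
  have Av: "mat_vec2 A v = comb2 b1 b2 (c * fst v, snd v)" for v
    by (simp add: mat_vec2_def A_def comb2_def mult_ac)
  have dA: "mat_det2 A = c * b" by (simp add: mat_det2_def A_def b_def det2_def algebra_simps)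
  have dAe: "(mat_det2 A ^ ((p - 1) div 2)) ^ e = 1"
  proof -
    have "(mat_det2 A ^ ((p - 1) div 2)) ^ e = (mat_det2 A ^ e) ^ ((p - 1) div 2)"
      by (simp flip: power_mult add: mult.commute)
    also have "mat_det2 A ^ e = 1" using b ce by (simp add: dA power_mult_distrib)
    finally show ?thesis by simp
  qed
  have cls: "vclass (semilinear A \<sigma> v) = vclass (comb2 b1 b2 (c * \<sigma> (fst v), \<sigma> (snd v)))" for v
    unfolding semilinear_def Av vclass_scale2[OF dAe] by simp
  have base: "vclass (g u) = vclass (semilinear A \<sigma> u)" if "u = (1, 0) \<or> (\<exists>y. u = (y, 1))" for u
    using that
  proof
    assume u: "u = (1, 0)"
    have "vclass (semilinear A \<sigma> u) = vclass (scale2 c b1)" unfolding cls u by simp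
    also have "\<dots> = vclass (g u)" unfolding vclass_scale2[OF ce] by (simp add: b1_def u)
    finally show ?thesis by simp
  next
    assume "\<exists>y. u = (y, 1)"
    then obtain y where u: "u = (y, 1)" by blast
    show ?thesis unfolding cls u f by (simp add: fc)
  qed
  show ?thesis
  proof (rule that[of A \<sigma>])
    show "A \<in> carrier_mat 2 2" by (simp add: A_def)
    show "mat_det2 A \<noteq> 0" using b0 c0 by (simp add: dA)
    show "field_hom \<sigma>" by (rule \<sigma>)
    fix u :: "'f \<times> 'f" assume u: "u \<noteq> (0, 0)"
    obtain s v where sv: "s \<noteq> 0" "u = scale2 s v" "v = (1, 0) \<or> (\<exists>y. v = (y, 1))"
    proof (cases "snd u = 0")
      case True
      then have "u = scale2 (fst u) (1, 0)" "fst u \<noteq> 0" using u by (cases u, simp add: scale2_def)+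
      then show ?thesis using that by blast
    next
      case False
      then have "u = scale2 (snd u) (fst u / snd u, 1)" by (cases u) (simp add: scale2_def)
      then show ?thesis using that False by blast
    qed
    have v: "v \<noteq> (0, 0)" using sv(3) by auto
    obtain t where t: "g (scale2 s v) = scale2 t (g v)" "t ^ e = s ^ (e * a)" using gs[OF v sv(1)] by blast
    have te: "t ^ e = \<sigma> s ^ e" using t(2) \<sigma>a[of s 0] by simp
    have t0: "t \<noteq> 0" using t(2) sv(1) by auto
    show "vclass (g u) = vclass (semilinear A \<sigma> u)"
      unfolding sv(2) t(1) semilinear_scale2[OF \<sigma>]
      by (rule vclass_scale2_cong[OF base[OF sv(3)] te g0[OF v] t0])
  qed
qed

end

section \<open>The projective semilinear group of degree two\<close>

lemma carrier_GL_2: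
  "carrier (GL 2 TYPE('f::{field,finite})) = {A \<in> carrier_mat 2 2. mat_det2 A \<noteq> 0}"
proof -
  have "A \<in> carrier (GL 2 TYPE('f)) \<longleftrightarrow> A \<in> carrier_mat 2 2 \<and> mat_det2 A \<noteq> 0" for A :: "'f mat"
  proof
    assume "A \<in> carrier (GL 2 TYPE('f))"
    then obtain B where B: "A \<in> carrier_mat 2 2" "B \<in> carrier_mat 2 2" "A * B = 1\<^sub>m 2"
      by (auto simp: GL_def units_of_carrier Units_def ring_mat_def)
    have "mat_det2 A * mat_det2 B = mat_det2 (1\<^sub>m 2)"
      using mat_det2_mult[OF B(1,2)] unfolding B(3) by (rule sym)
    also have "\<dots> = 1" by (rule mat_det2_one)
    finally have "mat_det2 A * mat_det2 B = 1" .
    then show "A \<in> carrier_mat 2 2 \<and> mat_det2 A \<noteq> 0" using B by auto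
  next
    assume *: "A \<in> carrier_mat 2 2 \<and> mat_det2 A \<noteq> 0"
    then have A: "A \<in> carrier_mat 2 2" by simp
    define B where "B = inverse (mat_det2 A) \<cdot>\<^sub>m
      mat 2 2 (\<lambda>(i, j). if i = j then A $$ (1 - i, 1 - j) else - A $$ (i, j))"
    have B: "B \<in> carrier_mat 2 2" by (simp add: B_def)
    have Bi: "B $$ (0, 0) = inverse (mat_det2 A) * A $$ (1, 1)"
      "B $$ (0, 1) = - inverse (mat_det2 A) * A $$ (0, 1)"
      "B $$ (1, 0) = - inverse (mat_det2 A) * A $$ (1, 0)"
      "B $$ (1, 1) = inverse (mat_det2 A) * A $$ (0, 0)"
      by (simp_all add: B_def)
    have d: "inverse (mat_det2 A) * (A $$ (0, 0) * A $$ (1, 1) - A $$ (0, 1) * A $$ (1, 0)) = 1"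
      using * by (simp add: mat_det2_def)
    have "A * B = 1\<^sub>m 2"
      by (rule eq_mat_2I)
        (use A B d in \<open>simp_all add: mult_mat_2_entries[OF A B] Bi algebra_simps del: index_mult_mat One_nat_def\<close>)
    moreover have "B * A = 1\<^sub>m 2"
      by (rule eq_mat_2I)
        (use A B d in \<open>simp_all add: mult_mat_2_entries[OF B A] Bi algebra_simps del: index_mult_mat One_nat_def\<close>)
    ultimately show "A \<in> carrier (GL 2 TYPE('f))"
      using A B by (auto simp: GL_def units_of_carrier Units_def ring_mat_def)
  qed
  then show ?thesis by blast
qed

definition proj_class :: "'f::{field,finite} mat \<Rightarrow> 'f mat set" where
  "proj_class A = {c \<cdot>\<^sub>m A | c. c \<noteq> 0}"

lemma proj_class_self: "A \<in> proj_class A"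
  unfolding proj_class_def
proof (rule CollectI, intro exI conjI)
  show "A = 1 \<cdot>\<^sub>m A" by (rule eq_matI) auto
qed simp

lemma mult_GL: "A \<otimes>\<^bsub>GL n TYPE('f::field)\<^esub> B = A * B"
  by (simp add: GL_def units_of_def ring_mat_def)

lemma carrier_PGL_2:
  "carrier (PGL 2 TYPE('f::{field,finite})) = {proj_class A | A. A \<in> carrier_mat 2 2 \<and> mat_det2 A \<noteq> 0}"
proof -
  have "scalar_mats 2 TYPE('f) #>\<^bsub>GL 2 TYPE('f)\<^esub> A = proj_class A" if A: "A \<in> carrier_mat 2 2" for A
  proof -
    have "c \<cdot>\<^sub>m 1\<^sub>m 2 * A = c \<cdot>\<^sub>m A" for c
      using mult_smult_assoc_mat[OF one_carrier_mat A, of c] left_mult_one_mat[OF A] by simp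
    then show ?thesis by (auto simp: r_coset_def scalar_mats_def proj_class_def mult_GL)
  qed
  then show ?thesis
    unfolding PGL_def FactGroup_def RCOSETS_def partial_object.simps carrier_GL_2 by auto
qed

lemma mult_PGL_2:
  assumes "A \<in> carrier_mat 2 2" "B \<in> carrier_mat 2 2"
  shows "proj_class A \<otimes>\<^bsub>PGL 2 TYPE('f::{field,finite})\<^esub> proj_class B = proj_class (A * B)"
proof -
  have m: "(c \<cdot>\<^sub>m A) * (d \<cdot>\<^sub>m B) = (c * d) \<cdot>\<^sub>m (A * B)" for c d
  proof -
    have "d \<cdot>\<^sub>m B \<in> carrier_mat 2 2" using assms(2) by simp
    then have "(c \<cdot>\<^sub>m A) * (d \<cdot>\<^sub>m B) = c \<cdot>\<^sub>m (A * (d \<cdot>\<^sub>m B))"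
      by (rule mult_smult_assoc_mat[OF assms(1)])
    also have "A * (d \<cdot>\<^sub>m B) = d \<cdot>\<^sub>m (A * B)" by (rule mult_smult_distrib[OF assms])
    also have "c \<cdot>\<^sub>m (d \<cdot>\<^sub>m (A * B)) = (c * d) \<cdot>\<^sub>m (A * B)" by (rule eq_matI) (auto simp: mult.assoc)
    finally show ?thesis .
  qed
  have "proj_class A \<otimes>\<^bsub>PGL 2 TYPE('f)\<^esub> proj_class B = {X * Y | X Y. X \<in> proj_class A \<and> Y \<in> proj_class B}"
    by (auto simp: PGL_def FactGroup_def set_mult_def mult_GL)
  also have "\<dots> = proj_class (A * B)"
  proof (intro equalityI subsetI)
    fix Z assume "Z \<in> {X * Y | X Y. X \<in> proj_class A \<and> Y \<in> proj_class B}"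
    then obtain c d where "c \<noteq> 0" "d \<noteq> 0" "Z = (c \<cdot>\<^sub>m A) * (d \<cdot>\<^sub>m B)" by (auto simp: proj_class_def)
    then show "Z \<in> proj_class (A * B)" unfolding m proj_class_def by force
  next
    fix Z assume "Z \<in> proj_class (A * B)"
    then obtain c where c: "c \<noteq> 0" "Z = c \<cdot>\<^sub>m (A * B)" by (auto simp: proj_class_def)
    have "Z = (c \<cdot>\<^sub>m A) * B" using mult_smult_assoc_mat[OF assms, of c] c(2) by simp
    moreover have "c \<cdot>\<^sub>m A \<in> proj_class A" using c(1) by (auto simp: proj_class_def)
    ultimately show "Z \<in> {X * Y | X Y. X \<in> proj_class A \<and> Y \<in> proj_class B}"
      using proj_class_self[of B] by blast
  qed
  finally show ?thesis .
qed

lemma carrier_field_aut_group: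
  "carrier (field_aut_group TYPE('f::{field,finite})) = {\<sigma>. field_hom \<sigma>}"
  by (auto simp: field_aut_group_def Bij_def field_hom_surj)

lemma mult_field_aut_group:
  assumes "field_hom \<sigma>" "field_hom \<tau>"
  shows "\<sigma> \<otimes>\<^bsub>field_aut_group TYPE('f::{field,finite})\<^esub> \<tau> = \<sigma> \<circ> \<tau>"
  using field_hom_surj[OF assms(1)] field_hom_surj[OF assms(2)]
  by (auto simp: field_aut_group_def BijGroup_def Bij_def compose_def)

lemma map_mat_proj_class:
  fixes \<sigma> :: "'f::{field,finite} \<Rightarrow> 'f"
  assumes "field_hom \<sigma>"
  shows "map_mat \<sigma> ` proj_class A = proj_class (map_mat \<sigma> A)"
proof -
  interpret field_hom \<sigma> by fact
  have m: "map_mat \<sigma> (c \<cdot>\<^sub>m A) = \<sigma> c \<cdot>\<^sub>m map_mat \<sigma> A" for c by (rule eq_matI) (auto simp: hom_mult)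
  show ?thesis
  proof (intro equalityI subsetI)
    fix Z assume "Z \<in> map_mat \<sigma> ` proj_class A"
    then obtain c where "c \<noteq> 0" "Z = \<sigma> c \<cdot>\<^sub>m map_mat \<sigma> A" by (auto simp: proj_class_def m)
    then show "Z \<in> proj_class (map_mat \<sigma> A)" by (auto simp: proj_class_def)
  next
    fix Z assume "Z \<in> proj_class (map_mat \<sigma> A)"
    then obtain c where c: "c \<noteq> 0" "Z = c \<cdot>\<^sub>m map_mat \<sigma> A" by (auto simp: proj_class_def)
    obtain d where d: "c = \<sigma> d" using surjD[OF bij_is_surj[OF field_hom_surj[OF assms]], of c] by blast
    then have "d \<cdot>\<^sub>m A \<in> proj_class A" using c(1) by (auto simp: proj_class_def)
    moreover have "Z = map_mat \<sigma> (d \<cdot>\<^sub>m A)" by (simp add: m c d)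
    ultimately show "Z \<in> map_mat \<sigma> ` proj_class A" by blast
  qed
qed

lemma carrier_PGammaL_2:
  "carrier (PGammaL 2 TYPE('f::{field,finite})) =
     {(proj_class A, \<sigma>) | A \<sigma>. A \<in> carrier_mat 2 2 \<and> mat_det2 A \<noteq> 0 \<and> field_hom \<sigma>}"
  by (auto simp: PGammaL_def semidirect_product_def carrier_PGL_2 carrier_field_aut_group)

lemma mult_PGammaL_2:
  assumes "A \<in> carrier_mat 2 2" "B \<in> carrier_mat 2 2" "field_hom \<sigma>" "field_hom \<tau>"
  shows "(proj_class A, \<sigma>) \<otimes>\<^bsub>PGammaL 2 TYPE('f::{field,finite})\<^esub> (proj_class B, \<tau>) =
    (proj_class (A * map_mat \<sigma> B), \<sigma> \<circ> \<tau>)"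
  using assms by (simp add: PGammaL_def semidirect_product_def map_mat_proj_class mult_PGL_2 mult_field_aut_group)

section \<open>The automorphism groups of the digraphs\<close>

context mathon_field
begin

definition class_action :: "'f mat set \<times> ('f \<Rightarrow> 'f) \<Rightarrow> nat \<Rightarrow> nat" where
  "class_action x = (\<lambda>\<alpha>\<in>vertices.
     vclass (semilinear (SOME A. A \<in> fst x) (snd x) (SOME u. u \<noteq> (0, 0) \<and> vclass u = \<alpha>)))"

text \<open>The scalar \<open>c\<close> relating two representing matrices contributes the factor \<open>c ^ p \<in> K\<close>.\<close>
lemma class_action_vclass:
  assumes A: "A \<in> carrier_mat 2 2" and \<sigma>: "field_hom \<sigma>" and u: "u \<noteq> (0, 0)"
  shows "class_action (proj_class A, \<sigma>) (vclass u) = vclass (semilinear A \<sigma> u)"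
proof -
  define B where "B = (SOME B. B \<in> proj_class A)"
  define v where "v = (SOME v. v \<noteq> (0, 0) \<and> vclass v = vclass u)"
  have "B \<in> proj_class A" unfolding B_def using proj_class_self by (rule someI)
  then obtain c where c: "c \<noteq> 0" "B = c \<cdot>\<^sub>m A" by (auto simp: proj_class_def)
  have "v \<noteq> (0, 0) \<and> vclass v = vclass u" unfolding v_def by (rule someI[of _ u]) (use u in simp)
  then have v: "vclass v = vclass u" by simp
  have "class_action (proj_class A, \<sigma>) (vclass u) = vclass (semilinear B \<sigma> v)"
    using vertexI[OF u] by (simp add: class_action_def B_def v_def)
  also have "\<dots> = vclass (semilinear A \<sigma> v)"
    unfolding c(2) semilinear_smult[OF A] by (rule vclass_scale2[OF power_p_power_e[OF c(1)]])
  also have "\<dots> = vclass (semilinear A \<sigma> u)" by (rule semilinear_vclass_cong[OF \<sigma> v])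
  finally show ?thesis .
qed

lemma class_action_in_aut:
  assumes S: "paley_set S" and A: "A \<in> carrier_mat 2 2" "mat_det2 A \<noteq> 0" and \<sigma>: "field_hom \<sigma>"
  shows "class_action (proj_class A, \<sigma>) \<in> carrier (digraph_aut_group (mathon_digraph S))"
proof -
  interpret field_hom \<sigma> by (rule \<sigma>)
  let ?f = "class_action (proj_class A, \<sigma>)"
  note act = class_action_vclass[OF A(1) \<sigma>]
  have inj: "inj_on ?f vertices"
  proof (rule inj_onI)
    fix \<alpha> \<beta> assume *: "\<alpha> \<in> vertices" "\<beta> \<in> vertices" "?f \<alpha> = ?f \<beta>"
    obtain u where u: "u \<noteq> (0, 0)" "\<alpha> = vclass u" using *(1) by (rule vertexE)
    obtain v where v: "v \<noteq> (0, 0)" "\<beta> = vclass v" using *(2) by (rule vertexE)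
    have "vclass (semilinear A \<sigma> u) = vclass (semilinear A \<sigma> v)"
      using *(3) unfolding u(2) v(2) act[OF u(1)] act[OF v(1)] .
    then obtain k where k: "k ^ e = 1" "semilinear A \<sigma> v = scale2 k (semilinear A \<sigma> u)"
      unfolding vclass_eq_iff by auto
    have "det2 (semilinear A \<sigma> u) (semilinear A \<sigma> v) = 0" using k(2) by simp
    then have "\<sigma> (det2 u v) = 0" using det2_semilinear[OF \<sigma>, of A u v] A(2) by simp
    then have "det2 u v = 0" by simp
    then obtain s where s: "v = scale2 s u" using det2_eq_0D u(1) by blast
    then have "scale2 (\<sigma> s) (semilinear A \<sigma> u) = scale2 k (semilinear A \<sigma> u)"
      using k(2) semilinear_scale2[OF \<sigma>] by simp
    then have "\<sigma> s = k" using scale2_eq_iff[OF semilinear_neq_0[OF \<sigma> A(2) u(1)]] by blast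
    then have "\<sigma> (s ^ e) = \<sigma> 1" using k(1) by (simp add: hom_power)
    then have "s ^ e = 1" by (simp only: eq_iff)
    then show "\<alpha> = \<beta>" unfolding u(2) v(2) s using vclass_scale2 by simp
  qed
  have "?f ` vertices \<subseteq> vertices"
  proof
    fix \<beta> assume "\<beta> \<in> ?f ` vertices"
    then obtain \<alpha> where \<alpha>: "\<alpha> \<in> vertices" "\<beta> = ?f \<alpha>" by blast
    obtain u where u: "u \<noteq> (0, 0)" "\<alpha> = vclass u" using \<alpha>(1) by (rule vertexE)
    show "\<beta> \<in> vertices" unfolding \<alpha>(2) u(2) act[OF u(1)]
      by (rule vertexI[OF semilinear_neq_0[OF \<sigma> A(2) u(1)]])
  qed
  then have "?f ` vertices = vertices" using endo_inj_surj[OF finite_vertices _ inj] by simp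
  then have "bij_betw ?f vertices vertices" using inj by (simp add: bij_betw_def)
  moreover have "?f \<in> extensional vertices" by (simp add: class_action_def)
  moreover have "(?f \<alpha>, ?f \<beta>) \<in> parcs (mathon_digraph S) \<longleftrightarrow> (\<alpha>, \<beta>) \<in> parcs (mathon_digraph S)"
    if \<alpha>: "\<alpha> \<in> vertices" and \<beta>: "\<beta> \<in> vertices" for \<alpha> \<beta>
  proof -
    obtain u where u: "u \<noteq> (0, 0)" "\<alpha> = vclass u" using \<alpha> by (rule vertexE)
    obtain v where v: "v \<noteq> (0, 0)" "\<beta> = vclass v" using \<beta> by (rule vertexE)
    show ?thesis unfolding u(2) v(2) act[OF u(1)] act[OF v(1)]
        mathon_arc_iff[OF semilinear_neq_0[OF \<sigma> A(2) u(1)] semilinear_neq_0[OF \<sigma> A(2) v(1)]]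
        mathon_arc_iff[OF u(1) v(1)]
      by (rule adjacent_semilinear[OF S \<sigma> A(2) u(1)])
  qed
  ultimately show ?thesis by (simp add: carrier_digraph_aut_group)
qed

text \<open>It is enough that the images of the lines of \<open>(1, 0)\<close>, \<open>(0, 1)\<close> and all \<open>(z, 1)\<close> agree: the first two
  make the columns proportional, \<open>(1, 1)\<close> makes the two factors equal, and \<open>(z, 1)\<close> then gives
  \<open>\<sigma> z = \<tau> z\<close>.\<close>
lemma class_action_inj:
  assumes A: "A \<in> carrier_mat 2 2" "mat_det2 A \<noteq> 0" and \<sigma>: "field_hom \<sigma>"
    and B: "B \<in> carrier_mat 2 2" "mat_det2 B \<noteq> 0" and \<tau>: "field_hom \<tau>"
    and eq: "class_action (proj_class A, \<sigma>) = class_action (proj_class B, \<tau>)"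
  shows "proj_class A = proj_class B" "\<sigma> = \<tau>"
proof -
  interpret s: field_hom \<sigma> by (rule \<sigma>)
  interpret t: field_hom \<tau> by (rule \<tau>)
  have dep: "det2 (mat_vec2 A (map_prod \<sigma> \<sigma> u)) (mat_vec2 B (map_prod \<tau> \<tau> u)) = 0" if "u \<noteq> (0, 0)" for u
  proof -
    have "vclass (semilinear A \<sigma> u) = vclass (semilinear B \<tau> u)"
      unfolding class_action_vclass[OF A(1) \<sigma> that, symmetric] class_action_vclass[OF B(1) \<tau> that, symmetric] eq ..
    then obtain k where "semilinear B \<tau> u = scale2 k (semilinear A \<sigma> u)"
      unfolding vclass_eq_iff by auto
    then have "det2 (semilinear A \<sigma> u) (semilinear B \<tau> u) = 0" by simp
    then show ?thesis using A(2) B(2) by (simp add: semilinear_def)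
  qed
  let ?a = "A $$ (0, 0)" and ?b = "A $$ (0, 1)" and ?c = "A $$ (1, 0)" and ?d = "A $$ (1, 1)"
  let ?a' = "B $$ (0, 0)" and ?b' = "B $$ (0, 1)" and ?c' = "B $$ (1, 0)" and ?d' = "B $$ (1, 1)"
  define a1 where "a1 = (?a, ?c)"
  define a2 where "a2 = (?b, ?d)"
  have Da: "det2 a1 a2 \<noteq> 0" using A(2) by (simp add: a1_def a2_def det2_def mat_det2_def mult.commute)
  have MA: "mat_vec2 A w = comb2 a1 a2 w" for w by (simp add: mat_vec2_def comb2_def a1_def a2_def mult.commute)
  have a10: "a1 \<noteq> (0, 0)" and a20: "a2 \<noteq> (0, 0)" using Da by auto
  have "det2 a1 (?a', ?c') = 0" using dep[of "(1, 0)"] unfolding MA by (simp add: mat_vec2_def)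
  then obtain x where x: "(?a', ?c') = scale2 x a1" using det2_eq_0D a10 by blast
  have "det2 a2 (?b', ?d') = 0" using dep[of "(0, 1)"] unfolding MA by (simp add: mat_vec2_def)
  then obtain y where y: "(?b', ?d') = scale2 y a2" using det2_eq_0D a20 by blast
  have MB: "mat_vec2 B w = comb2 a1 a2 (x * fst w, y * snd w)" for w
    using x y by (auto simp: mat_vec2_def comb2_def a1_def a2_def scale2_def algebra_simps)
  have rel: "\<sigma> z * y = x * \<tau> z" for z
  proof -
    have "det2 (comb2 a1 a2 (\<sigma> z, 1)) (comb2 a1 a2 (x * \<tau> z, y)) = 0"
      using dep[of "(z, 1)"] unfolding MA MB by simp
    moreover have "det2 (comb2 a1 a2 (\<sigma> z, 1)) (comb2 a1 a2 (x * \<tau> z, y)) = (\<sigma> z * y - x * \<tau> z) * det2 a1 a2"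
      by (simp add: det2_def comb2_def algebra_simps)
    ultimately show ?thesis using Da by simp
  qed
  have xy: "y = x" using rel[of 1] by simp
  have x0: "x \<noteq> 0"
  proof
    assume "x = 0"
    then have "B $$ (0, 0) = 0" "B $$ (1, 0) = 0" using x by (auto simp: scale2_def)
    then show False using B(2) by (simp add: mat_det2_def)
  qed
  show "\<sigma> = \<tau>" using rel x0 by (intro ext) (simp add: xy mult.commute)
  have BA: "B = x \<cdot>\<^sub>m A"
    by (rule eq_mat_2I) (use A(1) B(1) x y xy in \<open>auto simp: scale2_def a1_def a2_def\<close>)
  have "proj_class (x \<cdot>\<^sub>m A) = proj_class A"
  proof (intro equalityI subsetI)
    fix Z assume "Z \<in> proj_class (x \<cdot>\<^sub>m A)"
    then obtain c where "c \<noteq> 0" "Z = c \<cdot>\<^sub>m (x \<cdot>\<^sub>m A)" by (auto simp: proj_class_def)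
    moreover have "c \<cdot>\<^sub>m (x \<cdot>\<^sub>m A) = (c * x) \<cdot>\<^sub>m A" by (rule eq_matI) (auto simp: mult.assoc)
    ultimately show "Z \<in> proj_class A" using x0 by (auto simp: proj_class_def)
  next
    fix Z assume "Z \<in> proj_class A"
    then obtain c where "c \<noteq> 0" "Z = c \<cdot>\<^sub>m A" by (auto simp: proj_class_def)
    moreover have "c \<cdot>\<^sub>m A = (c / x) \<cdot>\<^sub>m (x \<cdot>\<^sub>m A)" using x0 by (intro eq_matI) auto
    ultimately show "Z \<in> proj_class (x \<cdot>\<^sub>m A)" using x0 by (auto simp: proj_class_def)
  qed
  then show "proj_class A = proj_class B" using BA by simp
qed

lemma digraph_map_semilinear:
  assumes S: "paley_set S" and S': "paley_set S'"
    and bij: "bij_betw \<phi> vertices vertices"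
    and arcs: "\<And>\<alpha> \<beta>. \<alpha> \<in> vertices \<Longrightarrow> \<beta> \<in> vertices \<Longrightarrow>
      (\<phi> \<alpha>, \<phi> \<beta>) \<in> parcs (mathon_digraph S') \<longleftrightarrow> (\<alpha>, \<beta>) \<in> parcs (mathon_digraph S)"
  obtains A \<sigma> where "A \<in> carrier_mat 2 2" "mat_det2 A \<noteq> 0" "field_hom \<sigma>"
    "\<And>\<alpha>. \<alpha> \<in> vertices \<Longrightarrow> \<phi> \<alpha> = class_action (proj_class A, \<sigma>) \<alpha>"
proof -
  obtain g where g: "cover_map g" "\<And>u. u \<noteq> (0, 0) \<Longrightarrow> \<phi> (vclass u) = vclass (g u)"
    using digraph_map_imp_cover_map[OF S S' bij arcs] by blast
  obtain A \<sigma> where A: "A \<in> carrier_mat 2 2" "mat_det2 A \<noteq> 0" and \<sigma>: "field_hom \<sigma>"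
    and gA: "\<And>u. u \<noteq> (0, 0) \<Longrightarrow> vclass (g u) = vclass (semilinear A \<sigma> u)"
    using cover_map_semilinear[OF g(1)] by metis
  have "\<phi> \<alpha> = class_action (proj_class A, \<sigma>) \<alpha>" if \<alpha>: "\<alpha> \<in> vertices" for \<alpha>
  proof -
    obtain u where u: "u \<noteq> (0, 0)" "\<alpha> = vclass u" using \<alpha> by (rule vertexE)
    show ?thesis unfolding u(2) class_action_vclass[OF A(1) \<sigma> u(1)] g(2)[OF u(1)] by (rule gA[OF u(1)])
  qed
  then show ?thesis using that A \<sigma> by blast
qed

theorem mathon_digraph_aut_group:
  assumes S: "paley_set S"
  shows "digraph_aut_group (mathon_digraph S) \<cong> PGammaL 2 TYPE('f)"
proof -
  let ?P = "PGammaL 2 TYPE('f)" and ?A = "digraph_aut_group (mathon_digraph S)"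
  have in_aut: "class_action x \<in> carrier ?A" if "x \<in> carrier ?P" for x
    using that class_action_in_aut[OF S] unfolding carrier_PGammaL_2 by blast
  have prod: "x \<otimes>\<^bsub>?P\<^esub> y \<in> carrier ?P \<and> class_action (x \<otimes>\<^bsub>?P\<^esub> y) = class_action x \<otimes>\<^bsub>?A\<^esub> class_action y"
    if xy: "x \<in> carrier ?P" "y \<in> carrier ?P" for x y
  proof -
    obtain A \<sigma> B \<tau> where x: "x = (proj_class A, \<sigma>)" and A: "A \<in> carrier_mat 2 2" "mat_det2 A \<noteq> 0"
      and \<sigma>: "field_hom \<sigma>" and y: "y = (proj_class B, \<tau>)" and B: "B \<in> carrier_mat 2 2" "mat_det2 B \<noteq> 0"
      and \<tau>: "field_hom \<tau>"
      using xy unfolding carrier_PGammaL_2 by blast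
    interpret field_hom \<sigma> by (rule \<sigma>)
    have mB: "map_mat \<sigma> B \<in> carrier_mat 2 2" using B by simp
    have AB: "A * map_mat \<sigma> B \<in> carrier_mat 2 2" using A(1) mB by (rule mult_carrier_mat)
    have "mat_det2 (A * map_mat \<sigma> B) \<noteq> 0"
      using A(2) B(2) by (simp add: mat_det2_mult[OF A(1) mB] mat_det2_map_mat[OF \<sigma> B(1)])
    then have "(proj_class (A * map_mat \<sigma> B), \<sigma> \<circ> \<tau>) \<in> carrier ?P"
      unfolding carrier_PGammaL_2 using AB field_hom_comp[OF \<sigma> \<tau>] by blast
    moreover have "class_action (proj_class (A * map_mat \<sigma> B), \<sigma> \<circ> \<tau>) \<alpha>
        = compose vertices (class_action (proj_class A, \<sigma>)) (class_action (proj_class B, \<tau>)) \<alpha>" for \<alpha>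
    proof (cases "\<alpha> \<in> vertices")
      case True
      then obtain u where u: "u \<noteq> (0, 0)" "\<alpha> = vclass u" by (rule vertexE)
      show ?thesis unfolding compose_eq[OF True] unfolding u(2)
          class_action_vclass[OF B(1) \<tau> u(1)]
          class_action_vclass[OF A(1) \<sigma> semilinear_neq_0[OF \<tau> B(2) u(1)]]
          class_action_vclass[OF AB field_hom_comp[OF \<sigma> \<tau>] u(1)] semilinear_comp[OF A(1) B(1) \<sigma>] ..
    next
      case False
      then show ?thesis by (simp add: class_action_def compose_def)
    qed
    then have "class_action (proj_class (A * map_mat \<sigma> B), \<sigma> \<circ> \<tau>)
        = class_action (proj_class A, \<sigma>) \<otimes>\<^bsub>?A\<^esub> class_action (proj_class B, \<tau>)"
      using mult_digraph_aut_group[OF class_action_in_aut[OF S A \<sigma>] class_action_in_aut[OF S B \<tau>]]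
      by (simp add: fun_eq_iff)
    ultimately show ?thesis unfolding x y mult_PGammaL_2[OF A(1) B(1) \<sigma> \<tau>] by blast
  qed
  have "class_action \<in> hom ?P ?A" using in_aut prod by (intro homI) blast+
  moreover have "inj_on class_action (carrier ?P)"
  proof (rule inj_onI)
    fix x y assume "x \<in> carrier ?P" "y \<in> carrier ?P" and eq: "class_action x = class_action y"
    then obtain A \<sigma> B \<tau> where x: "x = (proj_class A, \<sigma>)" "A \<in> carrier_mat 2 2" "mat_det2 A \<noteq> 0" "field_hom \<sigma>"
      and y: "y = (proj_class B, \<tau>)" "B \<in> carrier_mat 2 2" "mat_det2 B \<noteq> 0" "field_hom \<tau>"
      unfolding carrier_PGammaL_2 by blast
    show "x = y" using class_action_inj[OF x(2-4) y(2-4)] eq unfolding x(1) y(1) by blast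
  qed
  moreover have "class_action ` carrier ?P = carrier ?A"
  proof
    show "class_action ` carrier ?P \<subseteq> carrier ?A" using in_aut by blast
    show "carrier ?A \<subseteq> class_action ` carrier ?P"
    proof
      fix \<phi> assume "\<phi> \<in> carrier ?A"
      then have \<phi>: "\<phi> \<in> extensional vertices" "bij_betw \<phi> vertices vertices"
        "\<And>\<alpha> \<beta>. \<alpha> \<in> vertices \<Longrightarrow> \<beta> \<in> vertices \<Longrightarrow>
          (\<phi> \<alpha>, \<phi> \<beta>) \<in> parcs (mathon_digraph S) \<longleftrightarrow> (\<alpha>, \<beta>) \<in> parcs (mathon_digraph S)"
        by (auto simp: carrier_digraph_aut_group)
      obtain A \<sigma> where A: "A \<in> carrier_mat 2 2" "mat_det2 A \<noteq> 0" "field_hom \<sigma>"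
        "\<And>\<alpha>. \<alpha> \<in> vertices \<Longrightarrow> \<phi> \<alpha> = class_action (proj_class A, \<sigma>) \<alpha>"
        using digraph_map_semilinear[OF S S \<phi>(2,3)] by metis
      have "\<phi> = class_action (proj_class A, \<sigma>)"
      proof (rule extensionalityI[OF \<phi>(1)])
        show "class_action (proj_class A, \<sigma>) \<in> extensional vertices"
          unfolding class_action_def by (rule restrict_extensional)
      qed (rule A(4))
      moreover have "(proj_class A, \<sigma>) \<in> carrier ?P" unfolding carrier_PGammaL_2 using A(1-3) by blast
      ultimately show "\<phi> \<in> class_action ` carrier ?P" by blast
    qed
  qed
  ultimately have "class_action \<in> iso ?P ?A" by (simp add: iso_iff)
  then show ?thesis by (rule iso_converse_of_closed) (use prod in blast)
qed

text \<open>The map is induced by a semilinear map, which is also an automorphism of the digraph of \<open>S'\<close>.\<close>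
lemma mathon_digraph_map_imp_eq:
  assumes S: "paley_set S" and S': "paley_set S'"
    and bij: "bij_betw \<phi> vertices vertices"
    and arcs: "\<And>\<alpha> \<beta>. \<alpha> \<in> vertices \<Longrightarrow> \<beta> \<in> vertices \<Longrightarrow>
      (\<phi> \<alpha>, \<phi> \<beta>) \<in> parcs (mathon_digraph S') \<longleftrightarrow> (\<alpha>, \<beta>) \<in> parcs (mathon_digraph S)"
  shows "S = S'"
proof -
  obtain A \<sigma> where A: "A \<in> carrier_mat 2 2" "mat_det2 A \<noteq> 0" and \<sigma>: "field_hom \<sigma>"
    and \<phi>: "\<And>\<alpha>. \<alpha> \<in> vertices \<Longrightarrow> \<phi> \<alpha> = class_action (proj_class A, \<sigma>) \<alpha>"
    using digraph_map_semilinear[OF S S' bij arcs] by metis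
  have "(\<alpha>, \<beta>) \<in> parcs (mathon_digraph S') \<longleftrightarrow> (\<alpha>, \<beta>) \<in> parcs (mathon_digraph S)"
    if "\<alpha> \<in> vertices" "\<beta> \<in> vertices" for \<alpha> \<beta>
    using class_action_in_aut[OF S' A \<sigma>] arcs[OF that] that \<phi> by (simp add: carrier_digraph_aut_group)
  then have adj: "adjacent S' u v \<longleftrightarrow> adjacent S u v" if "u \<noteq> (0, 0)" "v \<noteq> (0, 0)" for u v
    using mathon_arc_iff[OF that] vertexI[OF that(1)] vertexI[OF that(2)] by blast
  have mem: "s ^ e \<in> T \<longleftrightarrow> adjacent T (1, 0) (scale2 s (1, 0))" for s T
    using scale2_eq_iff[of "(1, 0) :: 'f \<times> 'f"] by (auto simp: adjacent_def)
  have "z \<in> S \<longleftrightarrow> z \<in> S'" if z: "z \<in> mu" for z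
  proof -
    obtain s where s: "s \<noteq> 0" "s ^ e = z" using ex_power_e[OF z] by blast
    then show ?thesis using mem[of s S] mem[of s S'] adj[of "(1, 0)" "scale2 s (1, 0)"] by simp
  qed
  then show ?thesis using paley_set_mu[OF S] paley_set_mu[OF S'] by blast
qed

end

section \<open>Two nonisomorphic digraphs\<close>

lemma parameters:
  fixes p q :: nat
  assumes p: "prime p" "p mod 4 = 3" and q: "real q - 1 = real p * (real p - 3) / 4"
  obtains e where "p = 4 * e + 3" "q = 1 + p * e" "(q - 1) div p = e"
proof -
  define e where "e = p div 4"
  have pe: "p = 4 * e + 3" using p(2) mult_div_mod_eq[of 4 p] by (simp add: e_def)
  have "real q = 1 + real p * (real (4 * e + 3) - 3) / 4" using q by (simp flip: pe)
  also have "\<dots> = real (1 + p * e)" by simp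
  finally have qe: "q = 1 + p * e" by (simp only: of_nat_eq_iff)
  have "(q - 1) div p = e" using qe prime_gt_0_nat[OF p(1)] by simp
  then show ?thesis using that pe qe by blast
qed

theorem theorem1p1:
  fixes p q :: nat
  assumes "prime p" and "primepow q" and "p mod 4 = 3"
    and "real q - 1 = real p * (real p - 3) / 4"
    and "CARD('f::{field,finite}) = q"
  shows "\<exists>(G :: nat pair_pre_digraph) (H :: nat pair_pre_digraph).
    directed_strongly_regular_graph G
      ((q + 1) * p) (q + (p - 1) div 2) q ((q - 1) div p) ((q - 1) div p + 1) \<and>
    directed_strongly_regular_graph H
      ((q + 1) * p) (q + (p - 1) div 2) q ((q - 1) div p) ((q - 1) div p + 1) \<and>
    \<not> digraph_iso (with_proj G) (with_proj H) \<and>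
    digraph_aut_group G \<cong> PGammaL 2 TYPE('f) \<and>
    digraph_aut_group H \<cong> PGammaL 2 TYPE('f)"
proof -
  obtain e where e: "p = 4 * e + 3" "q = 1 + p * e" "(q - 1) div p = e"
    using parameters[OF assms(1,3,4)] by blast
  interpret mathon_field p e "TYPE('f)"
    by unfold_locales (use assms e in auto)
  obtain S where S: "paley_set S" using ex_paley_set by blast
  define S' where "S' = inverse ` S"
  have S': "paley_set S'" unfolding S'_def by (rule paley_set_inverse[OF S])
  have neq: "S \<noteq> S'"
  proof
    assume eq: "S = S'"
    have "S \<noteq> {}" using card_paley_set[OF S] by auto
    then obtain z where z: "z \<in> S" by blast
    then have "inverse z \<in> S" using eq S'_def by blast
    moreover have "z \<in> mu" "z \<noteq> 1" using S z by (auto simp: paley_set_def)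
    ultimately show False using S z by (simp add: paley_set_def)
  qed
  have "directed_strongly_regular_graph (mathon_digraph T)
      ((q + 1) * p) (q + (p - 1) div 2) q ((q - 1) div p) ((q - 1) div p + 1)" if "paley_set T" for T
    using mathon_digraph_dsrg[OF that] unfolding assms(5) e(3) .
  moreover have "\<not> digraph_iso (with_proj (mathon_digraph S)) (with_proj (mathon_digraph S'))"
  proof
    assume "digraph_iso (with_proj (mathon_digraph S)) (with_proj (mathon_digraph S'))"
    then obtain \<phi> where \<phi>: "bij_betw \<phi> vertices vertices"
      "\<And>\<alpha> \<beta>. \<alpha> \<in> vertices \<Longrightarrow> \<beta> \<in> vertices \<Longrightarrow>
        (\<phi> \<alpha>, \<phi> \<beta>) \<in> parcs (mathon_digraph S') \<longleftrightarrow> (\<alpha>, \<beta>) \<in> parcs (mathon_digraph S)"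
      by (auto elim: digraph_iso_with_projE)
    then have "S = S'" by (rule mathon_digraph_map_imp_eq[OF S S'])
    then show False using neq by simp
  qed
  ultimately show ?thesis using S S' mathon_digraph_aut_group by blast
qed

end
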